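(* The theory $\mathsf{ACA}_0^{\omega}$ proves: if $f:[0,1]\to\mathbb R$ is upper semi-continuous and $(f_n)_{n\in\mathbb N}$ is a sequence of continuous functions that converges pointwise to $f$ on $[0,1]$, then $C_f\neq\emptyset$, i.e. there is a point of $[0,1]$ at which $f$ is continuous.
   Context: Formal setting. $\mathsf{RCA}_0^{\omega}$ is Kohlenbach's base theory of higher-order Reverse Mathematics: a classical theory in the language of all finite types (type $0$ is the natural numbers, $\sigma\to\tau$ is the type of maps from type $\sigma$ to type $\tau$ objects, $1:=0\to 0$, $n+1:=n\to 0$; equality at higher types is defined pointwise from equality at type $0$), with axioms: ordered semi-ring axioms for $0,1,<,+,\times$; combinator axioms giving $\lambda$-abstraction; primitive recursion $\mathbf R_0(f,m,0)=m$, $\mathbf R_0(f,m,n+1)=f(n,\mathbf R_0(f,m,n))$ for number-valued $f$ on numbers; extensionality $x=_\rho y\to\varphi(x)=_\tau\varphi(y)$ at all types; induction for quantifier-free formulas (parameters of any type allowed); and $\mathsf{QF\text{-}AC}^{1,0}$, where $\mathsf{QF\text{-}AC}^{\sigma,\tau}$ is the schema $(\forall x^\sigma)(\exists y^\tau)A(x,y)\to(\exists Y^{\sigma\to\tau})(\forall x^\sigma)A(x,Y(x))$ for quantifier-free $A$. $\mathsf{ACA}_0^{\omega}$ is $\mathsf{RCA}_0^{\omega}$ plus $(\exists^2)$: there is $\varphi:\mathbb N^{\mathbb N}\to\{0,1\}$ with $\varphi(f)=0\leftrightarrow(\exists n)(f(n)=0)$ for all $f\in\mathbb N^{\mathbb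 N}$. Reals are fast-converging Cauchy sequences of rationals ($|q_n-q_{n+i}|<2^{-n}$) with the usual $=_{\mathbb R},<_{\mathbb R}$; functions on reals are type $1\to1$ objects respecting $=_{\mathbb R}$, with the usual epsilon-delta definition of continuity. Limits superior need not exist as objects; (in)equalities involving them are shorthand for the usual formulas. $f:[0,1]\to\mathbb R$ is upper semi-continuous if $f(x_0)\ge\limsup_{x\to x_0}f(x)$ for all $x_0\in[0,1]$. $C_f$ is the set of points at which $f$ is continuous. *)

theory Defs
  imports Main
begin

text \<open>
  A deep embedding of Kohlenbach's higher-order systems: the language of all finite types,
  classical natural deduction, the theories \<open>RCA\<^sub>0\<^sup>\<omega>\<close> and \<open>ACA\<^sub>0\<^sup>\<omega>\<close>, and the
  coding of rationals, reals and real functions in that language.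
\<close>

section \<open>Types, terms and formulas\<close>

datatype ty = Ty0 | Arr ty ty (infixr "\<Rrightarrow>" 60)

abbreviation Ty1 :: ty where "Ty1 \<equiv> Ty0 \<Rrightarrow> Ty0"
abbreviation Ty2 :: ty where "Ty2 \<equiv> Ty1 \<Rrightarrow> Ty0"

text \<open>
  A variable is a pair of an index and a type; the same index at two types gives two
  different variables.  \<open>CombK\<close>, \<open>CombS\<close> are Kohlenbach's \<open>\<Pi>\<close>, \<open>\<Sigma>\<close>, with their type
  indices; \<open>Rec\<close> is the recursor \<open>R\<^sub>0\<close>.
\<close>

datatype tm =
    Var nat ty
  | Zero
  | One
  | Plus
  | Times
  | CombK ty ty
  | CombS ty ty ty
  | Rec
  | App tm tm (infixl "\<cdot>" 100)

text \<open>The type of a term; the value is meaningful only for well-typed terms.\<close>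

fun ty_of :: "tm \<Rightarrow> ty" where
  "ty_of (Var k \<sigma>) = \<sigma>"
| "ty_of Zero = Ty0"
| "ty_of One = Ty0"
| "ty_of Plus = Ty0 \<Rrightarrow> Ty0 \<Rrightarrow> Ty0"
| "ty_of Times = Ty0 \<Rrightarrow> Ty0 \<Rrightarrow> Ty0"
| "ty_of (CombK \<sigma> \<tau>) = \<sigma> \<Rrightarrow> \<tau> \<Rrightarrow> \<sigma>"
| "ty_of (CombS \<rho> \<sigma> \<tau>) = (\<rho> \<Rrightarrow> \<sigma> \<Rrightarrow> \<tau>) \<Rrightarrow> (\<rho> \<Rrightarrow> \<sigma>) \<Rrightarrow> \<rho> \<Rrightarrow> \<tau>"
| "ty_of Rec = (Ty0 \<Rrightarrow> Ty0 \<Rrightarrow> Ty0) \<Rrightarrow> Ty0 \<Rrightarrow> Ty0 \<Rrightarrow> Ty0"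
| "ty_of (s \<cdot> t) = (case ty_of s of Ty0 \<Rightarrow> Ty0 | \<sigma> \<Rrightarrow> \<tau> \<Rightarrow> \<tau>)"

fun wt :: "tm \<Rightarrow> bool" where
  "wt (s \<cdot> t) \<longleftrightarrow> wt s \<and> wt t \<and> (\<exists>\<tau>. ty_of s = ty_of t \<Rrightarrow> \<tau>)"
| "wt _ \<longleftrightarrow> True"

fun vars :: "tm \<Rightarrow> (nat \<times> ty) set" where
  "vars (Var k \<sigma>) = {(k, \<sigma>)}"
| "vars (s \<cdot> t) = vars s \<union> vars t"
| "vars _ = {}"

fun subst_tm :: "tm \<Rightarrow> nat \<Rightarrow> ty \<Rightarrow> tm \<Rightarrow> tm" where
  "subst_tm (Var j \<tau>) k \<sigma> t = (if (j, \<tau>) = (k, \<sigma>) then t else Var j \<tau>)"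
| "subst_tm (s \<cdot> s') k \<sigma> t = subst_tm s k \<sigma> t \<cdot> subst_tm s' k \<sigma> t"
| "subst_tm s k \<sigma> t = s"

text \<open>Equality and order are primitive at type 0 only.\<close>

datatype fm =
    Eq tm tm (infix "\<^bold>=" 50)
  | Less tm tm (infix "\<^bold><" 50)
  | Falsum
  | Imp fm fm (infixr "\<^bold>\<longrightarrow>" 25)
  | Forall nat ty fm

abbreviation Neg :: "fm \<Rightarrow> fm" ("\<^bold>\<not> _" [40] 40) where
  "\<^bold>\<not> \<phi> \<equiv> \<phi> \<^bold>\<longrightarrow> Falsum"
abbreviation Conj :: "fm \<Rightarrow> fm \<Rightarrow> fm" (infixr "\<^bold>\<and>" 35) where
  "\<phi> \<^bold>\<and> \<psi> \<equiv> \<^bold>\<not> (\<phi> \<^bold>\<longrightarrow> \<^bold>\<not> \<psi>)"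
abbreviation Disj :: "fm \<Rightarrow> fm \<Rightarrow> fm" (infixr "\<^bold>\<or>" 30) where
  "\<phi> \<^bold>\<or> \<psi> \<equiv> \<^bold>\<not> \<phi> \<^bold>\<longrightarrow> \<psi>"
abbreviation Iff :: "fm \<Rightarrow> fm \<Rightarrow> fm" (infix "\<^bold>\<longleftrightarrow>" 25) where
  "\<phi> \<^bold>\<longleftrightarrow> \<psi> \<equiv> (\<phi> \<^bold>\<longrightarrow> \<psi>) \<^bold>\<and> (\<psi> \<^bold>\<longrightarrow> \<phi>)"
abbreviation Exists :: "nat \<Rightarrow> ty \<Rightarrow> fm \<Rightarrow> fm" where
  "Exists k \<sigma> \<phi> \<equiv> \<^bold>\<not> Forall k \<sigma> (\<^bold>\<not> \<phi>)"

fun wf_fm :: "fm \<Rightarrow> bool" where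
  "wf_fm (s \<^bold>= t) \<longleftrightarrow> wt s \<and> wt t \<and> ty_of s = Ty0 \<and> ty_of t = Ty0"
| "wf_fm (s \<^bold>< t) \<longleftrightarrow> wt s \<and> wt t \<and> ty_of s = Ty0 \<and> ty_of t = Ty0"
| "wf_fm Falsum \<longleftrightarrow> True"
| "wf_fm (\<phi> \<^bold>\<longrightarrow> \<psi>) \<longleftrightarrow> wf_fm \<phi> \<and> wf_fm \<psi>"
| "wf_fm (Forall k \<sigma> \<phi>) \<longleftrightarrow> wf_fm \<phi>"

fun fvs :: "fm \<Rightarrow> (nat \<times> ty) set" where
  "fvs (s \<^bold>= t) = vars s \<union> vars t"
| "fvs (s \<^bold>< t) = vars s \<union> vars t"
| "fvs Falsum = {}"
| "fvs (\<phi> \<^bold>\<longrightarrow> \<psi>) = fvs \<phi> \<union> fvs \<psi>"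
| "fvs (Forall k \<sigma> \<phi>) = fvs \<phi> - {(k, \<sigma>)}"

text \<open>
  \<open>subst_fm \<phi> k \<sigma> t\<close> replaces the free occurrences of the variable \<open>(k, \<sigma>)\<close> by \<open>t\<close> without
  renaming; \<open>free_for t k \<sigma> \<phi>\<close> says that no variable of \<open>t\<close> is captured.
\<close>

fun subst_fm :: "fm \<Rightarrow> nat \<Rightarrow> ty \<Rightarrow> tm \<Rightarrow> fm" where
  "subst_fm (s \<^bold>= s') k \<sigma> t = (subst_tm s k \<sigma> t \<^bold>= subst_tm s' k \<sigma> t)"
| "subst_fm (s \<^bold>< s') k \<sigma> t = (subst_tm s k \<sigma> t \<^bold>< subst_tm s' k \<sigma> t)"
| "subst_fm Falsum k \<sigma> t = Falsum"
| "subst_fm (\<phi> \<^bold>\<longrightarrow> \<psi>) k \<sigma> t = (subst_fm \<phi> k \<sigma> t \<^bold>\<longrightarrow> subst_fm \<psi> k \<sigma> t)"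
| "subst_fm (Forall j \<tau> \<phi>) k \<sigma> t =
     (if (j, \<tau>) = (k, \<sigma>) then Forall j \<tau> \<phi> else Forall j \<tau> (subst_fm \<phi> k \<sigma> t))"

fun free_for :: "tm \<Rightarrow> nat \<Rightarrow> ty \<Rightarrow> fm \<Rightarrow> bool" where
  "free_for t k \<sigma> (\<phi> \<^bold>\<longrightarrow> \<psi>) \<longleftrightarrow> free_for t k \<sigma> \<phi> \<and> free_for t k \<sigma> \<psi>"
| "free_for t k \<sigma> (Forall j \<tau> \<phi>) \<longleftrightarrow>
     (k, \<sigma>) \<notin> fvs (Forall j \<tau> \<phi>) \<or> ((j, \<tau>) \<notin> vars t \<and> free_for t k \<sigma> \<phi>)"
| "free_for t k \<sigma> _ \<longleftrightarrow> True"

fun qfree :: "fm \<Rightarrow> bool" where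
  "qfree (\<phi> \<^bold>\<longrightarrow> \<psi>) \<longleftrightarrow> qfree \<phi> \<and> qfree \<psi>"
| "qfree (Forall k \<sigma> \<phi>) \<longleftrightarrow> False"
| "qfree _ \<longleftrightarrow> True"


section \<open>Derivability\<close>

text \<open>
  \<open>T; \<Gamma> \<turnstile> \<phi>\<close> is classical many-sorted natural deduction with equality at type 0.  The eigenvariable
  condition of \<open>AllI\<close> concerns the hypotheses \<open>\<Gamma>\<close> only, so an axiom in \<open>T\<close> with free variables
  stands for its universal closure.
\<close>

inductive derives :: "fm set \<Rightarrow> fm set \<Rightarrow> fm \<Rightarrow> bool" ("_; _ \<turnstile> _" [51, 51, 20] 20)
  for T :: "fm set" where
  Axiom: "\<phi> \<in> T \<Longrightarrow> wf_fm \<phi> \<Longrightarrow> T; \<Gamma> \<turnstile> \<phi>"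
| Assume: "\<phi> \<in> \<Gamma> \<Longrightarrow> wf_fm \<phi> \<Longrightarrow> T; \<Gamma> \<turnstile> \<phi>"
| ImpI: "wf_fm \<phi> \<Longrightarrow> T; (insert \<phi> \<Gamma>) \<turnstile> \<psi> \<Longrightarrow> T; \<Gamma> \<turnstile> (\<phi> \<^bold>\<longrightarrow> \<psi>)"
| ImpE: "T; \<Gamma> \<turnstile> (\<phi> \<^bold>\<longrightarrow> \<psi>) \<Longrightarrow> T; \<Gamma> \<turnstile> \<phi> \<Longrightarrow> T; \<Gamma> \<turnstile> \<psi>"
| Classical: "wf_fm \<phi> \<Longrightarrow> T; (insert (\<^bold>\<not> \<phi>) \<Gamma>) \<turnstile> Falsum \<Longrightarrow> T; \<Gamma> \<turnstile> \<phi>"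
| AllI: "T; \<Gamma> \<turnstile> \<phi> \<Longrightarrow> (k, \<sigma>) \<notin> \<Union> (fvs ` \<Gamma>) \<Longrightarrow> T; \<Gamma> \<turnstile> Forall k \<sigma> \<phi>"
| AllE: "T; \<Gamma> \<turnstile> Forall k \<sigma> \<phi> \<Longrightarrow> wt t \<Longrightarrow> ty_of t = \<sigma> \<Longrightarrow> free_for t k \<sigma> \<phi> \<Longrightarrow>
    T; \<Gamma> \<turnstile> subst_fm \<phi> k \<sigma> t"
| EqRefl: "wt t \<Longrightarrow> ty_of t = Ty0 \<Longrightarrow> T; \<Gamma> \<turnstile> (t \<^bold>= t)"
| EqSubst: "T; \<Gamma> \<turnstile> (s \<^bold>= t) \<Longrightarrow> T; \<Gamma> \<turnstile> subst_fm \<phi> k Ty0 s \<Longrightarrow> wf_fm \<phi> \<Longrightarrow>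
    free_for s k Ty0 \<phi> \<Longrightarrow> free_for t k Ty0 \<phi> \<Longrightarrow> T; \<Gamma> \<turnstile> subst_fm \<phi> k Ty0 t"

definition proves :: "fm set \<Rightarrow> fm \<Rightarrow> bool" (infix "\<turnstile>" 20) where
  "(T \<turnstile> \<phi>) \<longleftrightarrow> (T; {} \<turnstile> \<phi>)"


section \<open>Binders with automatically chosen variables\<close>

text \<open>
  In \<open>univ \<sigma> ts (\<lambda>x. \<phi>)\<close>, \<open>exis \<sigma> ts (\<lambda>x. \<phi>)\<close> and \<open>lam \<sigma> ts (\<lambda>x. t)\<close> the bound variable is chosen
  outside the terms \<open>ts\<close>.  The list \<open>ts\<close> must contain every term that contributes free variables
  to the body, \<open>x\<close> itself excepted; then nothing is captured.
\<close>

fun var_bound :: "tm \<Rightarrow> nat" where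
  "var_bound (Var k \<sigma>) = Suc k"
| "var_bound (s \<cdot> t) = max (var_bound s) (var_bound t)"
| "var_bound _ = 0"

definition fresh :: "tm list \<Rightarrow> nat" where
  "fresh ts = foldr (\<lambda>t. max (var_bound t)) ts 0"

definition univ :: "ty \<Rightarrow> tm list \<Rightarrow> (tm \<Rightarrow> fm) \<Rightarrow> fm" where
  "univ \<sigma> ts F = Forall (fresh ts) \<sigma> (F (Var (fresh ts) \<sigma>))"

definition exis :: "ty \<Rightarrow> tm list \<Rightarrow> (tm \<Rightarrow> fm) \<Rightarrow> fm" where
  "exis \<sigma> ts F = Exists (fresh ts) \<sigma> (F (Var (fresh ts) \<sigma>))"

text \<open>Bracket abstraction: \<open>abstr k \<sigma> t\<close> is the combinator term for \<open>\<lambda>x\<^sub>k. t\<close>.\<close>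

fun abstr :: "nat \<Rightarrow> ty \<Rightarrow> tm \<Rightarrow> tm" where
  "abstr k \<sigma> (Var j \<tau>) =
     (if (j, \<tau>) = (k, \<sigma>) then CombS \<sigma> (\<sigma> \<Rrightarrow> \<sigma>) \<sigma> \<cdot> CombK \<sigma> (\<sigma> \<Rrightarrow> \<sigma>) \<cdot> CombK \<sigma> \<sigma>
      else CombK \<tau> \<sigma> \<cdot> Var j \<tau>)"
| "abstr k \<sigma> (s \<cdot> t) = CombS \<sigma> (ty_of t) (ty_of (s \<cdot> t)) \<cdot> abstr k \<sigma> s \<cdot> abstr k \<sigma> t"
| "abstr k \<sigma> c = CombK (ty_of c) \<sigma> \<cdot> c"

definition lam :: "ty \<Rightarrow> tm list \<Rightarrow> (tm \<Rightarrow> tm) \<Rightarrow> tm" where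
  "lam \<sigma> ts F = abstr (fresh ts) \<sigma> (F (Var (fresh ts) \<sigma>))"


section \<open>The theories \<open>RCA\<^sub>0\<^sup>\<omega>\<close> and \<open>ACA\<^sub>0\<^sup>\<omega>\<close>\<close>

abbreviation plus_tm :: "tm \<Rightarrow> tm \<Rightarrow> tm" (infixl "\<^bold>+" 65) where "s \<^bold>+ t \<equiv> Plus \<cdot> s \<cdot> t"
abbreviation times_tm :: "tm \<Rightarrow> tm \<Rightarrow> tm" (infixl "\<^bold>*" 70) where "s \<^bold>* t \<equiv> Times \<cdot> s \<cdot> t"

text \<open>Equality at higher types is pointwise.\<close>

primrec eq_at :: "ty \<Rightarrow> tm \<Rightarrow> tm \<Rightarrow> fm" where
  "eq_at Ty0 s t = (s \<^bold>= t)"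
| "eq_at (\<sigma> \<Rrightarrow> \<tau>) s t = univ \<sigma> [s, t] (\<lambda>z. eq_at \<tau> (s \<cdot> z) (t \<cdot> z))"

text \<open>
  Nonnegativity and discreteness (\<open>0 < x\<close> implies \<open>1 \<le> x\<close>) are not listed; they follow by
  quantifier-free induction, using \<open>Rec\<close> for the predecessor.
\<close>

definition semiring_axioms :: "fm set" where
  "semiring_axioms = (let x = Var 0 Ty0; y = Var 1 Ty0; z = Var 2 Ty0 in
    { (x \<^bold>+ y) \<^bold>+ z \<^bold>= x \<^bold>+ (y \<^bold>+ z),
      x \<^bold>+ y \<^bold>= y \<^bold>+ x,
      x \<^bold>+ Zero \<^bold>= x,
      (x \<^bold>* y) \<^bold>* z \<^bold>= x \<^bold>* (y \<^bold>* z),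
      x \<^bold>* y \<^bold>= y \<^bold>* x,
      x \<^bold>* One \<^bold>= x,
      x \<^bold>* Zero \<^bold>= Zero,
      x \<^bold>* (y \<^bold>+ z) \<^bold>= x \<^bold>* y \<^bold>+ x \<^bold>* z,
      \<^bold>\<not> (x \<^bold>< x),
      x \<^bold>< y \<^bold>\<longrightarrow> y \<^bold>< z \<^bold>\<longrightarrow> x \<^bold>< z,
      x \<^bold>< y \<^bold>\<or> x \<^bold>= y \<^bold>\<or> y \<^bold>< x,
      x \<^bold>< y \<^bold>\<longrightarrow> x \<^bold>+ z \<^bold>< y \<^bold>+ z,
      x \<^bold>< y \<^bold>\<longrightarrow> Zero \<^bold>< z \<^bold>\<longrightarrow> x \<^bold>* z \<^bold>< y \<^bold>* z,
      Zero \<^bold>< One })"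

definition combinator_axioms :: "fm set" where
  "combinator_axioms =
     {eq_at \<sigma> (CombK \<sigma> \<tau> \<cdot> x \<cdot> y) x | \<sigma> \<tau> x y. x = Var 0 \<sigma> \<and> y = Var 1 \<tau>} \<union>
     {eq_at \<tau> (CombS \<rho> \<sigma> \<tau> \<cdot> x \<cdot> y \<cdot> z) (x \<cdot> z \<cdot> (y \<cdot> z)) | \<rho> \<sigma> \<tau> x y z.
        x = Var 0 (\<rho> \<Rrightarrow> \<sigma> \<Rrightarrow> \<tau>) \<and> y = Var 1 (\<rho> \<Rrightarrow> \<sigma>) \<and> z = Var 2 \<rho>}"

definition recursor_axioms :: "fm set" where
  "recursor_axioms =
     (let f = Var 0 (Ty0 \<Rrightarrow> Ty0 \<Rrightarrow> Ty0); m = Var 1 Ty0; n = Var 2 Ty0 in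
       { Rec \<cdot> f \<cdot> m \<cdot> Zero \<^bold>= m,
         Rec \<cdot> f \<cdot> m \<cdot> (n \<^bold>+ One) \<^bold>= f \<cdot> n \<cdot> (Rec \<cdot> f \<cdot> m \<cdot> n) })"

definition extensionality_axioms :: "fm set" where
  "extensionality_axioms =
     {eq_at \<rho> x y \<^bold>\<longrightarrow> eq_at \<tau> (f \<cdot> x) (f \<cdot> y) | \<rho> \<tau> x y f.
        x = Var 0 \<rho> \<and> y = Var 1 \<rho> \<and> f = Var 2 (\<rho> \<Rrightarrow> \<tau>)}"

definition qf_induction_axioms :: "fm set" where
  "qf_induction_axioms =
     {subst_fm A k Ty0 Zero \<^bold>\<longrightarrow>
      Forall k Ty0 (A \<^bold>\<longrightarrow> subst_fm A k Ty0 (Var k Ty0 \<^bold>+ One)) \<^bold>\<longrightarrow>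
      Forall k Ty0 A | A k. qfree A \<and> wf_fm A}"

definition qf_ac_axioms :: "ty \<Rightarrow> ty \<Rightarrow> fm set" where
  "qf_ac_axioms \<sigma> \<tau> =
     {Forall i \<sigma> (Exists j \<tau> A) \<^bold>\<longrightarrow>
      Exists k (\<sigma> \<Rrightarrow> \<tau>) (Forall i \<sigma> (subst_fm A j \<tau> (Var k (\<sigma> \<Rrightarrow> \<tau>) \<cdot> Var i \<sigma>))) | A i j k.
        qfree A \<and> wf_fm A \<and> (i, \<sigma>) \<noteq> (j, \<tau>) \<and> (k, \<sigma> \<Rrightarrow> \<tau>) \<notin> fvs A}"

definition RCA0_omega :: "fm set" where
  "RCA0_omega = semiring_axioms \<union> combinator_axioms \<union> recursor_axioms \<union>
     extensionality_axioms \<union> qf_induction_axioms \<union> qf_ac_axioms Ty1 Ty0"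

definition exists2_axiom :: fm where
  "exists2_axiom =
     exis Ty2 [] (\<lambda>\<phi>. univ Ty1 [\<phi>] (\<lambda>f.
       (\<phi> \<cdot> f \<^bold>= Zero \<^bold>\<or> \<phi> \<cdot> f \<^bold>= One) \<^bold>\<and>
       (\<phi> \<cdot> f \<^bold>= Zero \<^bold>\<longleftrightarrow> exis Ty0 [f] (\<lambda>n. f \<cdot> n \<^bold>= Zero))))"

definition ACA0_omega :: "fm set" where
  "ACA0_omega = insert exists2_axiom RCA0_omega"


section \<open>Primitive recursive functions\<close>

text \<open>\<open>step\<close> may contain no free variables besides its two arguments (index, previous value).\<close>

definition prim_rec :: "(tm \<Rightarrow> tm \<Rightarrow> tm) \<Rightarrow> tm \<Rightarrow> tm" where
  "prim_rec step base = Rec \<cdot> lam Ty0 [] (\<lambda>n. lam Ty0 [n] (\<lambda>m. step n m)) \<cdot> base"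

definition pred_tm :: "tm \<Rightarrow> tm" where
  "pred_tm t = prim_rec (\<lambda>n m. n) Zero \<cdot> t"

definition monus :: "tm \<Rightarrow> tm \<Rightarrow> tm" (infixl "\<^bold>-" 65) where
  "s \<^bold>- t = prim_rec (\<lambda>n m. pred_tm m) s \<cdot> t"

definition pow2 :: "tm \<Rightarrow> tm" where
  "pow2 t = prim_rec (\<lambda>n m. m \<^bold>+ m) One \<cdot> t"

text \<open>
  The Cantor pairing \<open>\<langle>s, t\<rangle> = tri (s + t) + s\<close>, where \<open>tri n = 0 + 1 + \<dots> + n\<close>.  Here \<open>diag n\<close> is the
  largest \<open>d\<close> with \<open>tri d \<le> n\<close>, i.e. the sum of the two components of \<open>n\<close>.
\<close>

definition tri :: "tm \<Rightarrow> tm" where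
  "tri t = prim_rec (\<lambda>n m. m \<^bold>+ (n \<^bold>+ One)) Zero \<cdot> t"

definition diag :: "tm \<Rightarrow> tm" where
  "diag t = prim_rec (\<lambda>n m. m \<^bold>+ (One \<^bold>- (tri (m \<^bold>+ One) \<^bold>- (n \<^bold>+ One)))) Zero \<cdot> t"

definition pair_tm :: "tm \<Rightarrow> tm \<Rightarrow> tm" where
  "pair_tm s t = tri (s \<^bold>+ t) \<^bold>+ s"

definition fst_tm :: "tm \<Rightarrow> tm" where
  "fst_tm t = t \<^bold>- tri (diag t)"

definition snd_tm :: "tm \<Rightarrow> tm" where
  "snd_tm t = diag t \<^bold>- fst_tm t"


section \<open>Rationals\<close>

text \<open>
  Every number codes a rational: \<open>\<langle>\<langle>a, b\<rangle>, c\<rangle>\<close> codes \<open>(a - b) / (c + 1)\<close>.  So \<open>mk_rat a b d\<close> codes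
  \<open>(a - b) / d\<close> for \<open>d > 0\<close>.  Codes are not unique; \<open>rat_less\<close> compares values.
\<close>

definition pos_part :: "tm \<Rightarrow> tm" where "pos_part q = fst_tm (fst_tm q)"
definition neg_part :: "tm \<Rightarrow> tm" where "neg_part q = snd_tm (fst_tm q)"
definition denom :: "tm \<Rightarrow> tm" where "denom q = snd_tm q \<^bold>+ One"

definition mk_rat :: "tm \<Rightarrow> tm \<Rightarrow> tm \<Rightarrow> tm" where
  "mk_rat a b d = pair_tm (pair_tm a b) (pred_tm d)"

definition rat_add :: "tm \<Rightarrow> tm \<Rightarrow> tm" where
  "rat_add q r = mk_rat (pos_part q \<^bold>* denom r \<^bold>+ pos_part r \<^bold>* denom q)
                        (neg_part q \<^bold>* denom r \<^bold>+ neg_part r \<^bold>* denom q)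
                        (denom q \<^bold>* denom r)"

definition rat_uminus :: "tm \<Rightarrow> tm" where
  "rat_uminus q = mk_rat (neg_part q) (pos_part q) (denom q)"

definition rat_sub :: "tm \<Rightarrow> tm \<Rightarrow> tm" where
  "rat_sub q r = rat_add q (rat_uminus r)"

definition rat_abs :: "tm \<Rightarrow> tm" where
  "rat_abs q = mk_rat ((pos_part q \<^bold>- neg_part q) \<^bold>+ (neg_part q \<^bold>- pos_part q)) Zero (denom q)"

definition rat_less :: "tm \<Rightarrow> tm \<Rightarrow> fm" where
  "rat_less q r = (pos_part q \<^bold>* denom r \<^bold>+ neg_part r \<^bold>* denom q \<^bold><
                   pos_part r \<^bold>* denom q \<^bold>+ neg_part q \<^bold>* denom r)"

abbreviation rat_le :: "tm \<Rightarrow> tm \<Rightarrow> fm" where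
  "rat_le q r \<equiv> \<^bold>\<not> rat_less r q"

text \<open>\<open>2\<^sup>-\<^sup>t\<close> and \<open>2\<^sup>-\<^sup>t\<^sup>+\<^sup>1\<close>\<close>

definition half_pow :: "tm \<Rightarrow> tm" where
  "half_pow t = mk_rat One Zero (pow2 t)"

definition two_half_pow :: "tm \<Rightarrow> tm" where
  "two_half_pow t = mk_rat (One \<^bold>+ One) Zero (pow2 t)"


section \<open>Reals\<close>

text \<open>
  Not every type 1 object is a real; quantifiers over reals are relativised to \<open>is_real\<close>.
\<close>

definition is_real :: "tm \<Rightarrow> fm" where
  "is_real x = univ Ty0 [x] (\<lambda>n. univ Ty0 [x, n] (\<lambda>i.
     rat_less (rat_abs (rat_sub (x \<cdot> n) (x \<cdot> (n \<^bold>+ i)))) (half_pow n)))"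

definition real_eq :: "tm \<Rightarrow> tm \<Rightarrow> fm" where
  "real_eq x y = univ Ty0 [x, y] (\<lambda>n.
     rat_le (rat_abs (rat_sub (x \<cdot> n) (y \<cdot> n))) (two_half_pow n))"

definition real_less :: "tm \<Rightarrow> tm \<Rightarrow> fm" where
  "real_less x y = exis Ty0 [x, y] (\<lambda>n.
     rat_less (rat_add (x \<cdot> n) (two_half_pow n)) (y \<cdot> n))"

abbreviation real_le :: "tm \<Rightarrow> tm \<Rightarrow> fm" where
  "real_le x y \<equiv> \<^bold>\<not> real_less y x"

definition real_zero :: tm where
  "real_zero = lam Ty0 [] (\<lambda>n. mk_rat Zero Zero One)"

definition real_one :: tm where
  "real_one = lam Ty0 [] (\<lambda>n. mk_rat One Zero One)"

text \<open>The index shift in sums and differences restores the rate of convergence \<open>2\<^sup>-\<^sup>n\<close>.\<close>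

definition real_add :: "tm \<Rightarrow> tm \<Rightarrow> tm" where
  "real_add x y = lam Ty0 [x, y] (\<lambda>n. rat_add (x \<cdot> (n \<^bold>+ One)) (y \<cdot> (n \<^bold>+ One)))"

definition real_sub :: "tm \<Rightarrow> tm \<Rightarrow> tm" where
  "real_sub x y = lam Ty0 [x, y] (\<lambda>n. rat_sub (x \<cdot> (n \<^bold>+ One)) (y \<cdot> (n \<^bold>+ One)))"

definition real_abs :: "tm \<Rightarrow> tm" where
  "real_abs x = lam Ty0 [x] (\<lambda>n. rat_abs (x \<cdot> n))"

definition real_dist :: "tm \<Rightarrow> tm \<Rightarrow> tm" where
  "real_dist x y = real_abs (real_sub x y)"

definition in_unit :: "tm \<Rightarrow> fm" where
  "in_unit x = (is_real x \<^bold>\<and> real_le real_zero x \<^bold>\<and> real_le x real_one)"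

definition real_pos :: "tm \<Rightarrow> fm" where
  "real_pos x = (is_real x \<^bold>\<and> real_less real_zero x)"

definition all_unit :: "tm list \<Rightarrow> (tm \<Rightarrow> fm) \<Rightarrow> fm" where
  "all_unit ts F = univ Ty1 ts (\<lambda>x. in_unit x \<^bold>\<longrightarrow> F x)"

definition ex_unit :: "tm list \<Rightarrow> (tm \<Rightarrow> fm) \<Rightarrow> fm" where
  "ex_unit ts F = exis Ty1 ts (\<lambda>x. in_unit x \<^bold>\<and> F x)"

definition all_pos :: "tm list \<Rightarrow> (tm \<Rightarrow> fm) \<Rightarrow> fm" where
  "all_pos ts F = univ Ty1 ts (\<lambda>e. real_pos e \<^bold>\<longrightarrow> F e)"

definition ex_pos :: "tm list \<Rightarrow> (tm \<Rightarrow> fm) \<Rightarrow> fm" where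
  "ex_pos ts F = exis Ty1 ts (\<lambda>e. real_pos e \<^bold>\<and> F e)"


section \<open>Functions on the unit interval\<close>

text \<open>
  A function from \<open>[0,1]\<close> to the reals is an object of type \<open>1 \<rightarrow> 1\<close>; nothing is required of its
  values at arguments that do not represent an element of \<open>[0,1]\<close>.
\<close>

definition unit_fun :: "tm \<Rightarrow> fm" where
  "unit_fun f =
     (all_unit [f] (\<lambda>x. is_real (f \<cdot> x)) \<^bold>\<and>
      all_unit [f] (\<lambda>x. all_unit [f, x] (\<lambda>y.
        real_eq x y \<^bold>\<longrightarrow> real_eq (f \<cdot> x) (f \<cdot> y))))"

definition continuous_at :: "tm \<Rightarrow> tm \<Rightarrow> fm" where
  "continuous_at f x =
     all_pos [f, x] (\<lambda>\<epsilon>. ex_pos [f, x, \<epsilon>] (\<lambda>\<delta>. all_unit [f, x, \<epsilon>, \<delta>] (\<lambda>y.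
       real_less (real_dist x y) \<delta> \<^bold>\<longrightarrow> real_less (real_dist (f \<cdot> x) (f \<cdot> y)) \<epsilon>)))"

definition continuous_unit :: "tm \<Rightarrow> fm" where
  "continuous_unit f = all_unit [f] (\<lambda>x. continuous_at f x)"

text \<open>\<open>limsup\<^sub>y\<^sub>\<rightarrow>\<^sub>x f(y) \<le> f(x)\<close>, with the limit superior over \<open>y \<noteq> x\<close>, written out.\<close>

definition usc_at :: "tm \<Rightarrow> tm \<Rightarrow> fm" where
  "usc_at f x =
     all_pos [f, x] (\<lambda>\<epsilon>. ex_pos [f, x, \<epsilon>] (\<lambda>\<delta>. all_unit [f, x, \<epsilon>, \<delta>] (\<lambda>y.
       real_less real_zero (real_dist x y) \<^bold>\<and> real_less (real_dist x y) \<delta> \<^bold>\<longrightarrow>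
       real_less (f \<cdot> y) (real_add (f \<cdot> x) \<epsilon>))))"

definition usc_unit :: "tm \<Rightarrow> fm" where
  "usc_unit f = all_unit [f] (\<lambda>x. usc_at f x)"

definition converges_pointwise :: "tm \<Rightarrow> tm \<Rightarrow> fm" where
  "converges_pointwise fs f =
     all_unit [fs, f] (\<lambda>x. all_pos [fs, f, x] (\<lambda>\<epsilon>. exis Ty0 [fs, f, x, \<epsilon>] (\<lambda>m.
       univ Ty0 [fs, f, x, \<epsilon>, m] (\<lambda>n.
         \<^bold>\<not> (n \<^bold>< m) \<^bold>\<longrightarrow> real_less (real_dist (fs \<cdot> n \<cdot> x) (f \<cdot> x)) \<epsilon>))))"

end

theory Submission
  imports Defs "HOL-Library.Countable_Set" "HOL-Computational_Algebra.Fraction_Field"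
begin

text \<open>
  The calculus is complete, so instead of writing a formal derivation one may argue semantically: if
  the sentence were not derivable, it would fail in some structure that satisfies
  \<open>ACA\<^sub>0\<^sup>\<omega>\<close>, with possibly non-standard natural numbers.  In such a structure the
  functions on numbers are closed under arithmetical comprehension, arithmetical induction and
  arithmetical dependent choice, which suffices for the following Baire category argument.

  Since the \<open>f\<^sub>m\<close> are continuous, statements about their values on a ball can be tested on
  rational points, and so they are arithmetical.  Given \<open>p\<close> and a ball, some smaller ball \<open>B\<close> and some
  \<open>n\<close> satisfy \<open>\<bar>f\<^sub>m r - f\<^sub>n s\<bar> \<le> 2\<^sup>-\<^sup>p\<close> for all \<open>m \<ge> n\<close> and all rational points \<open>r\<close>, \<open>s\<close> of \<open>B\<close>:
  otherwise one could choose nested balls \<open>B\<^sub>i\<close> and indices \<open>m\<^sub>i \<ge> i\<close> with \<open>f\<close> at index \<open>m\<^sub>i\<close>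
  differing from \<open>f\<^sub>i\<close> by more than \<open>2\<^sup>-\<^sup>p\<^sup>-\<^sup>2\<close> on all of \<open>B\<^sub>i\<close>, and the sequence would not converge at
  the common point of the balls.  Iterating over \<open>p\<close> gives nested balls whose common point is a
  point of continuity of the limit.
\<close>

section \<open>Completeness for Kohlenbach's calculus\<close>

text \<open>The axioms offer induction and choice for quantifier-free formulas only.
  \<open>exists2_axiom\<close> bridges the gap to arithmetical reasoning: every arithmetical
  condition on numbers becomes the zero set of a function of the model, and being a zero is
  quantifier-free.

  This shapes the category argument. The limit is not determined by its values at rational points,
  so a condition on its behaviour throughout a ball quantifies over reals and is not arithmetical.
  No such condition guides a construction; the limit is consulted only at a point that has already
  been built.

  The numbers of the structure may be non-standard, so induction over the naturals of HOL says
  nothing about them. Every induction on them has to exhibit its predicate as definable in the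
  model, and precisions, indices and codes of balls are all numbers of the model. Their arithmetic
  takes place in a fraction field built over them, where linear and field reasoning are
  available.\<close>

lemma ty_of_subst_tm: "ty_of t = \<sigma> \<Longrightarrow> ty_of (subst_tm s k \<sigma> t) = ty_of s"
  by (induction s) auto

lemma wt_subst_tm: "wt s \<Longrightarrow> wt t \<Longrightarrow> ty_of t = \<sigma> \<Longrightarrow> wt (subst_tm s k \<sigma> t)"
  by (induction s) (auto simp: ty_of_subst_tm)

lemma wf_subst_fm: "wf_fm \<phi> \<Longrightarrow> wt t \<Longrightarrow> ty_of t = \<sigma> \<Longrightarrow> wf_fm (subst_fm \<phi> k \<sigma> t)"
  by (induction \<phi>) (auto simp: ty_of_subst_tm wt_subst_tm)

lemma subst_tm_idle: "(k, \<sigma>) \<notin> vars s \<Longrightarrow> subst_tm s k \<sigma> t = s"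
  by (induction s) auto

lemma subst_fm_idle: "(k, \<sigma>) \<notin> fvs \<phi> \<Longrightarrow> subst_fm \<phi> k \<sigma> t = \<phi>"
  by (induction \<phi>) (auto simp: subst_tm_idle)

lemma subst_tm_Var_self: "subst_tm s k \<sigma> (Var k \<sigma>) = s"
  by (induction s) auto

lemma subst_fm_Var_self: "subst_fm \<phi> k \<sigma> (Var k \<sigma>) = \<phi>"
  by (induction \<phi>) (auto simp: subst_tm_Var_self)

lemma free_for_Var_self: "free_for (Var k \<sigma>) k \<sigma> \<phi>"
  by (induction \<phi>) auto

fun bvs :: "fm \<Rightarrow> (nat \<times> ty) set" where
  "bvs (\<phi> \<^bold>\<longrightarrow> \<psi>) = bvs \<phi> \<union> bvs \<psi>"
| "bvs (Forall k \<sigma> \<phi>) = insert (k, \<sigma>) (bvs \<phi>)"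
| "bvs _ = {}"

lemma finite_vars: "finite (vars t)"
  by (induction t) auto

lemma finite_fvs: "finite (fvs \<phi>)"
  by (induction \<phi>) (auto simp: finite_vars)

lemma finite_bvs: "finite (bvs \<phi>)"
  by (induction \<phi>) auto

lemma free_for_disjoint: "vars t \<inter> bvs \<phi> = {} \<Longrightarrow> free_for t k \<sigma> \<phi>"
  by (induction \<phi>) auto

lemma vars_subst_tm: "vars (subst_tm s k \<sigma> t) \<subseteq> (vars s - {(k, \<sigma>)}) \<union> vars t"
  by (induction s) auto

lemma subst_tm_back: "(c, \<sigma>) \<notin> vars s \<Longrightarrow>
    subst_tm (subst_tm s k \<sigma> (Var c \<sigma>)) c \<sigma> (Var k \<sigma>) = s"
  by (induction s) auto

lemma subst_fm_back: "(c, \<sigma>) \<notin> fvs \<phi> \<union> bvs \<phi> \<Longrightarrow>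
    subst_fm (subst_fm \<phi> k \<sigma> (Var c \<sigma>)) c \<sigma> (Var k \<sigma>) = \<phi>"
proof (induction \<phi>)
  case (Forall j \<tau> \<phi>)
  show ?case
  proof (cases "(j, \<tau>) = (k, \<sigma>)")
    case True
    with Forall show ?thesis by (auto intro!: subst_fm_idle)
  next
    case False
    with Forall show ?thesis by auto
  qed
qed (auto simp: subst_tm_back)

lemma free_for_back: "(c, \<sigma>) \<notin> fvs \<phi> \<union> bvs \<phi> \<Longrightarrow>
    free_for (Var k \<sigma>) c \<sigma> (subst_fm \<phi> k \<sigma> (Var c \<sigma>))"
  by (induction \<phi>) auto

text \<open>
  Hypotheses are moved out of the natural deduction calculus, because weakening with a formula
  that contains an eigenvariable is not one of its rules.
\<close>

inductive hil :: "fm set \<Rightarrow> fm set \<Rightarrow> fm \<Rightarrow> bool" for T H where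
  base: "T; {} \<turnstile> \<phi> \<Longrightarrow> hil T H \<phi>"
| hyp: "\<phi> \<in> H \<Longrightarrow> wf_fm \<phi> \<Longrightarrow> hil T H \<phi>"
| mp: "hil T H (\<phi> \<^bold>\<longrightarrow> \<psi>) \<Longrightarrow> hil T H \<phi> \<Longrightarrow> hil T H \<psi>"

lemma derives_wf: "T; \<Gamma> \<turnstile> \<phi> \<Longrightarrow> wf_fm \<phi>"
proof (induction rule: derives.induct)
  case (EqSubst \<Gamma> s t \<phi> k)
  then show ?case using wf_subst_fm by auto
qed (auto simp: wf_subst_fm)

lemma hil_wf: "hil T H \<phi> \<Longrightarrow> wf_fm \<phi>"
  by (induction rule: hil.induct) (auto simp: derives_wf)

lemma hil_mono: "hil T H \<phi> \<Longrightarrow> H \<subseteq> H' \<Longrightarrow> hil T H' \<phi>"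
  by (induction rule: hil.induct) (auto intro: hil.intros)

lemma hil_finite: "hil T H \<phi> \<Longrightarrow> \<exists>F. finite F \<and> F \<subseteq> H \<and> hil T F \<phi>"
proof (induction rule: hil.induct)
  case (base \<phi>)
  then show ?case by (meson empty_subsetI finite.emptyI hil.base)
next
  case (hyp \<phi>)
  then show ?case by (intro exI[of _ "{\<phi>}"]) (auto intro: hil.hyp)
next
  case (mp \<phi> \<psi>)
  then obtain F G where "finite F" "F \<subseteq> H" "hil T F (\<phi> \<^bold>\<longrightarrow> \<psi>)" "finite G" "G \<subseteq> H" "hil T G \<phi>" by auto
  then show ?case
    by (intro exI[of _ "F \<union> G"]) (auto intro: hil.mp hil_mono)
qed

lemma hil_empty: "hil T {} \<phi> \<Longrightarrow> T; {} \<turnstile> \<phi>"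
  by (induction rule: hil.induct) (auto intro: derives.ImpE)

section \<open>Logical axioms in implicational form, and the deduction theorem\<close>

lemma derives_K:
  assumes "wf_fm \<phi>" "wf_fm \<psi>" shows "T; {} \<turnstile> (\<phi> \<^bold>\<longrightarrow> \<psi> \<^bold>\<longrightarrow> \<phi>)"
  using assms by (intro derives.ImpI derives.Assume) auto

lemma derives_S:
  assumes "wf_fm \<phi>" "wf_fm \<psi>" "wf_fm \<chi>"
  shows "T; {} \<turnstile> ((\<phi> \<^bold>\<longrightarrow> \<psi> \<^bold>\<longrightarrow> \<chi>) \<^bold>\<longrightarrow> (\<phi> \<^bold>\<longrightarrow> \<psi>) \<^bold>\<longrightarrow> \<phi> \<^bold>\<longrightarrow> \<chi>)"
proof -
  let ?G = "{\<phi>, \<phi> \<^bold>\<longrightarrow> \<psi>, \<phi> \<^bold>\<longrightarrow> \<psi> \<^bold>\<longrightarrow> \<chi>}"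
  have a: "T; ?G \<turnstile> \<phi>" "T; ?G \<turnstile> (\<phi> \<^bold>\<longrightarrow> \<psi>)" "T; ?G \<turnstile> (\<phi> \<^bold>\<longrightarrow> \<psi> \<^bold>\<longrightarrow> \<chi>)"
    using assms by (auto intro!: derives.Assume)
  then have "T; ?G \<turnstile> \<chi>" by (meson derives.ImpE)
  then show ?thesis using assms by (intro derives.ImpI) auto
qed

lemma derives_DN:
  assumes "wf_fm \<phi>" shows "T; {} \<turnstile> ((\<^bold>\<not> \<^bold>\<not> \<phi>) \<^bold>\<longrightarrow> \<phi>)"
proof -
  let ?G = "{\<^bold>\<not> \<phi>, \<^bold>\<not> \<^bold>\<not> \<phi>}"
  have "T; ?G \<turnstile> (\<^bold>\<not> \<phi>)" "T; ?G \<turnstile> (\<^bold>\<not> \<^bold>\<not> \<phi>)" using assms by (auto intro!: derives.Assume)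
  then have "T; ?G \<turnstile> Falsum" by (meson derives.ImpE)
  then show ?thesis 
    using assms by (auto intro!: derives.ImpI[OF _ derives.Classical])
qed

lemma derives_AllK:
  assumes "wf_fm \<phi>" "(k, \<sigma>) \<notin> fvs \<phi>" shows "T; {} \<turnstile> (\<phi> \<^bold>\<longrightarrow> Forall k \<sigma> \<phi>)"
  using assms by (intro derives.ImpI derives.AllI derives.Assume) auto

lemma derives_AllE: "wf_fm \<phi> \<Longrightarrow> wt t \<Longrightarrow> ty_of t = \<sigma> \<Longrightarrow> free_for t k \<sigma> \<phi> \<Longrightarrow>
    T; {} \<turnstile> (Forall k \<sigma> \<phi> \<^bold>\<longrightarrow> subst_fm \<phi> k \<sigma> t)"
  by (intro derives.ImpI derives.AllE derives.Assume) auto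

lemma derives_AllDist:
  assumes "wf_fm \<phi>" "wf_fm \<psi>"
  shows "T; {} \<turnstile> (Forall k \<sigma> (\<phi> \<^bold>\<longrightarrow> \<psi>) \<^bold>\<longrightarrow> Forall k \<sigma> \<phi> \<^bold>\<longrightarrow> Forall k \<sigma> \<psi>)"
proof -
  let ?G = "{Forall k \<sigma> \<phi>, Forall k \<sigma> (\<phi> \<^bold>\<longrightarrow> \<psi>)}"
  have "T; ?G \<turnstile> Forall k \<sigma> \<phi>" "T; ?G \<turnstile> Forall k \<sigma> (\<phi> \<^bold>\<longrightarrow> \<psi>)"
    using assms by (auto intro!: derives.Assume)
  from this[THEN derives.AllE, of "Var k \<sigma>"]
  have "T; ?G \<turnstile> \<phi>" "T; ?G \<turnstile> (\<phi> \<^bold>\<longrightarrow> \<psi>)"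
    by (simp_all add: free_for_Var_self subst_fm_Var_self del: free_for.simps subst_fm.simps)
  then have "T; ?G \<turnstile> \<psi>" by (meson derives.ImpE)
  then show ?thesis using assms by (intro derives.ImpI derives.AllI) auto
qed

lemma hil_deduction: "hil T (insert \<phi> H) \<psi> \<Longrightarrow> wf_fm \<phi> \<Longrightarrow> hil T H (\<phi> \<^bold>\<longrightarrow> \<psi>)"
proof (induction rule: hil.induct)
  case (base \<psi>)
  then have "hil T H (\<psi> \<^bold>\<longrightarrow> \<phi> \<^bold>\<longrightarrow> \<psi>)" by (meson derives_K derives_wf hil.base)
  with base show ?case by (meson hil.base hil.mp)
next
  case (hyp \<psi>)
  show ?case
  proof (cases "\<psi> = \<phi>")
    case True
    have "T; {} \<turnstile> (\<phi> \<^bold>\<longrightarrow> \<phi>)" using hyp by (intro derives.ImpI derives.Assume) auto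
    with True show ?thesis by (auto intro: hil.base)
  next
    case False
    have "hil T H (\<psi> \<^bold>\<longrightarrow> \<phi> \<^bold>\<longrightarrow> \<psi>)" using hyp by (meson derives_K hil.base)
    with hyp False show ?thesis by (meson hil.hyp hil.mp insertE)
  qed
next
  case (mp \<psi> \<chi>)
  have w: "wf_fm (\<psi> \<^bold>\<longrightarrow> \<chi>)" using mp(1) by (rule hil_wf)
  have "hil T H ((\<phi> \<^bold>\<longrightarrow> \<psi> \<^bold>\<longrightarrow> \<chi>) \<^bold>\<longrightarrow> (\<phi> \<^bold>\<longrightarrow> \<psi>) \<^bold>\<longrightarrow> \<phi> \<^bold>\<longrightarrow> \<chi>)"
    using w mp.prems by (intro hil.base derives_S) auto
  with mp show ?case by (meson hil.mp)
qed

lemma hil_generalize: "hil T H \<phi> \<Longrightarrow> (k, \<sigma>) \<notin> \<Union> (fvs ` H) \<Longrightarrow> hil T H (Forall k \<sigma> \<phi>)"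
proof (induction rule: hil.induct)
  case (base \<phi>)
  then show ?case by (auto intro!: hil.base derives.AllI)
next
  case (hyp \<phi>)
  then have "hil T H (\<phi> \<^bold>\<longrightarrow> Forall k \<sigma> \<phi>)" by (intro hil.base derives_AllK) auto
  with hyp show ?case by (meson hil.hyp hil.mp)
next
  case (mp \<phi> \<psi>)
  have w: "wf_fm (\<phi> \<^bold>\<longrightarrow> \<psi>)" using mp(1) by (rule hil_wf)
  then have "hil T H (Forall k \<sigma> (\<phi> \<^bold>\<longrightarrow> \<psi>) \<^bold>\<longrightarrow> Forall k \<sigma> \<phi> \<^bold>\<longrightarrow> Forall k \<sigma> \<psi>)"
    by (intro hil.base derives_AllDist) auto
  with mp show ?case by (meson hil.mp)
qed

lemma hil_neg: 
  assumes "hil T (insert (\<^bold>\<not> \<phi>) H) Falsum" "wf_fm \<phi>" shows "hil T H \<phi>"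
proof -
  have "hil T H (\<^bold>\<not> \<^bold>\<not> \<phi>)" using assms by (intro hil_deduction) auto
  moreover have "hil T H ((\<^bold>\<not> \<^bold>\<not> \<phi>) \<^bold>\<longrightarrow> \<phi>)" using assms by (intro hil.base derives_DN)
  ultimately show ?thesis by (meson hil.mp)
qed

lemma hil_AllE:
  assumes "hil T H (Forall k \<sigma> \<phi>)" "wt t" "ty_of t = \<sigma>" "free_for t k \<sigma> \<phi>"
  shows "hil T H (subst_fm \<phi> k \<sigma> t)"
proof -
  have "wf_fm \<phi>" using hil_wf[OF assms(1)] by simp
  then show ?thesis using assms derives_AllE hil.base hil.mp by meson
qed

section \<open>Henkin witnesses and maximal consistent sets\<close>

definition consistent :: "fm set \<Rightarrow> fm set \<Rightarrow> bool" where
  "consistent T H \<longleftrightarrow> \<not> hil T H Falsum"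

text \<open>If the Henkin axiom were refuted, \<open>H\<close> would prove the instance at
  \<open>c\<close>. As \<open>c\<close> is fresh for \<open>H\<close>, generalising over
  \<open>c\<close> and renaming back to \<open>k\<close> proves the universal formula, and with it
  the implication that was refuted.\<close>

lemma consistent_witness:
  assumes H: "consistent T H" and w: "wf_fm \<phi>"
    and c: "(c, \<sigma>) \<notin> \<Union> (fvs ` H)" "(c, \<sigma>) \<notin> fvs \<phi> \<union> bvs \<phi>"
  shows "consistent T (insert (subst_fm \<phi> k \<sigma> (Var c \<sigma>) \<^bold>\<longrightarrow> Forall k \<sigma> \<phi>) H)"
proof (rule ccontr)
  let ?\<psi> = "subst_fm \<phi> k \<sigma> (Var c \<sigma>)" and ?\<chi> = "Forall k \<sigma> \<phi>"
  have w': "wf_fm ?\<psi>" "wf_fm ?\<chi>" using w by (auto intro!: wf_subst_fm)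
  assume "\<not> ?thesis"
  then have "hil T (insert (?\<psi> \<^bold>\<longrightarrow> ?\<chi>) H) Falsum" by (simp add: consistent_def)
  then have n: "hil T H (\<^bold>\<not> (?\<psi> \<^bold>\<longrightarrow> ?\<chi>))" using w' by (intro hil_deduction) auto
  have "hil T H ?\<psi>"
  proof (rule hil_neg[OF _ w'(1)])
    let ?H = "insert (\<^bold>\<not> ?\<psi>) H"
    have "hil T (insert ?\<psi> ?H) Falsum" 
      using w' by (auto intro!: hil.mp[of _ _ ?\<psi> Falsum] intro: hil.hyp)
    then have "hil T (insert (\<^bold>\<not> ?\<chi>) (insert ?\<psi> ?H)) Falsum" by (rule hil_mono) auto
    then have "hil T (insert ?\<psi> ?H) ?\<chi>" by (rule hil_neg) (use w' in auto)
    then have "hil T ?H (?\<psi> \<^bold>\<longrightarrow> ?\<chi>)" using w' by (intro hil_deduction) auto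
    moreover have "hil T ?H (\<^bold>\<not> (?\<psi> \<^bold>\<longrightarrow> ?\<chi>))" using n by (rule hil_mono) auto
    ultimately show "hil T ?H Falsum" by (meson hil.mp)
  qed
  then have g: "hil T H (Forall c \<sigma> ?\<psi>)" using c by (intro hil_generalize)
  have "hil T H ?\<chi>"
  proof -
    show ?thesis
    proof (cases "(c, \<sigma>) = (k, \<sigma>)")
      case True
      with g show ?thesis by (simp add: subst_fm_Var_self)
    next
      case False
      have fv: "(k, \<sigma>) \<notin> fvs (Forall c \<sigma> ?\<psi>)" 
      proof -
        have "(k, \<sigma>) \<notin> fvs (subst_fm \<phi> k \<sigma> (Var c \<sigma>))"
        proof -
          have t: "(k, \<sigma>) \<notin> vars (subst_tm s k \<sigma> (Var c \<sigma>))" for s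
            using False vars_subst_tm[of s k \<sigma> "Var c \<sigma>"] by auto
          show ?thesis by (induction \<phi>) (use t in auto)
        qed
        then show ?thesis by simp
      qed
      have "T; {Forall c \<sigma> ?\<psi>} \<turnstile> subst_fm ?\<psi> c \<sigma> (Var k \<sigma>)"
        using w' c by (intro derives.AllE derives.Assume free_for_back) auto
      then have "T; {Forall c \<sigma> ?\<psi>} \<turnstile> Forall k \<sigma> \<phi>"
        using c fv by (intro derives.AllI) (auto simp: subst_fm_back)
      then have "T; {} \<turnstile> (Forall c \<sigma> ?\<psi> \<^bold>\<longrightarrow> Forall k \<sigma> \<phi>)"
        using w' by (intro derives.ImpI) auto
      then show ?thesis using g by (meson hil.base hil.mp)
    qed
  qed
  then have "hil T (insert ?\<psi> H) ?\<chi>" by (rule hil_mono) auto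
  then have "hil T H (?\<psi> \<^bold>\<longrightarrow> ?\<chi>)" using w' by (intro hil_deduction) auto
  with n have "hil T H Falsum" by (meson hil.mp)
  with H show False by (simp add: consistent_def)
qed


instance ty :: countable by countable_datatype
instance tm :: countable by countable_datatype
instance fm :: countable by countable_datatype

lemma consistent_finite:
  assumes "\<And>F. finite F \<Longrightarrow> F \<subseteq> H \<Longrightarrow> consistent T F" shows "consistent T H"
  unfolding consistent_def by (meson assms consistent_def hil_finite)

lemma ex_witness_set:
  assumes H: "consistent T H" and fin: "finite H"
  shows "\<exists>W. H \<subseteq> W \<and> consistent T W \<and> (\<forall>k \<sigma> \<phi> b. wf_fm \<phi> \<longrightarrow>
    (\<exists>c\<ge>b. (c, \<sigma>) \<notin> bvs \<phi> \<and> (subst_fm \<phi> k \<sigma> (Var c \<sigma>) \<^bold>\<longrightarrow> Forall k \<sigma> \<phi>) \<in> W))"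
proof -
  define req :: "nat \<Rightarrow> nat \<times> nat \<times> ty \<times> fm" where "req = from_nat"
  define ok where "ok G r G' \<longleftrightarrow> (case r of (b, k, \<sigma>, \<phi>) \<Rightarrow> wf_fm \<phi> \<longrightarrow>
    (\<exists>c\<ge>b. (c, \<sigma>) \<notin> bvs \<phi> \<and> (subst_fm \<phi> k \<sigma> (Var c \<sigma>) \<^bold>\<longrightarrow> Forall k \<sigma> \<phi>) \<in> G'))" 
    for G :: "fm set" and r G'
  have ex: "\<exists>G'. (consistent T G' \<and> finite G') \<and> G \<subseteq> G' \<and> ok G (req n) G'"
    if G: "consistent T G \<and> finite G" for G n
  proof -
    obtain b k \<sigma> \<phi> where r: "req n = (b, k, \<sigma>, \<phi>)" by (metis prod_cases4)
    show ?thesis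
    proof (cases "wf_fm \<phi>")
      case False
      with r G show ?thesis by (intro exI[of _ G]) (auto simp: ok_def)
    next
      case True
      have "finite (fst ` (\<Union> (fvs ` G) \<union> fvs \<phi> \<union> bvs \<phi>))"
        using G by (auto simp: finite_fvs finite_bvs)
      then obtain c where c: "c \<ge> b" "c \<notin> fst ` (\<Union> (fvs ` G) \<union> fvs \<phi> \<union> bvs \<phi>)"
        by (metis finite_nat_set_iff_bounded_le le_cases not_less_eq_eq)
      then have c': "(c, \<sigma>) \<notin> \<Union> (fvs ` G)" "(c, \<sigma>) \<notin> fvs \<phi> \<union> bvs \<phi>" by force+
      then have "consistent T (insert (subst_fm \<phi> k \<sigma> (Var c \<sigma>) \<^bold>\<longrightarrow> Forall k \<sigma> \<phi>) G)"
        using G True by (intro consistent_witness) auto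
      then show ?thesis using G r c c'
        by (intro exI[of _ "insert (subst_fm \<phi> k \<sigma> (Var c \<sigma>) \<^bold>\<longrightarrow> Forall k \<sigma> \<phi>) G"]) 
          (auto simp: ok_def)
    qed
  qed
  obtain S where S0: "S 0 = H" and S: "\<And>n. consistent T (S n) \<and> finite (S n)"
    and SS: "\<And>n. S n \<subseteq> S (Suc n) \<and> ok (S n) (req n) (S (Suc n))"
  proof -
    have "\<exists>f. \<forall>n. (consistent T (f n) \<and> finite (f n) \<and> (n = 0 \<longrightarrow> f n = H)) \<and>
       (f n \<subseteq> f (Suc n) \<and> ok (f n) (req n) (f (Suc n)))"
      by (rule dependent_nat_choice) (use H fin ex in auto)
    then show ?thesis using that by blast
  qed
  have mono: "m \<le> n \<Longrightarrow> S m \<subseteq> S n" for m n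
    using SS by (simp add: lift_Suc_mono_le)
  let ?W = "\<Union>n. S n"
  have "consistent T ?W"
  proof (rule consistent_finite)
    fix F assume "finite F" "F \<subseteq> ?W"
    then have "\<exists>n. F \<subseteq> S n"
    proof (induction F)
      case (insert x F)
      then obtain m n where "F \<subseteq> S n" "x \<in> S m" by auto
      then have "insert x F \<subseteq> S (max m n)" using mono[of m "max m n"] mono[of n "max m n"] by auto
      then show ?case by blast
    qed auto
    then show "consistent T F" using S hil_mono unfolding consistent_def by meson
  qed
  moreover have "\<exists>c\<ge>b. (c, \<sigma>) \<notin> bvs \<phi> \<and> (subst_fm \<phi> k \<sigma> (Var c \<sigma>) \<^bold>\<longrightarrow> Forall k \<sigma> \<phi>) \<in> ?W"
    if "wf_fm \<phi>" for k \<sigma> \<phi> b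
  proof -
    have "req (to_nat (b, k, \<sigma>, \<phi>)) = (b, k, \<sigma>, \<phi>)" by (simp add: req_def)
    then show ?thesis using SS[of "to_nat (b, k, \<sigma>, \<phi>)"] that by (auto simp: ok_def)
  qed
  ultimately show ?thesis using S0 by (intro exI[of _ ?W]) auto
qed

lemma ex_maximal:
  assumes "consistent T W"
  shows "\<exists>M. W \<subseteq> M \<and> consistent T M \<and> (\<forall>\<phi>. wf_fm \<phi> \<longrightarrow> \<phi> \<in> M \<or> (\<^bold>\<not> \<phi>) \<in> M)"
proof -
  let ?A = "{M. W \<subseteq> M \<and> consistent T M}"
  have "\<exists>M\<in>?A. \<forall>X\<in>?A. M \<subseteq> X \<longrightarrow> X = M"
  proof (rule subset_Zorn_nonempty)
    show "?A \<noteq> {}" using assms by auto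
    fix C assume C: "C \<noteq> {}" "subset.chain ?A C"
    have "consistent T (\<Union> C)"
    proof (rule consistent_finite)
      fix F assume "finite F" "F \<subseteq> \<Union> C"
      then obtain N where N: "N \<in> C" "F \<subseteq> N" using C finite_subset_Union_chain[of F C ?A] by blast
      then have "consistent T N" using C(2) by (auto simp: subset.chain_def)
      then show "consistent T F" using N hil_mono unfolding consistent_def by meson
    qed
    moreover have "W \<subseteq> \<Union> C" using C by (fastforce simp: subset.chain_def)
    ultimately show "\<Union> C \<in> ?A" by simp
  qed
  then obtain M where M: "W \<subseteq> M" "consistent T M" and max: "\<And>X. M \<subseteq> X \<Longrightarrow> consistent T X \<Longrightarrow> X = M"
    by auto
  have "\<phi> \<in> M \<or> (\<^bold>\<not> \<phi>) \<in> M" if w: "wf_fm \<phi>" for \<phi>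
  proof (rule ccontr)
    assume a: "\<not> ?thesis"
    then have "\<not> consistent T (insert \<phi> M)" "\<not> consistent T (insert (\<^bold>\<not> \<phi>) M)"
      using max by blast+
    then have "hil T M (\<^bold>\<not> \<phi>)" "hil T M \<phi>" 
      using w hil_deduction hil_neg unfolding consistent_def by blast+
    then show False using M(2) hil.mp unfolding consistent_def by blast
  qed
  with M show ?thesis by blast
qed

section \<open>The term structure and the truth lemma\<close>

type_synonym asg = "nat \<times> ty \<Rightarrow> tm"

fun val :: "asg \<Rightarrow> tm \<Rightarrow> tm" where
  "val A (Var k \<sigma>) = A (k, \<sigma>)"
| "val A (s \<cdot> t) = val A s \<cdot> val A t"
| "val A t = t"

text \<open>The rules of the package are eta-expanded in \<open>A\<close>, which hides updated assignments.\<close>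

declare val.simps(2) [simp del]
lemma val_App [simp]: "val A (s \<cdot> t) = val A s \<cdot> val A t"
  by (rule val.simps(2))

definition obj :: "ty \<Rightarrow> tm set" where
  "obj \<sigma> = {t. wt t \<and> ty_of t = \<sigma>}"

definition good :: "asg \<Rightarrow> bool" where
  "good A \<longleftrightarrow> (\<forall>k \<sigma>. A (k, \<sigma>) \<in> obj \<sigma>)"

text \<open>
  Satisfaction in a term structure: an object of type \<open>\<sigma>\<close> is a term of type \<open>\<sigma>\<close>, and only
  equality and order at type 0 are not syntactic.
\<close>

fun sat :: "(tm \<Rightarrow> tm \<Rightarrow> bool) \<Rightarrow> (tm \<Rightarrow> tm \<Rightarrow> bool) \<Rightarrow> asg \<Rightarrow> fm \<Rightarrow> bool" where
  "sat E L A (s \<^bold>= t) \<longleftrightarrow> E (val A s) (val A t)"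
| "sat E L A (s \<^bold>< t) \<longleftrightarrow> L (val A s) (val A t)"
| "sat E L A Falsum \<longleftrightarrow> False"
| "sat E L A (\<phi> \<^bold>\<longrightarrow> \<psi>) \<longleftrightarrow> (sat E L A \<phi> \<longrightarrow> sat E L A \<psi>)"
| "sat E L A (Forall k \<sigma> \<phi>) \<longleftrightarrow> (\<forall>t\<in>obj \<sigma>. sat E L (A((k, \<sigma>) := t)) \<phi>)"

declare sat.simps(4) [simp del]
lemma sat_Imp [simp]: "sat E L A (\<phi> \<^bold>\<longrightarrow> \<psi>) \<longleftrightarrow> (sat E L A \<phi> \<longrightarrow> sat E L A \<psi>)"
  by (rule sat.simps(4))

lemma good_Var: "good (\<lambda>(k, \<sigma>). Var k \<sigma>)"
  by (simp add: good_def obj_def)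

lemma good_upd: "good A \<Longrightarrow> t \<in> obj \<sigma> \<Longrightarrow> good (A((k, \<sigma>) := t))"
  by (simp add: good_def)

lemma ty_of_val: "good A \<Longrightarrow> ty_of (val A t) = ty_of t"
  by (induction t) (auto simp: good_def obj_def)

lemma wt_val: "good A \<Longrightarrow> wt t \<Longrightarrow> wt (val A t)"
  by (induction t) (auto simp: ty_of_val, auto simp: good_def obj_def)

lemma val_obj: "good A \<Longrightarrow> wt t \<Longrightarrow> val A t \<in> obj (ty_of t)"
  by (simp add: obj_def ty_of_val wt_val)

lemma val_cong: "(\<And>x. x \<in> vars t \<Longrightarrow> A x = B x) \<Longrightarrow> val A t = val B t"
  by (induction t) auto

lemma val_Var: "val (\<lambda>(k, \<sigma>). Var k \<sigma>) t = t"
  by (induction t) auto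

lemma val_fresh: "(k, \<sigma>) \<notin> vars t \<Longrightarrow> val (A((k, \<sigma>) := u)) t = val A t"
  by (intro val_cong) auto

lemma sat_cong: "(\<And>x. x \<in> fvs \<phi> \<Longrightarrow> A x = B x) \<Longrightarrow> sat E L A \<phi> = sat E L B \<phi>"
proof (induction \<phi> arbitrary: A B)
  case (Forall k \<sigma> \<phi>)
  have "sat E L (A((k, \<sigma>) := t)) \<phi> = sat E L (B((k, \<sigma>) := t)) \<phi>" for t
    using Forall.prems by (intro Forall.IH) auto
  then show ?case by simp
next
  case (Imp \<phi> \<psi>)
  from Imp.IH[of A B] Imp.prems show ?case by simp
next
  case (Eq s t)
  from val_cong[of s A B] val_cong[of t A B] Eq show ?case by simp
next
  case (Less s t)
  from val_cong[of s A B] val_cong[of t A B] Less show ?case by simp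
qed simp

text \<open>\<open>inst A \<phi> \<phi>'\<close>: up to the names of bound variables, \<open>\<phi>'\<close> is \<open>\<phi>\<close> under the substitution \<open>A\<close>.\<close>

fun inst :: "asg \<Rightarrow> fm \<Rightarrow> fm \<Rightarrow> bool" where
  "inst A (s \<^bold>= t) \<phi>' \<longleftrightarrow> \<phi>' = (val A s \<^bold>= val A t)"
| "inst A (s \<^bold>< t) \<phi>' \<longleftrightarrow> \<phi>' = (val A s \<^bold>< val A t)"
| "inst A Falsum \<phi>' \<longleftrightarrow> \<phi>' = Falsum"
| "inst A (\<phi> \<^bold>\<longrightarrow> \<psi>) \<chi> \<longleftrightarrow> (\<exists>\<phi>' \<psi>'. \<chi> = (\<phi>' \<^bold>\<longrightarrow> \<psi>') \<and> inst A \<phi> \<phi>' \<and> inst A \<psi> \<psi>')"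
| "inst A (Forall k \<sigma> \<phi>) \<chi> \<longleftrightarrow> (\<exists>m \<phi>'. \<chi> = Forall m \<sigma> \<phi>' \<and> inst (A((k, \<sigma>) := Var m \<sigma>)) \<phi> \<phi>' \<and>
     (\<forall>x \<in> fvs \<phi> - {(k, \<sigma>)}. (m, \<sigma>) \<notin> vars (A x)))"

lemma inst_cong: "inst A \<phi> \<phi>' \<Longrightarrow> (\<And>x. x \<in> fvs \<phi> \<Longrightarrow> A x = B x) \<Longrightarrow> inst B \<phi> \<phi>'"
proof (induction \<phi> arbitrary: A B \<phi>')
  case (Forall k \<sigma> \<phi>)
  then obtain m \<psi> where m: "\<phi>' = Forall m \<sigma> \<psi>" "inst (A((k, \<sigma>) := Var m \<sigma>)) \<phi> \<psi>"
    "\<forall>x \<in> fvs \<phi> - {(k, \<sigma>)}. (m, \<sigma>) \<notin> vars (A x)" by auto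
  have "inst (B((k, \<sigma>) := Var m \<sigma>)) \<phi> \<psi>"
    using Forall.prems(2) by (intro Forall.IH[OF m(2)]) auto
  with m Forall.prems(2) show ?case by auto
next
  case (Imp \<phi> \<psi>)
  then obtain \<phi>1 \<psi>1 where "\<phi>' = (\<phi>1 \<^bold>\<longrightarrow> \<psi>1)" "inst A \<phi> \<phi>1" "inst A \<psi> \<psi>1" by auto
  moreover from this have "inst B \<phi> \<phi>1" "inst B \<psi> \<psi>1" using Imp by auto
  ultimately show ?case by simp
next
  case (Eq s t)
  from val_cong[of s A B] val_cong[of t A B] Eq show ?case by simp
next
  case (Less s t)
  from val_cong[of s A B] val_cong[of t A B] Less show ?case by simp
qed simp

lemma inst_Var: "inst (\<lambda>(k, \<sigma>). Var k \<sigma>) \<phi> \<phi>"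
proof (induction \<phi>)
  case (Forall k \<sigma> \<phi>)
  have "(\<lambda>(k, \<sigma>). Var k \<sigma>)((k, \<sigma>) := Var k \<sigma>) = (\<lambda>(k, \<sigma>). Var k \<sigma>)" by auto
  then show ?case using Forall by (auto split: prod.splits)
qed (auto simp: val_Var)

lemma inst_wf: "inst A \<phi> \<phi>' \<Longrightarrow> good A \<Longrightarrow> wf_fm \<phi> \<Longrightarrow> wf_fm \<phi>'"
proof (induction \<phi> arbitrary: A \<phi>')
  case (Forall k \<sigma> \<phi>)
  then obtain m \<psi> where m: "\<phi>' = Forall m \<sigma> \<psi>" "inst (A((k, \<sigma>) := Var m \<sigma>)) \<phi> \<psi>" by auto
  have "good (A((k, \<sigma>) := Var m \<sigma>))" using Forall.prems by (intro good_upd) (auto simp: obj_def)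
  then have "wf_fm \<psi>" by (rule Forall.IH[OF m(2)]) (use Forall.prems(3) in simp)
  with m show ?case by simp
qed (auto simp: ty_of_val wt_val)

lemma subst_tm_val: "subst_tm (val A s) m \<sigma> t = val (\<lambda>x. subst_tm (A x) m \<sigma> t) s"
  by (induction s) auto

lemma inst_subst: "inst A \<phi> \<phi>' \<Longrightarrow> vars t \<inter> bvs \<phi>' = {} \<Longrightarrow>
    inst (\<lambda>x. subst_tm (A x) m \<sigma> t) \<phi> (subst_fm \<phi>' m \<sigma> t)"
proof (induction \<phi> arbitrary: A \<phi>')
  case (Forall k \<tau> \<phi>)
  then obtain p \<psi> where p: "\<phi>' = Forall p \<tau> \<psi>" "inst (A((k, \<tau>) := Var p \<tau>)) \<phi> \<psi>"
    "\<forall>x \<in> fvs \<phi> - {(k, \<tau>)}. (p, \<tau>) \<notin> vars (A x)" by auto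
  show ?case
  proof (cases "(p, \<tau>) = (m, \<sigma>)")
    case True
    with p Forall.prems(1) show ?thesis
      by (auto elim!: inst_cong simp: subst_tm_idle)
  next
    case False
    have *: "(\<lambda>x. subst_tm ((A((k, \<tau>) := Var p \<tau>)) x) m \<sigma> t) =
      (\<lambda>x. subst_tm (A x) m \<sigma> t)((k, \<tau>) := Var p \<tau>)"
      using False by auto
    have "inst ((\<lambda>x. subst_tm (A x) m \<sigma> t)((k, \<tau>) := Var p \<tau>)) \<phi> (subst_fm \<psi> m \<sigma> t)"
      using Forall.IH[OF p(2)] Forall.prems(2) p(1) unfolding * by auto
    moreover have "(p, \<tau>) \<notin> vars (subst_tm (A x) m \<sigma> t)" if "x \<in> fvs \<phi> - {(k, \<tau>)}" for x
      using that p Forall.prems(2) vars_subst_tm[of "A x" m \<sigma> t] by auto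
    ultimately show ?thesis using p False by auto
  qed
qed (auto simp: subst_tm_val Int_Un_distrib)

text \<open>As \<open>subst_fm\<close> does not rename, a term may be substituted only into a
  variant whose binders avoid its variables. Moving all binders beyond a bound provides such a
  variant.\<close>

lemma ex_inst: "\<exists>\<phi>'. inst A \<phi> \<phi>' \<and> (\<forall>k \<sigma>. (k, \<sigma>) \<in> bvs \<phi>' \<longrightarrow> b \<le> k)"
proof (induction \<phi> arbitrary: A)
  case (Imp \<phi> \<psi>)
  obtain \<phi>' \<psi>' where "inst A \<phi> \<phi>' \<and> (\<forall>k \<sigma>. (k, \<sigma>) \<in> bvs \<phi>' \<longrightarrow> b \<le> k)"
    "inst A \<psi> \<psi>' \<and> (\<forall>k \<sigma>. (k, \<sigma>) \<in> bvs \<psi>' \<longrightarrow> b \<le> k)" using Imp by metis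
  then show ?case by (intro exI[of _ "\<phi>' \<^bold>\<longrightarrow> \<psi>'"]) auto
next
  case (Forall k \<sigma> \<phi>)
  have "finite (fst ` (\<Union>x\<in>fvs \<phi>. vars (A x)))" by (auto simp: finite_fvs finite_vars)
  then obtain c where c: "c \<ge> b" "c \<notin> fst ` (\<Union>x\<in>fvs \<phi>. vars (A x))"
    by (metis finite_nat_set_iff_bounded_le le_cases not_less_eq_eq)
  obtain \<psi> where "inst (A((k, \<sigma>) := Var c \<sigma>)) \<phi> \<psi> \<and> (\<forall>k \<sigma>. (k, \<sigma>) \<in> bvs \<psi> \<longrightarrow> b \<le> k)"
    using Forall by metis
  with c show ?case by (intro exI[of _ "Forall c \<sigma> \<psi>"]) force
qed auto

lemma inst_Forall_subst:
  assumes "inst A (Forall k \<sigma> \<phi>) (Forall m \<sigma> \<psi>)" "vars t \<inter> bvs \<psi> = {}"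
  shows "inst (A((k, \<sigma>) := t)) \<phi> (subst_fm \<psi> m \<sigma> t)"
proof -
  have "inst (A((k, \<sigma>) := Var m \<sigma>)) \<phi> \<psi>" and m: "\<forall>x \<in> fvs \<phi> - {(k, \<sigma>)}. (m, \<sigma>) \<notin> vars (A x)"
    using assms by auto
  from inst_subst[OF this(1) assms(2)] show ?thesis
    by (rule inst_cong) (use m in \<open>auto simp: subst_tm_idle\<close>)
qed

text \<open>Because of capture there is no single formula that is \<open>\<phi>\<close> under
  \<open>A\<close>. The statement therefore ranges over all variants \<open>\<phi>'\<close> at once,
  and the quantifier case can exchange one variant for another that suits the term at hand.\<close>

lemma truth_lemma:
  assumes cons: "consistent T M"
    and max: "\<And>\<phi>. wf_fm \<phi> \<Longrightarrow> \<phi> \<in> M \<or> (\<^bold>\<not> \<phi>) \<in> M"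
    and wit: "\<And>k \<sigma> \<phi> b. wf_fm \<phi> \<Longrightarrow>
      \<exists>c\<ge>b. (c, \<sigma>) \<notin> bvs \<phi> \<and> (subst_fm \<phi> k \<sigma> (Var c \<sigma>) \<^bold>\<longrightarrow> Forall k \<sigma> \<phi>) \<in> M"
    and E: "E = (\<lambda>s t. hil T M (s \<^bold>= t))" and L: "L = (\<lambda>s t. hil T M (s \<^bold>< t))"
    and "inst A \<phi> \<phi>'" "good A" "wf_fm \<phi>"
  shows "sat E L A \<phi> \<longleftrightarrow> hil T M \<phi>'"
  using assms(6-8)
proof (induction \<phi> arbitrary: A \<phi>')
  case (Eq s t) then show ?case by (simp add: E)
next
  case (Less s t) then show ?case by (simp add: L)
next
  case Falsum then show ?case using cons by (simp add: consistent_def)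
next
  case (Imp \<phi> \<psi>)
  then obtain \<phi>1 \<psi>1 where i: "\<phi>' = (\<phi>1 \<^bold>\<longrightarrow> \<psi>1)" "inst A \<phi> \<phi>1" "inst A \<psi> \<psi>1" by auto
  have w: "wf_fm \<phi>1" "wf_fm \<psi>1" using Imp.prems i inst_wf by auto
  have IH: "sat E L A \<phi> \<longleftrightarrow> hil T M \<phi>1" "sat E L A \<psi> \<longleftrightarrow> hil T M \<psi>1"
    using Imp i by simp_all
  have "hil T M (\<phi>1 \<^bold>\<longrightarrow> \<psi>1)" if a: "hil T M \<phi>1 \<longrightarrow> hil T M \<psi>1"
  proof (cases "\<phi>1 \<in> M")
    case True
    then have "hil T M \<psi>1" using a w hil.hyp by blast
    then have "hil T (insert \<phi>1 M) \<psi>1" by (rule hil_mono) auto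
    then show ?thesis using w by (intro hil_deduction)
  next
    case False
    then have n: "(\<^bold>\<not> \<phi>1) \<in> M" using max w by blast
    have "hil T (insert \<phi>1 M) (\<^bold>\<not> \<phi>1)" "hil T (insert \<phi>1 M) \<phi>1"
      using n w by (auto intro: hil.hyp)
    then have "hil T (insert \<phi>1 M) Falsum" by (rule hil.mp)
    then have "hil T (insert (\<^bold>\<not> \<psi>1) (insert \<phi>1 M)) Falsum" by (rule hil_mono) auto
    then have "hil T (insert \<phi>1 M) \<psi>1" by (rule hil_neg) (use w in auto)
    then show ?thesis using w by (intro hil_deduction)
  qed
  then show ?case using IH i(1) hil.mp by auto
next
  case (Forall k \<sigma> \<phi>)
  have IH: "sat E L (A((k, \<sigma>) := t)) \<phi> \<longleftrightarrow> hil T M \<psi>" 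
    if "t \<in> obj \<sigma>" "inst (A((k, \<sigma>) := t)) \<phi> \<psi>" for t \<psi>
    
    by (rule Forall.IH[OF that(2) good_upd[OF Forall.prems(2) that(1)]]) (use Forall.prems(3) in simp)
  have V: "Var c \<sigma> \<in> obj \<sigma>" for c by (simp add: obj_def)
  have elim: "hil T M (subst_fm \<psi> m \<sigma> t)"
    if "hil T M (Forall m \<sigma> \<psi>)" "t \<in> obj \<sigma>" "vars t \<inter> bvs \<psi> = {}" for m \<psi> t
    using that by (intro hil_AllE free_for_disjoint) (auto simp: obj_def)
  have intr: "\<exists>c\<ge>b. (c, \<sigma>) \<notin> bvs \<psi> \<and> \<not> hil T M (subst_fm \<psi> m \<sigma> (Var c \<sigma>))"
    if n: "\<not> hil T M (Forall m \<sigma> \<psi>)" and w: "wf_fm \<psi>" for m \<psi> b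
  proof -
    obtain c where c: "c \<ge> b" "(c, \<sigma>) \<notin> bvs \<psi>"
      "(subst_fm \<psi> m \<sigma> (Var c \<sigma>) \<^bold>\<longrightarrow> Forall m \<sigma> \<psi>) \<in> M"
      using wit[OF w] by blast
    have "hil T M (subst_fm \<psi> m \<sigma> (Var c \<sigma>) \<^bold>\<longrightarrow> Forall m \<sigma> \<psi>)"
      using c(3) w by (intro hil.hyp) (auto intro!: wf_subst_fm)
    then show ?thesis using n c hil.mp by blast
  qed
  obtain m \<psi> where \<psi>: "\<phi>' = Forall m \<sigma> \<psi>" using Forall.prems(1) by auto
  have i: "inst A (Forall k \<sigma> \<phi>) (Forall m \<sigma> \<psi>)" using Forall.prems(1) \<psi> by simp
  have wfi: "wf_fm \<chi>" if "inst A (Forall k \<sigma> \<phi>) (Forall p \<sigma> \<chi>)" for p \<chi>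
    using inst_wf[OF that] Forall.prems by simp
  show ?case
  proof
    assume s: "sat E L A (Forall k \<sigma> \<phi>)"
    show "hil T M \<phi>'"
    proof (rule ccontr)
      assume "\<not> ?thesis"
      then obtain c where c: "(c, \<sigma>) \<notin> bvs \<psi>" "\<not> hil T M (subst_fm \<psi> m \<sigma> (Var c \<sigma>))"
        using intr[of m \<psi> 0] wfi[OF i] \<psi> by blast
      have "inst (A((k, \<sigma>) := Var c \<sigma>)) \<phi> (subst_fm \<psi> m \<sigma> (Var c \<sigma>))"
        using c by (intro inst_Forall_subst[OF i]) auto
      then show False using IH[OF V] s V c by auto
    qed
  next
    assume h: "hil T M \<phi>'"
    show "sat E L A (Forall k \<sigma> \<phi>)"
    proof (rule ccontr)
      assume "\<not> ?thesis"
      then obtain t where t: "t \<in> obj \<sigma>" "\<not> sat E L (A((k, \<sigma>) := t)) \<phi>" by auto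
      obtain b where b: "\<And>p \<tau>. (p, \<tau>) \<in> vars t \<union> bvs \<psi> \<Longrightarrow> p < b"
      proof -
        have "finite (fst ` (vars t \<union> bvs \<psi>))" by (simp add: finite_vars finite_bvs)
        then obtain b where "\<forall>x \<in> fst ` (vars t \<union> bvs \<psi>). x < b"
          by (meson finite_nat_set_iff_bounded)
        then have "(p, \<tau>) \<in> vars t \<union> bvs \<psi> \<Longrightarrow> p < b" for p \<tau> by (metis fst_conv imageI)
        then show ?thesis by (rule that)
      qed
      \<comment> \<open>The counterexample \<open>t\<close> may clash with the binders of
        \<open>\<psi>\<close>, so it is first placed in a variant \<open>\<chi>\<close> with binders
        above \<open>b\<close>. Then \<open>Forall p \<sigma> \<chi>\<close> is not derivable, and a
        Henkin variable \<open>c \<ge> b\<close> replaces \<open>t\<close>. This variable is free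
        for \<open>\<psi>\<close> as well, and there it contradicts the derivability of
        \<open>\<phi>'\<close>.\<close>
      obtain \<chi>0 where "inst A (Forall k \<sigma> \<phi>) \<chi>0" and b0: "\<forall>p \<tau>. (p, \<tau>) \<in> bvs \<chi>0 \<longrightarrow> b \<le> p"
        using ex_inst by blast
      then obtain p \<chi> where i2: "inst A (Forall k \<sigma> \<phi>) (Forall p \<sigma> \<chi>)"
        and b2: "\<And>q \<tau>. (q, \<tau>) \<in> bvs \<chi> \<Longrightarrow> b \<le> q" by (cases \<chi>0) auto
      have "vars t \<inter> bvs \<chi> = {}" using b b2 by fastforce
      then have "inst (A((k, \<sigma>) := t)) \<phi> (subst_fm \<chi> p \<sigma> t)" "\<not> hil T M (Forall p \<sigma> \<chi>)"
        using inst_Forall_subst[OF i2] elim[of p \<chi> t] t IH by auto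
      then obtain c where c: "c \<ge> b" "(c, \<sigma>) \<notin> bvs \<chi>" "\<not> hil T M (subst_fm \<chi> p \<sigma> (Var c \<sigma>))"
        using intr[of p \<chi> b] wfi[OF i2] by blast
      have "inst (A((k, \<sigma>) := Var c \<sigma>)) \<phi> (subst_fm \<chi> p \<sigma> (Var c \<sigma>))"
        using c by (intro inst_Forall_subst[OF i2]) auto
      then have "\<not> sat E L (A((k, \<sigma>) := Var c \<sigma>)) \<phi>" using IH[OF V] c(3) by simp
      moreover have d: "vars (Var c \<sigma>) \<inter> bvs \<psi> = {}" using b[of c \<sigma>] c(1) by auto
      moreover have "hil T M (subst_fm \<psi> m \<sigma> (Var c \<sigma>))"
        using elim h \<psi> V d by simp
      ultimately show False using IH[OF V inst_Forall_subst[OF i d]] by simp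
    qed
  qed
qed

text \<open>The equivalence and congruence properties are part of the conclusion because the objects
  are still terms, and type 0 is to be divided by \<open>E\<close> later.\<close>

theorem ex_term_model:
  assumes np: "\<not> (T; {} \<turnstile> \<theta>)" and w: "wf_fm \<theta>"
  shows "\<exists>E L. (\<forall>A \<phi>. good A \<longrightarrow> \<phi> \<in> T \<longrightarrow> wf_fm \<phi> \<longrightarrow> sat E L A \<phi>) \<and>
    \<not> sat E L (\<lambda>(k, \<sigma>). Var k \<sigma>) \<theta> \<and>
    (\<forall>s\<in>obj Ty0. E s s) \<and> (\<forall>s t. E s t \<longrightarrow> E t s) \<and> (\<forall>r s t. E r s \<longrightarrow> E s t \<longrightarrow> E r t) \<and>
    (\<forall>s t s' t'. E s s' \<longrightarrow> E t t' \<longrightarrow> L s t \<longrightarrow> L s' t')"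
proof -
  let ?V = "\<lambda>(k, \<sigma>). Var k \<sigma>"
  have "consistent T {\<^bold>\<not> \<theta>}"
  proof (rule ccontr)
    assume "\<not> ?thesis"
    then have "hil T {} \<theta>" using w hil_neg unfolding consistent_def by blast
    then show False using np hil_empty by blast
  qed
  then obtain W where W: "{\<^bold>\<not> \<theta>} \<subseteq> W" "consistent T W"
    and wit: "\<And>k \<sigma> \<phi> b. wf_fm \<phi> \<Longrightarrow>
    (\<exists>c\<ge>b. (c, \<sigma>) \<notin> bvs \<phi> \<and> (subst_fm \<phi> k \<sigma> (Var c \<sigma>) \<^bold>\<longrightarrow> Forall k \<sigma> \<phi>) \<in> W)"
    using ex_witness_set[of T "{\<^bold>\<not> \<theta>}"] by auto
  obtain M where M: "W \<subseteq> M" "consistent T M" and max: "\<And>\<phi>. wf_fm \<phi> \<Longrightarrow> \<phi> \<in> M \<or> (\<^bold>\<not> \<phi>) \<in> M"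
    using ex_maximal[OF W(2)] by auto
  define E where "E = (\<lambda>s t. hil T M (s \<^bold>= t))"
  define L where "L = (\<lambda>s t. hil T M (s \<^bold>< t))"
  have wit': "\<exists>c\<ge>b. (c, \<sigma>) \<notin> bvs \<phi> \<and> (subst_fm \<phi> k \<sigma> (Var c \<sigma>) \<^bold>\<longrightarrow> Forall k \<sigma> \<phi>) \<in> M"
    if "wf_fm \<phi>" for k \<sigma> \<phi> b using wit[OF that] M(1) by blast
  have truth: "inst A \<phi> \<phi>' \<Longrightarrow> good A \<Longrightarrow> wf_fm \<phi> \<Longrightarrow> sat E L A \<phi> \<longleftrightarrow> hil T M \<phi>'" for A \<phi> \<phi>'
    by (rule truth_lemma[OF M(2) _ _ E_def L_def]) (use max wit' in auto)
  have tr: "sat E L ?V \<phi> \<longleftrightarrow> hil T M \<phi>" if "wf_fm \<phi>" for \<phi>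
    using truth[OF inst_Var good_Var that] by blast
  have "\<not> hil T M \<theta>"
  proof
    assume "hil T M \<theta>"
    moreover have "hil T M (\<^bold>\<not> \<theta>)" using M W w by (intro hil.hyp) auto
    ultimately show False using M(2) hil.mp unfolding consistent_def by blast
  qed
  then have th: "\<not> sat E L ?V \<theta>" using tr w by simp
  have ax: "sat E L A \<phi>" if A: "good A" and \<phi>: "\<phi> \<in> T" "wf_fm \<phi>" for A \<phi>
  proof -
    \<comment> \<open>An axiom with free variables has to hold under every assignment, not only
      under the identity. Generalisation from no hypotheses proves its closure, and the closure is
      then instantiated with the values of \<open>A\<close>.\<close>
    have "T; {} \<turnstile> foldr (\<lambda>(k, \<sigma>). Forall k \<sigma>) xs \<phi>" for xs
      by (induction xs) (auto intro: derives.AllI simp: derives.Axiom[OF \<phi>])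
    then have all: "sat E L ?V (foldr (\<lambda>(k, \<sigma>). Forall k \<sigma>) xs \<phi>)" for xs
      using tr derives_wf hil.base by blast
    obtain xs where xs: "set xs = fvs \<phi>" using finite_list[OF finite_fvs] by blast
    have "sat E L B (foldr (\<lambda>(k, \<sigma>). Forall k \<sigma>) xs \<phi>) \<Longrightarrow>
       (\<And>x. x \<in> fvs \<phi> - set xs \<Longrightarrow> B x = A x) \<Longrightarrow> sat E L A \<phi>" for B xs
    proof (induction xs arbitrary: B)
      case Nil
      then show ?case using sat_cong[of \<phi> B A] by auto
    next
      case (Cons x xs)
      obtain k \<sigma> where x: "x = (k, \<sigma>)" by (cases x)
      have "A x \<in> obj \<sigma>" using A x by (simp add: good_def)
      then have "sat E L (B(x := A x)) (foldr (\<lambda>(k, \<sigma>). Forall k \<sigma>) xs \<phi>)"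
        using Cons.prems(1) x by simp
      then show ?case by (rule Cons.IH) (use Cons.prems(2) in auto)
    qed
    from this[OF all[of xs]] show ?thesis using xs by simp
  qed
  have subst: "hil T M (subst_fm \<phi> k Ty0 s) \<Longrightarrow> hil T M (subst_fm \<phi> k Ty0 t)"
    if e: "hil T M (s \<^bold>= t)" and \<phi>: "wf_fm \<phi>" "qfree \<phi>" for \<phi> k s t
  proof -
    have w: "wf_fm (s \<^bold>= t)" using e by (rule hil_wf)
    then have w2: "wf_fm (subst_fm \<phi> k Ty0 s)" using \<phi> by (intro wf_subst_fm) auto
    have ff: "free_for u k Ty0 \<phi>" for u using \<phi>(2) by (induction \<phi>) auto
    have "T; {} \<turnstile> ((s \<^bold>= t) \<^bold>\<longrightarrow> subst_fm \<phi> k Ty0 s \<^bold>\<longrightarrow> subst_fm \<phi> k Ty0 t)"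
      using w w2 \<phi> ff
      by (intro derives.ImpI derives.EqSubst[of _ _ s t] derives.Assume) auto
    then show "hil T M (subst_fm \<phi> k Ty0 s) \<Longrightarrow> hil T M (subst_fm \<phi> k Ty0 t)"
      using e by (meson hil.base hil.mp)
  qed
  have fresh: "\<exists>k. (k, Ty0) \<notin> vars r" for r
  proof -
    have "finite (fst ` vars r)" by (simp add: finite_vars)
    then obtain k where "k \<notin> fst ` vars r" using ex_new_if_finite infinite_UNIV_nat by blast
    then show ?thesis by force
  qed
  have hr: "hil T M (s \<^bold>= s)" if "s \<in> obj Ty0" for s
    using that by (intro hil.base derives.EqRefl) (auto simp: obj_def)
  have wE: "s \<in> obj Ty0 \<and> t \<in> obj Ty0" if "hil T M (s \<^bold>= t)" for s t
    using hil_wf[OF that] by (simp add: obj_def)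
  have wL: "s \<in> obj Ty0 \<and> t \<in> obj Ty0" if "hil T M (s \<^bold>< t)" for s t
    using hil_wf[OF that] by (simp add: obj_def)
  have sym: "hil T M (t \<^bold>= s)" if e: "hil T M (s \<^bold>= t)" for s t
  proof -
    obtain k where k: "(k, Ty0) \<notin> vars s" using fresh by blast
    show ?thesis using subst[OF e, of "Var k Ty0 \<^bold>= s" k] wE[OF e] hr k
      by (simp add: subst_tm_idle obj_def)
  qed
  have trans: "hil T M (r \<^bold>= t)" if e: "hil T M (s \<^bold>= t)" "hil T M (r \<^bold>= s)" for r s t
  proof -
    obtain k where k: "(k, Ty0) \<notin> vars r" using fresh by blast
    show ?thesis using subst[OF e(1), of "r \<^bold>= Var k Ty0" k] wE[OF e(2)] e(2) k
      by (simp add: subst_tm_idle obj_def)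
  qed
  have congr: "hil T M (s' \<^bold>< t)" if e: "hil T M (s \<^bold>= s')" "hil T M (s \<^bold>< t)" for s s' t
  proof -
    obtain k where k: "(k, Ty0) \<notin> vars t" using fresh by blast
    show ?thesis using subst[OF e(1), of "Var k Ty0 \<^bold>< t" k] wL[OF e(2)] e(2) k
      by (simp add: subst_tm_idle obj_def)
  qed
  have congl: "hil T M (s \<^bold>< t')" if e: "hil T M (t \<^bold>= t')" "hil T M (s \<^bold>< t)" for s t t'
  proof -
    obtain k where k: "(k, Ty0) \<notin> vars s" using fresh by blast
    show ?thesis using subst[OF e(1), of "s \<^bold>< Var k Ty0" k] wL[OF e(2)] e(2) k
      by (simp add: subst_tm_idle obj_def)
  qed
  show ?thesis
    using ax th hr sym trans congr congl unfolding E_def L_def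
    by (intro exI[of _ "\<lambda>s t. hil T M (s \<^bold>= t)"] exI[of _ "\<lambda>s t. hil T M (s \<^bold>< t)"]) blast
qed

section \<open>Models of \<open>RCA\<^sub>0\<^sup>\<omega>\<close>\<close>

abbreviation idasg :: asg ("\<iota>") where "\<iota> \<equiv> (\<lambda>(k, \<sigma>). Var k \<sigma>)"

lemma obj_App [simp, intro]: "s \<in> obj (\<sigma> \<Rrightarrow> \<tau>) \<Longrightarrow> t \<in> obj \<sigma> \<Longrightarrow> s \<cdot> t \<in> obj \<tau>"
  by (auto simp: obj_def)

lemma obj_consts [simp, intro]:
  "Zero \<in> obj Ty0" "One \<in> obj Ty0" "Plus \<in> obj (Ty0 \<Rrightarrow> Ty0 \<Rrightarrow> Ty0)" "Times \<in> obj (Ty0 \<Rrightarrow> Ty0 \<Rrightarrow> Ty0)"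
  "CombK \<sigma> \<tau> \<in> obj (\<sigma> \<Rrightarrow> \<tau> \<Rrightarrow> \<sigma>)"
  "CombS \<rho> \<sigma> \<tau> \<in> obj ((\<rho> \<Rrightarrow> \<sigma> \<Rrightarrow> \<tau>) \<Rrightarrow> (\<rho> \<Rrightarrow> \<sigma>) \<Rrightarrow> \<rho> \<Rrightarrow> \<tau>)"
  "Rec \<in> obj ((Ty0 \<Rrightarrow> Ty0 \<Rrightarrow> Ty0) \<Rrightarrow> Ty0 \<Rrightarrow> Ty0 \<Rrightarrow> Ty0)" "Var k \<sigma> \<in> obj \<sigma>"
  by (auto simp: obj_def)

lemma obj_arith [simp, intro]:
  "s \<in> obj Ty0 \<Longrightarrow> t \<in> obj Ty0 \<Longrightarrow> s \<^bold>+ t \<in> obj Ty0"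
  "s \<in> obj Ty0 \<Longrightarrow> t \<in> obj Ty0 \<Longrightarrow> s \<^bold>* t \<in> obj Ty0"
  by (auto simp: obj_def)

lemma good_id [simp]: "good \<iota>"
  by (rule good_Var)

declare good_upd [simp, intro]

lemma var_bound_vars: "(k, \<sigma>) \<in> vars t \<Longrightarrow> k < var_bound t"
  by (induction t) auto

lemma fresh_not_vars [simp]: "t \<in> set ts \<Longrightarrow> (fresh ts, \<sigma>) \<notin> vars t"
proof
  assume t: "t \<in> set ts" and "(fresh ts, \<sigma>) \<in> vars t"
  then have "fresh ts < var_bound t" by (intro var_bound_vars)
  moreover from t have "var_bound t \<le> fresh ts" unfolding fresh_def by (induction ts) auto
  ultimately show False by simp
qed

lemma val_fresh_upd [simp]: "t \<in> set ts \<Longrightarrow> val (A((fresh ts, \<sigma>) := u)) t = val A t"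
  by (rule val_fresh) simp

lemma val_var_bound_upd: "var_bound t \<le> k \<Longrightarrow> val (A((k, \<sigma>) := u)) t = val A t"
  using var_bound_vars[of k \<sigma> t] by (intro val_fresh) auto

lemma val_closed: "vars t = {} \<Longrightarrow> val A t = t"
  using val_cong[of t A "\<iota>"] by (simp add: val_Var)

lemma ty_of_abstr [simp]: "ty_of (abstr k \<sigma> t) = (\<sigma> \<Rrightarrow> ty_of t)"
  by (induction t) auto

lemma wt_abstr [simp]: "wt t \<Longrightarrow> wt (abstr k \<sigma> t)"
  by (induction t) auto

lemma vars_abstr [simp]: "vars (abstr k \<sigma> t) = vars t - {(k, \<sigma>)}"
  by (induction t) auto

lemma sat_univ: "sat E L A (univ \<sigma> ts F) \<longleftrightarrow>
    (\<forall>u\<in>obj \<sigma>. sat E L (A((fresh ts, \<sigma>) := u)) (F (Var (fresh ts) \<sigma>)))"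
  by (simp add: univ_def)

lemma sat_exis: "sat E L A (exis \<sigma> ts F) \<longleftrightarrow>
    (\<exists>u\<in>obj \<sigma>. sat E L (A((fresh ts, \<sigma>) := u)) (F (Var (fresh ts) \<sigma>)))"
  by (simp add: exis_def)

primrec eqv :: "(tm \<Rightarrow> tm \<Rightarrow> bool) \<Rightarrow> ty \<Rightarrow> tm \<Rightarrow> tm \<Rightarrow> bool" where
  "eqv E Ty0 s t = E s t"
| "eqv E (\<sigma> \<Rrightarrow> \<tau>) s t = (\<forall>z\<in>obj \<sigma>. eqv E \<tau> (s \<cdot> z) (t \<cdot> z))"

lemma sat_eq_at: "sat E L A (eq_at \<sigma> s t) \<longleftrightarrow> eqv E \<sigma> (val A s) (val A t)"
  by (induction \<sigma> arbitrary: A s t) (auto simp: sat_univ)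

lemma wf_eq_at: "s \<in> obj \<sigma> \<Longrightarrow> t \<in> obj \<sigma> \<Longrightarrow> wf_fm (eq_at \<sigma> s t)"
proof (induction \<sigma> arbitrary: s t)
  case Ty0 then show ?case by (simp add: obj_def)
next
  case (Arr \<sigma> \<tau>)
  then show ?case by (auto simp: univ_def)
qed

lemma val_subst_tm: "val A (subst_tm s k \<sigma> t) = val (A((k, \<sigma>) := val A t)) s"
  by (induction s) auto

lemma sat_subst_qfree: "qfree \<phi> \<Longrightarrow>
    sat E L A (subst_fm \<phi> k \<sigma> t) \<longleftrightarrow> sat E L (A((k, \<sigma>) := val A t)) \<phi>"
  by (induction \<phi>) (auto simp: val_subst_tm)

locale rca_model =
  fixes E L :: "tm \<Rightarrow> tm \<Rightarrow> bool"
  assumes rca: "good A \<Longrightarrow> \<phi> \<in> RCA0_omega \<Longrightarrow> wf_fm \<phi> \<Longrightarrow> sat E L A \<phi>"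
    and E_refl: "s \<in> obj Ty0 \<Longrightarrow> E s s"
    and E_sym: "E s t \<Longrightarrow> E t s"
    and E_trans: "E r s \<Longrightarrow> E s t \<Longrightarrow> E r t"
    and L_cong: "E s s' \<Longrightarrow> E t t' \<Longrightarrow> L s t \<Longrightarrow> L s' t'"
begin

lemma eqv_trans: "eqv E \<sigma> r s \<Longrightarrow> eqv E \<sigma> s t \<Longrightarrow> eqv E \<sigma> r t"
  by (induction \<sigma> arbitrary: r s t) (auto intro: E_trans)

lemma eqv_K:
  assumes "x \<in> obj \<sigma>" "y \<in> obj \<tau>" shows "eqv E \<sigma> (CombK \<sigma> \<tau> \<cdot> x \<cdot> y) x"
proof -
  let ?A = "\<iota>((0, \<sigma>) := x, (1, \<tau>) := y)"
  let ?\<phi> = "eq_at \<sigma> (CombK \<sigma> \<tau> \<cdot> Var 0 \<sigma> \<cdot> Var 1 \<tau>) (Var 0 \<sigma>)"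
  have "sat E L ?A ?\<phi>"
    using assms by (intro rca wf_eq_at obj_App[of _ \<tau>] obj_App[of _ \<sigma>])
      (auto simp: RCA0_omega_def combinator_axioms_def)
  then show ?thesis by (simp add: sat_eq_at)
qed

lemma eqv_S:
  assumes "x \<in> obj (\<rho> \<Rrightarrow> \<sigma> \<Rrightarrow> \<tau>)" "y \<in> obj (\<rho> \<Rrightarrow> \<sigma>)" "z \<in> obj \<rho>"
  shows "eqv E \<tau> (CombS \<rho> \<sigma> \<tau> \<cdot> x \<cdot> y \<cdot> z) (x \<cdot> z \<cdot> (y \<cdot> z))"
proof -
  let ?x = "Var 0 (\<rho> \<Rrightarrow> \<sigma> \<Rrightarrow> \<tau>)" and ?y = "Var 1 (\<rho> \<Rrightarrow> \<sigma>)" and ?z = "Var 2 \<rho>"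
  let ?A = "\<iota>((0, \<rho> \<Rrightarrow> \<sigma> \<Rrightarrow> \<tau>) := x, (1, \<rho> \<Rrightarrow> \<sigma>) := y, (2, \<rho>) := z)"
  let ?\<phi> = "eq_at \<tau> (CombS \<rho> \<sigma> \<tau> \<cdot> ?x \<cdot> ?y \<cdot> ?z) (?x \<cdot> ?z \<cdot> (?y \<cdot> ?z))"
  have "wf_fm ?\<phi>"
    by (rule wf_eq_at) (simp_all add: obj_def)
  moreover have "?\<phi> \<in> RCA0_omega"
    unfolding RCA0_omega_def combinator_axioms_def by blast
  ultimately have "sat E L ?A ?\<phi>" using assms by (intro rca) auto
  then show ?thesis by (simp add: sat_eq_at)
qed

lemma eqv_ext:
  assumes "x \<in> obj \<rho>" "y \<in> obj \<rho>" "f \<in> obj (\<rho> \<Rrightarrow> \<tau>)" "eqv E \<rho> x y"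
  shows "eqv E \<tau> (f \<cdot> x) (f \<cdot> y)"
proof -
  let ?x = "Var 0 \<rho>" and ?y = "Var 1 \<rho>" and ?f = "Var 2 (\<rho> \<Rrightarrow> \<tau>)"
  let ?A = "\<iota>((0, \<rho>) := x, (1, \<rho>) := y, (2, \<rho> \<Rrightarrow> \<tau>) := f)"
  let ?\<phi> = "eq_at \<rho> ?x ?y \<^bold>\<longrightarrow> eq_at \<tau> (?f \<cdot> ?x) (?f \<cdot> ?y)"
  have "wf_fm ?\<phi>" by (auto intro!: wf_eq_at simp: obj_def)
  moreover have "?\<phi> \<in> RCA0_omega"
    unfolding RCA0_omega_def extensionality_axioms_def by blast
  ultimately have "sat E L ?A ?\<phi>" using assms by (intro rca) auto
  then show ?thesis using assms by (simp add: sat_eq_at)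
qed

lemma eqv_App:
  assumes "f \<in> obj (\<rho> \<Rrightarrow> \<tau>)" "g \<in> obj (\<rho> \<Rrightarrow> \<tau>)" "x \<in> obj \<rho>" "y \<in> obj \<rho>"
    "eqv E (\<rho> \<Rrightarrow> \<tau>) f g" "eqv E \<rho> x y"
  shows "eqv E \<tau> (f \<cdot> x) (g \<cdot> y)"
  using eqv_trans[of \<tau> "f \<cdot> x" "f \<cdot> y" "g \<cdot> y"] eqv_ext[of x \<rho> y f \<tau>] assms by simp

text \<open>Beta conversion holds only up to pointwise equality. In the application case the axiom
  for \<open>CombS\<close> leads to pointwise equal functions applied to pointwise equal arguments,
  and extensionality permits the exchange of the argument.\<close>

lemma abstr_beta:
  assumes "good A" "wt t" "a \<in> obj \<sigma>"
  shows "eqv E (ty_of t) (val A (abstr k \<sigma> t) \<cdot> a) (val (A((k, \<sigma>) := a)) t)"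
  using assms(2)
proof (induction t)
  case (App s t)
  then obtain \<tau> where ty: "ty_of s = ty_of t \<Rrightarrow> \<tau>" by auto
  let ?u = "val A (abstr k \<sigma> s)" and ?v = "val A (abstr k \<sigma> t)"
  have o: "?u \<in> obj (\<sigma> \<Rrightarrow> ty_of t \<Rrightarrow> \<tau>)" "?v \<in> obj (\<sigma> \<Rrightarrow> ty_of t)"
    using val_obj[OF assms(1), of "abstr k \<sigma> s"] val_obj[OF assms(1), of "abstr k \<sigma> t"] App ty by auto
  have o': "val (A((k, \<sigma>) := a)) s \<in> obj (ty_of t \<Rrightarrow> \<tau>)" "val (A((k, \<sigma>) := a)) t \<in> obj (ty_of t)"
    using val_obj[of "A((k, \<sigma>) := a)"] App ty assms by (metis good_upd wt.simps(1))+
  have "eqv E \<tau> (CombS \<sigma> (ty_of t) \<tau> \<cdot> ?u \<cdot> ?v \<cdot> a) (?u \<cdot> a \<cdot> (?v \<cdot> a))"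
    using o assms by (intro eqv_S)
  moreover have "eqv E \<tau> (?u \<cdot> a \<cdot> (?v \<cdot> a)) (val (A((k, \<sigma>) := a)) s \<cdot> val (A((k, \<sigma>) := a)) t)"
  proof (rule eqv_App[of _ "ty_of t"])
    show "eqv E (ty_of t \<Rrightarrow> \<tau>) (?u \<cdot> a) (val (A((k, \<sigma>) := a)) s)"
      using App.IH(1) App.prems unfolding ty by (metis wt.simps(1))
    show "eqv E (ty_of t) (?v \<cdot> a) (val (A((k, \<sigma>) := a)) t)"
      using App.IH(2) App.prems by (metis wt.simps(1))
  qed (use o o' assms in blast)+
  ultimately have "eqv E \<tau> (CombS \<sigma> (ty_of t) \<tau> \<cdot> ?u \<cdot> ?v \<cdot> a)
      (val (A((k, \<sigma>) := a)) s \<cdot> val (A((k, \<sigma>) := a)) t)" by (rule eqv_trans)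
  then show ?case by (simp only: abstr.simps val.simps val_App ty ty_of.simps ty.case)
next
  case (Var j \<tau>)
  show ?case
  proof (cases "(j, \<tau>) = (k, \<sigma>)")
    case True
    have "eqv E \<sigma> (CombS \<sigma> (\<sigma> \<Rrightarrow> \<sigma>) \<sigma> \<cdot> CombK \<sigma> (\<sigma> \<Rrightarrow> \<sigma>) \<cdot> CombK \<sigma> \<sigma> \<cdot> a)
       (CombK \<sigma> (\<sigma> \<Rrightarrow> \<sigma>) \<cdot> a \<cdot> (CombK \<sigma> \<sigma> \<cdot> a))"
      using assms by (intro eqv_S) auto
    moreover have "eqv E \<sigma> (CombK \<sigma> (\<sigma> \<Rrightarrow> \<sigma>) \<cdot> a \<cdot> (CombK \<sigma> \<sigma> \<cdot> a)) a"
      using assms obj_App[OF obj_consts(5)[of \<sigma> \<sigma>]] by (intro eqv_K) auto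
    ultimately show ?thesis using True by (auto intro: eqv_trans)
  next
    case False
    then show ?thesis using assms by (auto intro!: eqv_K simp: good_def)
  qed
qed (use assms eqv_K[of Zero Ty0 a \<sigma>] eqv_K[of One Ty0 a \<sigma>] in
   \<open>auto intro!: eqv_K[OF obj_consts(3), simplified]
   eqv_K[OF obj_consts(4), simplified] eqv_K[OF obj_consts(5), simplified] eqv_K[OF obj_consts(6), simplified]
   eqv_K[OF obj_consts(7), simplified]\<close>)

lemma sat_semiring_axioms:
  assumes "good A" "\<phi> \<in> semiring_axioms" shows "sat E L A \<phi>"
proof (rule rca[OF assms(1)])
  have "\<forall>\<phi>\<in>semiring_axioms. wf_fm \<phi>" by (simp add: semiring_axioms_def Let_def)
  then show "wf_fm \<phi>" using assms(2) by blast
qed (use assms(2) in \<open>simp add: RCA0_omega_def\<close>)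

end

text \<open>The equality of the model is now the kernel of a valuation \<open>\<nu>\<close>, so that
  equations between objects of type 0 become genuine equations in \<open>'m\<close>. Objects of
  higher type remain terms, compared pointwise.\<close>

locale num_model = rca_model "\<lambda>s t. \<nu> s = \<nu> t" "\<lambda>s t. lt (\<nu> s) (\<nu> t)"
  for \<nu> :: "tm \<Rightarrow> 'm" and lt :: "'m \<Rightarrow> 'm \<Rightarrow> bool" +
  fixes pl ti :: "'m \<Rightarrow> 'm \<Rightarrow> 'm" and ze on :: 'm
  assumes surj: "\<exists>t\<in>obj Ty0. \<nu> t = a"
    and nu_Zero [simp]: "\<nu> Zero = ze" and nu_One [simp]: "\<nu> One = on"
    and nu_Plus [simp]: "s \<in> obj Ty0 \<Longrightarrow> t \<in> obj Ty0 \<Longrightarrow> \<nu> (s \<^bold>+ t) = pl (\<nu> s) (\<nu> t)"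
    and nu_Times [simp]: "s \<in> obj Ty0 \<Longrightarrow> t \<in> obj Ty0 \<Longrightarrow> \<nu> (s \<^bold>* t) = ti (\<nu> s) (\<nu> t)"
begin

abbreviation tr :: "asg \<Rightarrow> fm \<Rightarrow> bool" where
  "tr \<equiv> sat (\<lambda>s t. \<nu> s = \<nu> t) (\<lambda>s t. lt (\<nu> s) (\<nu> t))"

abbreviation eqm :: "ty \<Rightarrow> tm \<Rightarrow> tm \<Rightarrow> bool" where
  "eqm \<equiv> eqv (\<lambda>s t. \<nu> s = \<nu> t)"

definition rep :: "'m \<Rightarrow> tm" where "rep a = (SOME t. t \<in> obj Ty0 \<and> \<nu> t = a)"

lemma rep [simp]: "rep a \<in> obj Ty0" "\<nu> (rep a) = a"
  using surj[of a] someI[of "\<lambda>t. t \<in> obj Ty0 \<and> \<nu> t = a"] unfolding rep_def by blast+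

lemma nu_arg: "f \<in> obj (Ty0 \<Rrightarrow> \<tau>) \<Longrightarrow> s \<in> obj Ty0 \<Longrightarrow> t \<in> obj Ty0 \<Longrightarrow> \<nu> s = \<nu> t \<Longrightarrow>
    eqm \<tau> (f \<cdot> s) (f \<cdot> t)"
  using eqv_ext[of s Ty0 t f \<tau>] by simp

definition fn :: "tm \<Rightarrow> 'm \<Rightarrow> 'm" where "fn u a = \<nu> (u \<cdot> rep a)"

text \<open>The second-order part of the model. Passing from terms to functions identifies exactly
  the pointwise equal objects of type 1.\<close>

definition S :: "('m \<Rightarrow> 'm) set" where "S = fn ` obj Ty1"

lemma fn_nu [simp]: "u \<in> obj Ty1 \<Longrightarrow> t \<in> obj Ty0 \<Longrightarrow> fn u (\<nu> t) = \<nu> (u \<cdot> t)"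
  using nu_arg[of u Ty0 "rep (\<nu> t)" t] by (simp add: fn_def)

lemma fn_eqm: "u \<in> obj Ty1 \<Longrightarrow> v \<in> obj Ty1 \<Longrightarrow> fn u = fn v \<longleftrightarrow> eqm Ty1 u v"
proof
  assume "u \<in> obj Ty1" "v \<in> obj Ty1" "fn u = fn v"
  then show "eqm Ty1 u v" by (simp flip: fn_nu)
qed (simp add: fn_def fun_eq_iff)

lemma fn_in_S [simp, intro]: "u \<in> obj Ty1 \<Longrightarrow> fn u \<in> S"
  by (simp add: S_def)

lemma fn_abstr:
  assumes "good A" "wt t" "ty_of t = Ty0"
  shows "val A (abstr k Ty0 t) \<in> obj Ty1"
    and "s \<in> obj Ty0 \<Longrightarrow> \<nu> (val A (abstr k Ty0 t) \<cdot> s) = \<nu> (val (A((k, Ty0) := s)) t)"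
  using val_obj[OF assms(1), of "abstr k Ty0 t"] abstr_beta[of A t s Ty0 k] assms by auto

lemma S_I:
  assumes "wt t" "ty_of t = Ty0" "\<And>s. s \<in> obj Ty0 \<Longrightarrow> F (\<nu> s) = \<nu> (val (\<iota>((k, Ty0) := s)) t)"
  shows "F \<in> S"
proof -
  note b = fn_abstr[OF good_id assms(1,2), where k = k]
  have "fn (val \<iota> (abstr k Ty0 t)) = F"
  proof
    fix a
    show "fn (val \<iota> (abstr k Ty0 t)) a = F a"
      using b(2)[of "rep a"] assms(3)[of "rep a"] by (simp add: fn_def)
  qed
  then show ?thesis using b(1) by (metis fn_in_S)
qed

lemma S_const: "(\<lambda>_. c) \<in> S"
  by (rule S_I[of "rep c" _ "var_bound (rep c)"])
    (use rep[of c] in \<open>auto simp: obj_def val_var_bound_upd val_Var\<close>) 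

lemma S_id: "(\<lambda>a. a) \<in> S"
  by (rule S_I[of "Var 0 Ty0" _ 0]) auto

lemma S_comp:
  assumes "F \<in> S" "G \<in> S" shows "(\<lambda>a. F (G a)) \<in> S"
proof -
  obtain u v where uv: "u \<in> obj Ty1" "v \<in> obj Ty1" "F = fn u" "G = fn v" 
    using assms by (auto simp: S_def)
  define k where "k = max (var_bound u) (var_bound v)"
  show ?thesis
    by (rule S_I[of "u \<cdot> (v \<cdot> Var k Ty0)" _ k])
      (use uv in \<open>auto simp: obj_def k_def val_var_bound_upd val_Var fn_nu[unfolded obj_def]\<close>)
qed

lemma S_binary:
  assumes "c \<in> obj (Ty0 \<Rrightarrow> Ty0 \<Rrightarrow> Ty0)" "F \<in> S" "G \<in> S"
  shows "(\<lambda>a. \<nu> (c \<cdot> rep (F a) \<cdot> rep (G a))) \<in> S"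
proof -
  obtain u v where uv: "u \<in> obj Ty1" "v \<in> obj Ty1" "F = fn u" "G = fn v" 
    using assms by (auto simp: S_def)
  define k where "k = max (var_bound c) (max (var_bound u) (var_bound v))"
  show ?thesis
  proof (rule S_I[of "c \<cdot> (u \<cdot> Var k Ty0) \<cdot> (v \<cdot> Var k Ty0)" _ k])
    fix s assume s: "s \<in> obj Ty0"
    have "eqm Ty1 (c \<cdot> rep (F (\<nu> s))) (c \<cdot> (u \<cdot> s))"
      using assms uv s by (intro nu_arg) auto
    then have "\<nu> (c \<cdot> rep (F (\<nu> s)) \<cdot> rep (G (\<nu> s))) = \<nu> (c \<cdot> (u \<cdot> s) \<cdot> rep (G (\<nu> s)))" by simp
    also have "\<dots> = \<nu> (c \<cdot> (u \<cdot> s) \<cdot> (v \<cdot> s))"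
      using nu_arg[of "c \<cdot> (u \<cdot> s)" Ty0 "rep (G (\<nu> s))" "v \<cdot> s"] assms uv s by auto
    finally show "\<nu> (c \<cdot> rep (F (\<nu> s)) \<cdot> rep (G (\<nu> s))) =
        \<nu> (val (\<iota>((k, Ty0) := s)) (c \<cdot> (u \<cdot> Var k Ty0) \<cdot> (v \<cdot> Var k Ty0)))"
      by (simp add: k_def val_var_bound_upd val_Var)
  qed (use uv assms in \<open>auto simp: obj_def\<close>)
qed

lemma S_pl: "F \<in> S \<Longrightarrow> G \<in> S \<Longrightarrow> (\<lambda>a. pl (F a) (G a)) \<in> S"
  using S_binary[of Plus F G] by simp

lemma S_ti: "F \<in> S \<Longrightarrow> G \<in> S \<Longrightarrow> (\<lambda>a. ti (F a) (G a)) \<in> S"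
  using S_binary[of Times F G] by simp

text \<open>The formula is demanded for all large variable indices \<open>k\<close>: then the
  formulas of two predicates can share their free variable, and that variable avoids the parameters
  of both. \<open>qf_imp\<close> depends on this.\<close>

definition qf :: "('m \<Rightarrow> bool) \<Rightarrow> bool" where
  "qf P \<longleftrightarrow> (\<exists>K. \<forall>k\<ge>K. \<exists>\<phi>. qfree \<phi> \<and> wf_fm \<phi> \<and>
    (\<forall>s\<in>obj Ty0. tr (\<iota>((k, Ty0) := s)) \<phi> \<longleftrightarrow> P (\<nu> s)))"

lemma qf_atom:
  assumes "F \<in> S" "G \<in> S" "\<And>s t. s \<in> obj Ty0 \<Longrightarrow> t \<in> obj Ty0 \<Longrightarrow> wf_fm (R s t)"
    and "\<And>s t. qfree (R s t)" "\<And>A s t. tr A (R s t) \<longleftrightarrow> r (\<nu> (val A s)) (\<nu> (val A t))"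
  shows "qf (\<lambda>a. r (F a) (G a))"
proof -
  obtain u v where uv: "u \<in> obj Ty1" "v \<in> obj Ty1" "F = fn u" "G = fn v"
    using assms(1,2) by (auto simp: S_def)
  show ?thesis unfolding qf_def
  proof (intro exI[of _ "max (var_bound u) (var_bound v)"] allI impI)
    fix k assume "k \<ge> max (var_bound u) (var_bound v)"
    then show "\<exists>\<phi>. qfree \<phi> \<and> wf_fm \<phi> \<and> (\<forall>s\<in>obj Ty0. tr (\<iota>((k, Ty0) := s)) \<phi> \<longleftrightarrow> r (F (\<nu> s)) (G (\<nu> s)))"
      using uv assms(3-5) by (intro exI[of _ "R (u \<cdot> Var k Ty0) (v \<cdot> Var k Ty0)"])
        (auto simp: val_var_bound_upd val_Var)
  qed
qed

lemma qf_eq: "F \<in> S \<Longrightarrow> G \<in> S \<Longrightarrow> qf (\<lambda>a. F a = G a)"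
  by (rule qf_atom[of F G Eq "(=)"]) (auto simp: obj_def)

lemma qf_lt: "F \<in> S \<Longrightarrow> G \<in> S \<Longrightarrow> qf (\<lambda>a. lt (F a) (G a))"
  by (rule qf_atom[of F G Less lt]) (auto simp: obj_def)

lemma qf_imp: assumes "qf P" "qf Q" shows "qf (\<lambda>a. P a \<longrightarrow> Q a)"
proof -
  obtain K where K: "\<forall>k\<ge>K. \<exists>\<phi>. qfree \<phi> \<and> wf_fm \<phi> \<and> (\<forall>s\<in>obj Ty0. tr (\<iota>((k, Ty0) := s)) \<phi> \<longleftrightarrow> P (\<nu> s))"
    using assms(1) unfolding qf_def by blast
  obtain K' where K': "\<forall>k\<ge>K'. \<exists>\<phi>. qfree \<phi> \<and> wf_fm \<phi> \<and> (\<forall>s\<in>obj Ty0. tr (\<iota>((k, Ty0) := s)) \<phi> \<longleftrightarrow> Q (\<nu> s))"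
    using assms(2) unfolding qf_def by blast
  show ?thesis unfolding qf_def
  proof (intro exI[of _ "max K K'"] allI impI)
    fix k assume k: "k \<ge> max K K'"
    obtain \<phi> where \<phi>: "qfree \<phi>" "wf_fm \<phi>" "\<forall>s\<in>obj Ty0. tr (\<iota>((k, Ty0) := s)) \<phi> \<longleftrightarrow> P (\<nu> s)"
      using K k by (meson max.boundedE)
    obtain \<psi> where \<psi>: "qfree \<psi>" "wf_fm \<psi>" "\<forall>s\<in>obj Ty0. tr (\<iota>((k, Ty0) := s)) \<psi> \<longleftrightarrow> Q (\<nu> s)"
      using K' k by (meson max.boundedE)
    show "\<exists>\<phi>. qfree \<phi> \<and> wf_fm \<phi> \<and> (\<forall>s\<in>obj Ty0. tr (\<iota>((k, Ty0) := s)) \<phi> \<longleftrightarrow> (P (\<nu> s) \<longrightarrow> Q (\<nu> s)))"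
      using \<phi> \<psi> by (intro exI[of _ "\<phi> \<^bold>\<longrightarrow> \<psi>"]) auto
  qed
qed

lemma qf_False: "qf (\<lambda>_. False)"
  unfolding qf_def by (intro exI[of _ 0] allI impI exI[of _ Falsum]) auto

lemma qf_not: "qf P \<Longrightarrow> qf (\<lambda>a. \<not> P a)"
  using qf_imp[OF _ qf_False] by simp

lemma qf_conj: "qf P \<Longrightarrow> qf Q \<Longrightarrow> qf (\<lambda>a. P a \<and> Q a)"
  using qf_not[OF qf_imp[OF _ qf_not, of P Q]] by simp

lemma qf_disj: "qf P \<Longrightarrow> qf Q \<Longrightarrow> qf (\<lambda>a. P a \<or> Q a)"
  using qf_imp[OF qf_not, of P Q] by (simp add: imp_conv_disj)

lemma qf_induct:
  assumes "qf P" "P ze" "\<And>a. P a \<Longrightarrow> P (pl a on)" shows "P a"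
proof -
  obtain k \<phi> where \<phi>: "qfree \<phi>" "wf_fm \<phi>"
    and P: "\<And>s. s \<in> obj Ty0 \<Longrightarrow> tr (\<iota>((k, Ty0) := s)) \<phi> \<longleftrightarrow> P (\<nu> s)"
    using assms(1) unfolding qf_def by blast
  let ?\<psi> = "subst_fm \<phi> k Ty0 Zero \<^bold>\<longrightarrow>
      Forall k Ty0 (\<phi> \<^bold>\<longrightarrow> subst_fm \<phi> k Ty0 (Var k Ty0 \<^bold>+ One)) \<^bold>\<longrightarrow> Forall k Ty0 \<phi>"
  have "tr \<iota> ?\<psi>"
    using \<phi> by (intro rca) (auto simp: RCA0_omega_def qf_induction_axioms_def intro!: wf_subst_fm)
  moreover have "tr \<iota> (subst_fm \<phi> k Ty0 Zero)"
    using P[of Zero] assms(2) \<phi> by (simp add: sat_subst_qfree)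
  moreover have "tr (\<iota>((k, Ty0) := s)) (subst_fm \<phi> k Ty0 (Var k Ty0 \<^bold>+ One))"
    if "s \<in> obj Ty0" "tr (\<iota>((k, Ty0) := s)) \<phi>" for s
    using that P[of s] P[of "s \<^bold>+ One"] assms(3)[of "\<nu> s"] \<phi> by (simp add: sat_subst_qfree)
  ultimately have "\<forall>s\<in>obj Ty0. tr (\<iota>((k, Ty0) := s)) \<phi>" by simp
  then show ?thesis using P[of "rep a"] by simp
qed

lemma tr_semiring_axioms:
  "\<forall>\<phi>\<in>semiring_axioms. tr (\<iota>((0, Ty0) := rep a, (1, Ty0) := rep b, (2, Ty0) := rep c)) \<phi>"
  by (intro ballI sat_semiring_axioms) auto

lemma semiring_laws:
  "pl (pl a b) c = pl a (pl b c)" "pl a b = pl b a" "pl a ze = a"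
  "ti (ti a b) c = ti a (ti b c)" "ti a b = ti b a" "ti a on = a" "ti a ze = ze"
  "ti a (pl b c) = pl (ti a b) (ti a c)" "\<not> lt a a" "lt a b \<Longrightarrow> lt b c \<Longrightarrow> lt a c"
  "lt a b \<or> a = b \<or> lt b a" "lt a b \<Longrightarrow> lt (pl a c) (pl b c)"
  "lt a b \<Longrightarrow> lt ze c \<Longrightarrow> lt (ti a c) (ti b c)" "lt ze on"
  using tr_semiring_axioms[of a b c, unfolded semiring_axioms_def Let_def, simplified] by blast+

end

section \<open>Typing and evaluation of the recursive terms\<close>

lemma fresh_simps [simp]: "fresh [] = 0" "fresh [Var k \<sigma>] = Suc k"
  by (simp_all add: fresh_def)

lemma vars_lam [simp]: "vars (lam \<sigma> ts F) = vars (F (Var (fresh ts) \<sigma>)) - {(fresh ts, \<sigma>)}"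
  by (simp add: lam_def)

lemma obj_lam [simp]: "F (Var (fresh ts) \<sigma>) \<in> obj \<tau> \<Longrightarrow> lam \<sigma> ts F \<in> obj (\<sigma> \<Rrightarrow> \<tau>)"
  by (auto simp: lam_def obj_def)

lemma vars_prim_rec [simp]:
  "vars (prim_rec step b) = vars (step (Var 0 Ty0) (Var 1 Ty0)) - {(0, Ty0), (1, Ty0)} \<union> vars b"
  by (auto simp: prim_rec_def)

lemma obj_prim_rec [simp]: "step (Var 0 Ty0) (Var 1 Ty0) \<in> obj Ty0 \<Longrightarrow> b \<in> obj Ty0 \<Longrightarrow>
    prim_rec step b \<in> obj Ty1"
  unfolding prim_rec_def by (intro obj_App[of _ Ty0] obj_App[of Rec "Ty0 \<Rrightarrow> Ty0 \<Rrightarrow> Ty0"] obj_lam) auto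

lemma obj_pred_tm [simp]: "t \<in> obj Ty0 \<Longrightarrow> pred_tm t \<in> obj Ty0"
  unfolding pred_tm_def by (rule obj_App[of _ Ty0]) auto

lemma val_pred_tm [simp]: "val A (pred_tm t) = pred_tm (val A t)"
  by (simp add: pred_tm_def val_closed)

lemma vars_pred_tm [simp]: "vars (pred_tm t) = vars t"
  by (simp add: pred_tm_def)

text \<open>\<open>monus\<close> is an operation on terms outside the model. Congruence and
  \<open>S_binary\<close> speak about a single object that takes two arguments, so the constant is
  isolated here.\<close>

definition monus_tm :: tm where
  "monus_tm = Rec \<cdot> lam Ty0 [] (\<lambda>n. lam Ty0 [n] (\<lambda>m. pred_tm m))"

lemma monus_alt: "s \<^bold>- t = monus_tm \<cdot> s \<cdot> t"
  by (simp add: monus_def prim_rec_def monus_tm_def)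

lemma obj_monus_tm: "monus_tm \<in> obj (Ty0 \<Rrightarrow> Ty0 \<Rrightarrow> Ty0)"
  unfolding monus_tm_def by (intro obj_App[of Rec "Ty0 \<Rrightarrow> Ty0 \<Rrightarrow> Ty0"] obj_lam) auto

lemma obj_monus [simp]: "s \<in> obj Ty0 \<Longrightarrow> t \<in> obj Ty0 \<Longrightarrow> s \<^bold>- t \<in> obj Ty0"
  unfolding monus_alt using obj_monus_tm by blast

lemma vars_monus [simp]: "vars (s \<^bold>- t) = vars s \<union> vars t"
  by (simp add: monus_def)

lemma val_monus [simp]: "val A (s \<^bold>- t) = val A s \<^bold>- val A t"
proof -
  have "vars monus_tm = {}" by (simp add: monus_tm_def)
  then show ?thesis by (simp add: monus_alt val_closed)
qed

lemma obj_pow2 [simp]: "t \<in> obj Ty0 \<Longrightarrow> pow2 t \<in> obj Ty0"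
  unfolding pow2_def by (rule obj_App[of _ Ty0]) auto

lemma val_pow2 [simp]: "val A (pow2 t) = pow2 (val A t)"
  by (simp add: pow2_def val_closed)

lemma obj_tri [simp]: "t \<in> obj Ty0 \<Longrightarrow> tri t \<in> obj Ty0"
  unfolding tri_def by (rule obj_App[of _ Ty0]) auto

lemma vars_tri [simp]: "vars (tri t) = vars t"
  by (simp add: tri_def)

lemma val_tri [simp]: "val A (tri t) = tri (val A t)"
  by (simp add: tri_def val_closed)

lemma obj_diag [simp]: "t \<in> obj Ty0 \<Longrightarrow> diag t \<in> obj Ty0"
  unfolding diag_def by (rule obj_App[of _ Ty0]) auto

lemma val_diag [simp]: "val A (diag t) = diag (val A t)"
  by (simp add: diag_def val_closed)

section \<open>The numbers of a model as natural numbers with unusual operations\<close>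

context rca_model
begin

lemma model_semiring:
  assumes "x \<in> obj Ty0" "y \<in> obj Ty0" "z \<in> obj Ty0"
  shows "E (x \<^bold>+ y) (y \<^bold>+ x)" "E (x \<^bold>+ Zero) x" "\<not> L x x" "L x y \<Longrightarrow> L y z \<Longrightarrow> L x z"
    "L x y \<Longrightarrow> L (x \<^bold>+ z) (y \<^bold>+ z)" "L Zero One"
proof -
  have "\<forall>\<phi>\<in>semiring_axioms. sat E L (\<iota>((0, Ty0) := x, (1, Ty0) := y, (2, Ty0) := z)) \<phi>"
    using assms by (intro ballI sat_semiring_axioms) auto
  note * = this[unfolded semiring_axioms_def Let_def, simplified]
  then show "E (x \<^bold>+ y) (y \<^bold>+ x)" "E (x \<^bold>+ Zero) x" "\<not> L x x" "L x y \<Longrightarrow> L y z \<Longrightarrow> L x z"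
    "L x y \<Longrightarrow> L (x \<^bold>+ z) (y \<^bold>+ z)" "L Zero One"
    by blast+
qed

lemma model_less_Suc: assumes x: "x \<in> obj Ty0" shows "L x (x \<^bold>+ One)"
proof -
  have "L (Zero \<^bold>+ x) (One \<^bold>+ x)" using x model_semiring(5,6)[of Zero One x] by auto
  moreover have "E (Zero \<^bold>+ x) x" using x model_semiring(1)[of Zero x] model_semiring(2)[of x] E_trans by blast
  moreover have "E (One \<^bold>+ x) (x \<^bold>+ One)" using x model_semiring(1) by blast
  ultimately show ?thesis using L_cong by blast
qed

lemma E_cong_App2:
  assumes "c \<in> obj (Ty0 \<Rrightarrow> Ty0 \<Rrightarrow> Ty0)" "s \<in> obj Ty0" "t \<in> obj Ty0" "s' \<in> obj Ty0" "t' \<in> obj Ty0"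
    "E s s'" "E t t'"
  shows "E (c \<cdot> s \<cdot> t) (c \<cdot> s' \<cdot> t')"
proof -
  have "eqv E Ty1 (c \<cdot> s) (c \<cdot> s')" using assms by (intro eqv_ext[of _ Ty0]) auto
  then show ?thesis using eqv_App[of "c \<cdot> s" Ty0 Ty0 "c \<cdot> s'" t t'] assms by auto
qed

text \<open>There are only countably many terms, and the numerals fall into infinitely many classes
  because they increase strictly in the order of the model. So the classes can be counted by
  \<open>nat\<close>, a carrier that does not depend on the model.\<close>

lemma ex_numbering: "\<exists>\<nu> :: tm \<Rightarrow> nat.
    (\<forall>s\<in>obj Ty0. \<forall>t\<in>obj Ty0. E s t \<longleftrightarrow> \<nu> s = \<nu> t) \<and> (\<forall>n. \<exists>t\<in>obj Ty0. \<nu> t = n)"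
proof -
  define cls where "cls t = {s \<in> obj Ty0. E s t}" for t
  have cls: "cls s = cls t \<longleftrightarrow> E s t" if "s \<in> obj Ty0" "t \<in> obj Ty0" for s t
    unfolding cls_def using that E_refl E_sym E_trans by blast
  define num where "num n = ((\<lambda>t. t \<^bold>+ One) ^^ n) Zero" for n
  have num: "num n \<in> obj Ty0" for n by (induction n) (auto simp: num_def)
  have less: "m < n \<Longrightarrow> L (num m) (num n)" for m n
  proof (induction n)
    case (Suc n)
    have "L (num n) (num (Suc n))" using model_less_Suc[OF num[of n]] by (simp add: num_def)
    then show ?case using Suc model_semiring(4)[OF num num num, of m n "Suc n"] by (cases "m = n") auto
  qed simp
  have "inj (\<lambda>n. cls (num n))"
  proof (rule injI, rule ccontr)
    fix m n assume "cls (num m) = cls (num n)" "m \<noteq> n"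
    then have "E (num m) (num n)" "L (num m) (num n) \<or> L (num n) (num m)"
      using cls num less by (metis, metis linorder_neqE_nat)
    then have "L (num n) (num n)" using L_cong E_sym E_refl num by blast
    then show False using model_semiring(3) num by blast
  qed
  then have "infinite (range (\<lambda>n. cls (num n)))" by (simp add: finite_image_iff)
  moreover have "range (\<lambda>n. cls (num n)) \<subseteq> cls ` obj Ty0" using num by auto
  ultimately have inf: "infinite (cls ` obj Ty0)" using finite_subset by blast
  have "countable (cls ` obj Ty0)" by (intro countable_image countableI_type)
  with inf have bij: "bij_betw (to_nat_on (cls ` obj Ty0)) (cls ` obj Ty0) UNIV"
    by (intro to_nat_on_infinite)
  show ?thesis
  proof (intro exI[of _ "\<lambda>t. to_nat_on (cls ` obj Ty0) (cls t)"] conjI ballI allI)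
    fix s t assume "s \<in> obj Ty0" "t \<in> obj Ty0"
    then show "E s t \<longleftrightarrow> to_nat_on (cls ` obj Ty0) (cls s) = to_nat_on (cls ` obj Ty0) (cls t)"
      using cls bij by (simp add: bij_betw_def inj_on_eq_iff)
  next
    fix n
    have "n \<in> to_nat_on (cls ` obj Ty0) ` (cls ` obj Ty0)" using bij by (simp add: bij_betw_def)
    then show "\<exists>t\<in>obj Ty0. to_nat_on (cls ` obj Ty0) (cls t) = n" by auto
  qed
qed

end

lemma sat_obj_cong:
  assumes "\<And>s t. s \<in> obj Ty0 \<Longrightarrow> t \<in> obj Ty0 \<Longrightarrow> E s t = E' s t"
    "\<And>s t. s \<in> obj Ty0 \<Longrightarrow> t \<in> obj Ty0 \<Longrightarrow> L s t = L' s t"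
  shows "good A \<Longrightarrow> wf_fm \<phi> \<Longrightarrow> sat E L A \<phi> = sat E' L' A \<phi>"
proof (induction \<phi> arbitrary: A)
  case (Eq s t)
  then show ?case using val_obj[of A s] val_obj[of A t] assms by simp
next
  case (Less s t)
  then show ?case using val_obj[of A s] val_obj[of A t] assms by simp
next
  case (Forall k \<sigma> \<phi>)
  then show ?case by (metis good_upd sat.simps(5) wf_fm.simps(5))
qed auto

lemma rca_model_numbering:
  assumes "rca_model E L"
  shows "\<exists>(\<nu> :: tm \<Rightarrow> nat) lt pl ti ze on. num_model \<nu> lt pl ti ze on \<and>
    (\<forall>s\<in>obj Ty0. \<forall>t\<in>obj Ty0. (E s t \<longleftrightarrow> \<nu> s = \<nu> t) \<and> (L s t \<longleftrightarrow> lt (\<nu> s) (\<nu> t)))"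
proof -
  interpret rca_model E L by fact
  obtain \<nu> :: "tm \<Rightarrow> nat" where E: "\<And>s t. s \<in> obj Ty0 \<Longrightarrow> t \<in> obj Ty0 \<Longrightarrow> E s t \<longleftrightarrow> \<nu> s = \<nu> t"
    and surj: "\<And>n. \<exists>t\<in>obj Ty0. \<nu> t = n" using ex_numbering by blast
  define r where "r n = (SOME t. t \<in> obj Ty0 \<and> \<nu> t = n)" for n
  have r: "r n \<in> obj Ty0" "\<nu> (r n) = n" for n
    using surj[of n] someI[of "\<lambda>t. t \<in> obj Ty0 \<and> \<nu> t = n"] unfolding r_def by blast+
  define lt where "lt m n = L (r m) (r n)" for m n
  have Er: "E (r (\<nu> s)) s" "E s (r (\<nu> s))" if "s \<in> obj Ty0" for s using E r that by auto
  have L: "L s t \<longleftrightarrow> lt (\<nu> s) (\<nu> t)" if "s \<in> obj Ty0" "t \<in> obj Ty0" for s t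
    unfolding lt_def using L_cong Er that by metis
  have sat: "sat (\<lambda>s t. \<nu> s = \<nu> t) (\<lambda>s t. lt (\<nu> s) (\<nu> t)) A \<phi> = sat E L A \<phi>" 
    if "good A" "wf_fm \<phi>" for A \<phi>
    using that E L by (intro sat_obj_cong) auto
  have two: "\<nu> (c \<cdot> s \<cdot> t) = \<nu> (c \<cdot> r (\<nu> s) \<cdot> r (\<nu> t))" 
    if "c \<in> obj (Ty0 \<Rrightarrow> Ty0 \<Rrightarrow> Ty0)" "s \<in> obj Ty0" "t \<in> obj Ty0" for c s t
  proof -
    have "c \<cdot> s \<cdot> t \<in> obj Ty0" "c \<cdot> r (\<nu> s) \<cdot> r (\<nu> t) \<in> obj Ty0"
      using that r by (auto intro!: obj_App[of _ Ty0])
    moreover have "E (c \<cdot> s \<cdot> t) (c \<cdot> r (\<nu> s) \<cdot> r (\<nu> t))"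
      using that Er r by (intro E_cong_App2) auto
    ultimately show ?thesis using E by blast
  qed
  have "num_model \<nu> lt (\<lambda>m n. \<nu> (r m \<^bold>+ r n)) (\<lambda>m n. \<nu> (r m \<^bold>* r n)) (\<nu> Zero) (\<nu> One)"
  proof unfold_locales
    fix A \<phi> assume "good A" "\<phi> \<in> RCA0_omega" "wf_fm \<phi>"
    then show "sat (\<lambda>s t. \<nu> s = \<nu> t) (\<lambda>s t. lt (\<nu> s) (\<nu> t)) A \<phi>"
      using sat rca by simp
  qed (use surj two[of Plus] two[of Times] in auto)
  then show ?thesis using E L by blast
qed

text \<open>The algebraic part of a model, stated without terms so that the standard operations on
  \<open>nat\<close> can satisfy it as well. Nonnegativity and differences are included because the
  class instances below require them.\<close>

definition ops_ok :: "('m \<Rightarrow> 'm \<Rightarrow> bool) \<Rightarrow> ('m \<Rightarrow> 'm \<Rightarrow> 'm) \<Rightarrow> ('m \<Rightarrow> 'm \<Rightarrow> 'm) \<Rightarrow> 'm \<Rightarrow> 'm \<Rightarrow> bool" where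
  "ops_ok lt pl ti ze on \<longleftrightarrow> (\<forall>a b c.
    pl (pl a b) c = pl a (pl b c) \<and> pl a b = pl b a \<and> pl a ze = a \<and>
    ti (ti a b) c = ti a (ti b c) \<and> ti a b = ti b a \<and> ti a on = a \<and> ti a ze = ze \<and>
    ti a (pl b c) = pl (ti a b) (ti a c) \<and> \<not> lt a a \<and> (lt a b \<longrightarrow> lt b c \<longrightarrow> lt a c) \<and>
    (lt a b \<or> a = b \<or> lt b a) \<and> (lt a b \<longrightarrow> lt (pl a c) (pl b c)) \<and>
    (lt a b \<longrightarrow> lt ze c \<longrightarrow> lt (ti a c) (ti b c)) \<and> lt ze on \<and>
    \<not> lt a ze \<and> (\<not> lt a b \<longrightarrow> (\<exists>d. pl d b = a)))"

section \<open>Predecessor, truncated subtraction and their consequences for the order\<close>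

context num_model
begin

lemma nu_arg2: "c \<in> obj (Ty0 \<Rrightarrow> Ty0 \<Rrightarrow> Ty0) \<Longrightarrow> s \<in> obj Ty0 \<Longrightarrow> t \<in> obj Ty0 \<Longrightarrow>
    s' \<in> obj Ty0 \<Longrightarrow> t' \<in> obj Ty0 \<Longrightarrow> \<nu> s = \<nu> s' \<Longrightarrow> \<nu> t = \<nu> t' \<Longrightarrow> \<nu> (c \<cdot> s \<cdot> t) = \<nu> (c \<cdot> s' \<cdot> t')"
  by (rule E_cong_App2)

lemma nu_Rec:
  assumes "f \<in> obj (Ty0 \<Rrightarrow> Ty0 \<Rrightarrow> Ty0)" "m \<in> obj Ty0" "n \<in> obj Ty0"
  shows "\<nu> (Rec \<cdot> f \<cdot> m \<cdot> Zero) = \<nu> m"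
    "\<nu> (Rec \<cdot> f \<cdot> m \<cdot> (n \<^bold>+ One)) = \<nu> (f \<cdot> n \<cdot> (Rec \<cdot> f \<cdot> m \<cdot> n))"
proof -
  let ?A = "\<iota>((0, Ty0 \<Rrightarrow> Ty0 \<Rrightarrow> Ty0) := f, (1, Ty0) := m, (2, Ty0) := n)"
  have "\<forall>\<phi>\<in>recursor_axioms. wf_fm \<phi>" by (simp add: recursor_axioms_def Let_def)
  then have "\<forall>\<phi>\<in>recursor_axioms. tr ?A \<phi>"
    using assms by (auto intro!: rca simp: RCA0_omega_def)
  then show "\<nu> (Rec \<cdot> f \<cdot> m \<cdot> Zero) = \<nu> m"
    "\<nu> (Rec \<cdot> f \<cdot> m \<cdot> (n \<^bold>+ One)) = \<nu> (f \<cdot> n \<cdot> (Rec \<cdot> f \<cdot> m \<cdot> n))"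
    unfolding recursor_axioms_def Let_def by simp_all
qed

lemma nu_abstr2:
  assumes "good A" "t \<in> obj Ty0" "a \<in> obj Ty0" "b \<in> obj Ty0"
  shows "\<nu> (val A (abstr k Ty0 (abstr l Ty0 t)) \<cdot> a \<cdot> b) = \<nu> (val (A((k, Ty0) := a, (l, Ty0) := b)) t)"
proof -
  have t: "wt t" "ty_of t = Ty0" using assms by (auto simp: obj_def)
  have "eqm Ty1 (val A (abstr k Ty0 (abstr l Ty0 t)) \<cdot> a) (val (A((k, Ty0) := a)) (abstr l Ty0 t))"
    using abstr_beta[OF assms(1) wt_abstr[OF t(1)] assms(3), where k = k] t by (simp only: ty_of_abstr)
  then have "\<nu> (val A (abstr k Ty0 (abstr l Ty0 t)) \<cdot> a \<cdot> b) = \<nu> (val (A((k, Ty0) := a)) (abstr l Ty0 t) \<cdot> b)"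
    using assms(4) by simp
  also have "\<dots> = \<nu> (val (A((k, Ty0) := a, (l, Ty0) := b)) t)"
    using assms t by (intro fn_abstr(2)) auto
  finally show ?thesis .
qed

lemma nu_prim_rec:
  assumes s: "step (Var 0 Ty0) (Var 1 Ty0) \<in> obj Ty0" and b: "b \<in> obj Ty0" and a: "a \<in> obj Ty0"
  shows "\<nu> (prim_rec step b \<cdot> Zero) = \<nu> b"
    and "\<nu> (prim_rec step b \<cdot> (a \<^bold>+ One)) =
      \<nu> (val (\<iota>((0, Ty0) := a, (1, Ty0) := prim_rec step b \<cdot> a)) (step (Var 0 Ty0) (Var 1 Ty0)))"
proof -
  let ?f = "lam Ty0 [] (\<lambda>n. lam Ty0 [n] (\<lambda>m. step n m))"
  have f: "?f = val \<iota> (abstr 0 Ty0 (abstr 1 Ty0 (step (Var 0 Ty0) (Var 1 Ty0))))"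
    by (simp add: lam_def val_Var)
  have o: "?f \<in> obj (Ty0 \<Rrightarrow> Ty0 \<Rrightarrow> Ty0)" using s by simp
  have r: "prim_rec step b \<cdot> a \<in> obj Ty0"
    using obj_App[OF obj_prim_rec[of step b]] s b a by simp
  show "\<nu> (prim_rec step b \<cdot> Zero) = \<nu> b"
    unfolding prim_rec_def using o b a by (rule nu_Rec)
  have "\<nu> (prim_rec step b \<cdot> (a \<^bold>+ One)) = \<nu> (?f \<cdot> a \<cdot> (prim_rec step b \<cdot> a))"
    using nu_Rec(2)[OF o b a] by (simp add: prim_rec_def)
  also have "\<dots> = \<nu> (val (\<iota>((0, Ty0) := a, (1, Ty0) := prim_rec step b \<cdot> a)) (step (Var 0 Ty0) (Var 1 Ty0)))"
    unfolding f by (rule nu_abstr2) (use s a r in auto)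
  finally show "\<nu> (prim_rec step b \<cdot> (a \<^bold>+ One)) =
      \<nu> (val (\<iota>((0, Ty0) := a, (1, Ty0) := prim_rec step b \<cdot> a)) (step (Var 0 Ty0) (Var 1 Ty0)))" .
qed

definition pd where "pd = fn (prim_rec (\<lambda>n m. n) Zero)"
definition mn where "mn a b = \<nu> (monus_tm \<cdot> rep a \<cdot> rep b)"

lemma nu_pred_tm [simp]: "t \<in> obj Ty0 \<Longrightarrow> \<nu> (pred_tm t) = pd (\<nu> t)"
  unfolding pd_def pred_tm_def by (rule fn_nu[symmetric]) auto

lemma pd_simps: "pd ze = ze" "pd (pl a on) = a"
  using nu_prim_rec[of "\<lambda>n m. n" Zero "rep a"] nu_pred_tm[of Zero] nu_pred_tm[of "rep a \<^bold>+ One"]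
  by (simp_all add: pred_tm_def)

lemma nu_monus [simp]: "s \<in> obj Ty0 \<Longrightarrow> t \<in> obj Ty0 \<Longrightarrow> \<nu> (s \<^bold>- t) = mn (\<nu> s) (\<nu> t)"
  unfolding mn_def monus_alt by (rule nu_arg2) (auto simp: obj_monus_tm)

lemma mn_simps: "mn a ze = a" "mn a (pl b on) = pd (mn a b)"
proof -
  note r = nu_prim_rec[of "\<lambda>n m. pred_tm m" "rep a" "rep b", folded monus_def]
  show "mn a ze = a" using r(1) nu_monus[of "rep a" Zero] by simp
  have "rep a \<^bold>- rep b \<in> obj Ty0" by simp
  then show "mn a (pl b on) = pd (mn a b)"
    using r(2) nu_monus[of "rep a" "rep b \<^bold>+ One"] by (simp del: nu_monus add: nu_monus[of "rep a" "rep b"])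
qed

lemma S_pd: "pd \<in> S"
  unfolding pd_def by (rule fn_in_S) simp

lemma S_mn: "F \<in> S \<Longrightarrow> G \<in> S \<Longrightarrow> (\<lambda>a. mn (F a) (G a)) \<in> S"
  unfolding mn_def by (rule S_binary[OF obj_monus_tm])

text \<open>Quantifier-free induction gives both facts. If \<open>a + 1\<close> were negative, so
  would be the smaller \<open>a\<close>. For differences the induction is on \<open>b\<close>: if
  \<open>a\<close> is not below \<open>b + 1\<close>, then \<open>mn a b\<close> is nonzero, hence a
  successor, and lowering it by one compensates for raising \<open>b\<close> by one.\<close>

lemma nonneg_and_difference:
  shows "\<not> lt a ze" and "\<not> lt a b \<Longrightarrow> pl (mn a b) b = a"
proof -
  note irrefl = semiring_laws(9) and trans = semiring_laws(10) and mono = semiring_laws(12)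
  have less_Suc: "lt a (pl a on)" for a
    using mono[OF semiring_laws(14), of a] by (metis semiring_laws(2,3))
  have nonneg: "\<not> lt a ze" for a
  proof (induction a rule: qf_induct)
    case 1 show ?case by (intro qf_not qf_lt S_id S_const)
  next
    case (3 a) then show ?case using less_Suc trans by blast
  qed (simp add: irrefl)
  have pd: "a = ze \<or> pl (pd a) on = a" for a
  proof (induction a rule: qf_induct)
    case 1 show ?case by (intro qf_disj qf_eq S_pl S_pd S_id S_const)
  qed (auto simp: pd_simps)
  have mn: "\<not> lt a b \<longrightarrow> pl (mn a b) b = a" for a b
  proof (induction b rule: qf_induct)
    case 1 show ?case by (intro qf_imp qf_not qf_lt qf_eq S_pl S_mn S_id S_const)
  next
    case (3 b)
    show ?case
    proof
      assume n: "\<not> lt a (pl b on)"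
      then have ab: "pl (mn a b) b = a" using 3 less_Suc trans by blast
      have "mn a b \<noteq> ze"
      proof
        assume "mn a b = ze"
        then have "a = b" using ab semiring_laws(2,3) by metis
        then show False using n less_Suc by blast
      qed
      then have "pl (pd (mn a b)) on = mn a b" using pd by blast
      then show "pl (mn a (pl b on)) (pl b on) = a"
        using ab unfolding mn_simps by (metis semiring_laws(1,2))
    qed
  qed (auto simp: mn_simps semiring_laws(3))
  show "\<not> lt a ze" "\<not> lt a b \<Longrightarrow> pl (mn a b) b = a" using nonneg mn by blast+
qed

lemma ops_ok: "ops_ok lt pl ti ze on"
  unfolding ops_ok_def
  by (intro allI conjI impI; (rule semiring_laws(1-9,11,14) nonneg_and_difference(1))?)
    (use nonneg_and_difference(2) in \<open>auto intro: semiring_laws(10,12,13)\<close>)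

end

section \<open>A countermodel whose numbers form a type\<close>

lemma obj_codes [simp]:
  "s \<in> obj Ty0 \<Longrightarrow> t \<in> obj Ty0 \<Longrightarrow> pair_tm s t \<in> obj Ty0"
  "s \<in> obj Ty0 \<Longrightarrow> fst_tm s \<in> obj Ty0" "s \<in> obj Ty0 \<Longrightarrow> snd_tm s \<in> obj Ty0"
  "s \<in> obj Ty0 \<Longrightarrow> pos_part s \<in> obj Ty0" "s \<in> obj Ty0 \<Longrightarrow> neg_part s \<in> obj Ty0"
  "s \<in> obj Ty0 \<Longrightarrow> denom s \<in> obj Ty0"
  by (simp_all add: pair_tm_def fst_tm_def snd_tm_def pos_part_def neg_part_def denom_def)

lemma obj_rat [simp]:
  "s \<in> obj Ty0 \<Longrightarrow> t \<in> obj Ty0 \<Longrightarrow> u \<in> obj Ty0 \<Longrightarrow> mk_rat s t u \<in> obj Ty0"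
  "s \<in> obj Ty0 \<Longrightarrow> t \<in> obj Ty0 \<Longrightarrow> rat_add s t \<in> obj Ty0"
  "s \<in> obj Ty0 \<Longrightarrow> rat_uminus s \<in> obj Ty0"
  "s \<in> obj Ty0 \<Longrightarrow> t \<in> obj Ty0 \<Longrightarrow> rat_sub s t \<in> obj Ty0"
  "s \<in> obj Ty0 \<Longrightarrow> rat_abs s \<in> obj Ty0" "s \<in> obj Ty0 \<Longrightarrow> half_pow s \<in> obj Ty0"
  "s \<in> obj Ty0 \<Longrightarrow> two_half_pow s \<in> obj Ty0"
  by (simp_all add: mk_rat_def rat_add_def rat_uminus_def rat_sub_def rat_abs_def
    half_pow_def two_half_pow_def)

lemma obj_app1 [simp]: "f \<in> obj Ty1 \<Longrightarrow> t \<in> obj Ty0 \<Longrightarrow> f \<cdot> t \<in> obj Ty0"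
  by (rule obj_App)

lemma obj_app11 [simp]: "f \<in> obj (Ty1 \<Rrightarrow> Ty1) \<Longrightarrow> t \<in> obj Ty1 \<Longrightarrow> f \<cdot> t \<in> obj Ty1"
  by (rule obj_App)

lemma obj_app011 [simp]: "f \<in> obj (Ty0 \<Rrightarrow> Ty1 \<Rrightarrow> Ty1) \<Longrightarrow> t \<in> obj Ty0 \<Longrightarrow> f \<cdot> t \<in> obj (Ty1 \<Rrightarrow> Ty1)"
  by (rule obj_App)

lemma obj_real [simp]:
  "real_zero \<in> obj Ty1" "real_one \<in> obj Ty1"
  "x \<in> obj Ty1 \<Longrightarrow> y \<in> obj Ty1 \<Longrightarrow> real_add x y \<in> obj Ty1"
  "x \<in> obj Ty1 \<Longrightarrow> y \<in> obj Ty1 \<Longrightarrow> real_sub x y \<in> obj Ty1"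
  "x \<in> obj Ty1 \<Longrightarrow> real_abs x \<in> obj Ty1"
  "x \<in> obj Ty1 \<Longrightarrow> y \<in> obj Ty1 \<Longrightarrow> real_dist x y \<in> obj Ty1"
  by (simp_all add: real_zero_def real_one_def real_add_def real_sub_def real_abs_def real_dist_def)

lemma wf_eq_less: "s \<in> obj Ty0 \<Longrightarrow> t \<in> obj Ty0 \<Longrightarrow> wf_fm (s \<^bold>= t) \<and> wf_fm (s \<^bold>< t)"
  by (simp add: obj_def)

lemma wf_univ [simp]: "wf_fm (F (Var (fresh ts) \<sigma>)) \<Longrightarrow> wf_fm (univ \<sigma> ts F)"
  by (simp add: univ_def)

lemma wf_exis [simp]: "wf_fm (F (Var (fresh ts) \<sigma>)) \<Longrightarrow> wf_fm (exis \<sigma> ts F)"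
  by (simp add: exis_def)

lemma wf_rat_less [simp]: "s \<in> obj Ty0 \<Longrightarrow> t \<in> obj Ty0 \<Longrightarrow> wf_fm (rat_less s t)"
  unfolding rat_less_def by (rule wf_eq_less[THEN conjunct2]) simp_all

lemma wf_real [simp]:
  "x \<in> obj Ty1 \<Longrightarrow> wf_fm (is_real x)"
  "x \<in> obj Ty1 \<Longrightarrow> y \<in> obj Ty1 \<Longrightarrow> wf_fm (real_eq x y)"
  "x \<in> obj Ty1 \<Longrightarrow> y \<in> obj Ty1 \<Longrightarrow> wf_fm (real_less x y)"
  "x \<in> obj Ty1 \<Longrightarrow> wf_fm (in_unit x)"
  "x \<in> obj Ty1 \<Longrightarrow> wf_fm (real_pos x)"
  by (auto simp: is_real_def real_eq_def real_less_def in_unit_def real_pos_def)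

lemma wf_relativized [simp]:
  "wf_fm (F (Var (fresh ts) Ty1)) \<Longrightarrow> wf_fm (all_unit ts F)"
  "wf_fm (F (Var (fresh ts) Ty1)) \<Longrightarrow> wf_fm (ex_unit ts F)"
  "wf_fm (F (Var (fresh ts) Ty1)) \<Longrightarrow> wf_fm (all_pos ts F)"
  "wf_fm (F (Var (fresh ts) Ty1)) \<Longrightarrow> wf_fm (ex_pos ts F)"
  by (auto simp: all_unit_def ex_unit_def all_pos_def ex_pos_def)

lemma wf_fun [simp]:
  "f \<in> obj (Ty1 \<Rrightarrow> Ty1) \<Longrightarrow> wf_fm (unit_fun f)"
  "f \<in> obj (Ty1 \<Rrightarrow> Ty1) \<Longrightarrow> x \<in> obj Ty1 \<Longrightarrow> wf_fm (continuous_at f x)"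
  "f \<in> obj (Ty1 \<Rrightarrow> Ty1) \<Longrightarrow> wf_fm (continuous_unit f)"
  "f \<in> obj (Ty1 \<Rrightarrow> Ty1) \<Longrightarrow> wf_fm (usc_unit f)"
  "g \<in> obj (Ty0 \<Rrightarrow> Ty1 \<Rrightarrow> Ty1) \<Longrightarrow> f \<in> obj (Ty1 \<Rrightarrow> Ty1) \<Longrightarrow> wf_fm (converges_pointwise g f)"
  by (auto simp: unit_fun_def continuous_at_def continuous_unit_def usc_unit_def usc_at_def
    converges_pointwise_def wf_eq_less simp del: wf_fm.simps(1,2))

definition goal_fm :: fm where
  "goal_fm = univ (Ty1 \<Rrightarrow> Ty1) [] (\<lambda>f. univ (Ty0 \<Rrightarrow> Ty1 \<Rrightarrow> Ty1) [f] (\<lambda>fs.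
      unit_fun f \<^bold>\<and> usc_unit f \<^bold>\<and>
      univ Ty0 [fs] (\<lambda>n. unit_fun (fs \<cdot> n) \<^bold>\<and> continuous_unit (fs \<cdot> n)) \<^bold>\<and>
      converges_pointwise fs f
      \<^bold>\<longrightarrow> ex_unit [f] (\<lambda>x. continuous_at f x)))"

lemma wf_goal: "wf_fm goal_fm"
  by (auto simp: goal_fm_def)

lemma wf_exists2: "wf_fm exists2_axiom"
  by (auto simp: exists2_axiom_def exis_def univ_def)

text \<open>
  A countermodel to the theorem on the set of natural numbers, with non-standard operations.  These
  operations are chosen once and for all, so that the numbers of the model form a type on which the
  arithmetic of type classes is available; if there is no countermodel, the standard operations
  serve.
\<close>

definition countermodel :: "(tm \<Rightarrow> 'm) \<Rightarrow> ('m \<Rightarrow> 'm \<Rightarrow> bool) \<Rightarrow> ('m \<Rightarrow> 'm \<Rightarrow> 'm) \<Rightarrow> ('m \<Rightarrow> 'm \<Rightarrow> 'm) \<Rightarrow>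
    'm \<Rightarrow> 'm \<Rightarrow> bool" where
  "countermodel \<nu> lt pl ti ze on \<longleftrightarrow> num_model \<nu> lt pl ti ze on \<and>
    sat (\<lambda>s t. \<nu> s = \<nu> t) (\<lambda>s t. lt (\<nu> s) (\<nu> t)) \<iota> exists2_axiom \<and>
    \<not> sat (\<lambda>s t. \<nu> s = \<nu> t) (\<lambda>s t. lt (\<nu> s) (\<nu> t)) \<iota> goal_fm"

lemma ex_countermodel:
  assumes "\<not> (ACA0_omega \<turnstile> goal_fm)"
  shows "\<exists>(\<nu> :: tm \<Rightarrow> nat) lt pl ti ze on. countermodel \<nu> lt pl ti ze on"
proof -
  from ex_term_model[OF assms[unfolded proves_def] wf_goal]
  obtain E L where T: "\<forall>A \<phi>. good A \<longrightarrow> \<phi> \<in> ACA0_omega \<longrightarrow> wf_fm \<phi> \<longrightarrow> sat E L A \<phi>"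
    and g: "\<not> sat E L \<iota> goal_fm"
    and E: "\<forall>s\<in>obj Ty0. E s s" "\<forall>s t. E s t \<longrightarrow> E t s" "\<forall>r s t. E r s \<longrightarrow> E s t \<longrightarrow> E r t"
    and L: "\<forall>s t s' t'. E s s' \<longrightarrow> E t t' \<longrightarrow> L s t \<longrightarrow> L s' t'"
    by (elim exE conjE) (rule that)
  have "rca_model E L"
  proof
    show "sat E L A \<phi>" if "good A" "\<phi> \<in> RCA0_omega" "wf_fm \<phi>" for A \<phi>
      using T that by (simp add: ACA0_omega_def)
    show "E s s" if "s \<in> obj Ty0" for s using E(1) that by blast
    show "E t s" if "E s t" for s t using E(2) that by blast
    show "E r t" if "E r s" "E s t" for r s t using E(3) that by blast
    show "L s' t'" if "E s s'" "E t t'" "L s t" for s t s' t' using L that by blast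
  qed
  then obtain \<nu> :: "tm \<Rightarrow> nat" and lt pl ti ze on where m: "num_model \<nu> lt pl ti ze on"
    and EL: "\<forall>s\<in>obj Ty0. \<forall>t\<in>obj Ty0. (E s t \<longleftrightarrow> \<nu> s = \<nu> t) \<and> (L s t \<longleftrightarrow> lt (\<nu> s) (\<nu> t))"
    by (elim exE[OF rca_model_numbering] exE conjE) (rule that)
  have "sat (\<lambda>s t. \<nu> s = \<nu> t) (\<lambda>s t. lt (\<nu> s) (\<nu> t)) \<iota> \<phi> = sat E L \<iota> \<phi>" if "wf_fm \<phi>" for \<phi>
    using that EL by (intro sat_obj_cong) auto
  then have "countermodel \<nu> lt pl ti ze on"
    unfolding countermodel_def using m g T good_id wf_goal wf_exists2
    by (simp add: ACA0_omega_def)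
  then show ?thesis by blast
qed

lemma ops_ok_nat: "ops_ok (<) (+) (*) 0 (1 :: nat)"
  unfolding ops_ok_def by (auto simp: algebra_simps not_less intro: le_add_diff_inverse)

lemma ex_ops: "\<exists>ops. case ops of (lt, pl, ti, ze, on) \<Rightarrow> ops_ok lt pl ti ze (on :: nat) \<and>
    ((ACA0_omega \<turnstile> goal_fm) \<or> (\<exists>\<nu>. countermodel \<nu> lt pl ti ze on))"
proof (cases "(ACA0_omega \<turnstile> goal_fm)")
  case True
  then show ?thesis using ops_ok_nat by (intro exI[of _ "((<), (+), (*), 0, 1)"]) auto
next
  case False
  then obtain \<nu> lt pl ti ze and on :: nat where "countermodel \<nu> lt pl ti ze on" 
    using ex_countermodel by blast
  moreover from this have "ops_ok lt pl ti ze on"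
    unfolding countermodel_def by (elim conjE) (rule num_model.ops_ok)
  ultimately show ?thesis by (intro exI[of _ "(lt, pl, ti, ze, on)"]) auto
qed

definition chosen_ops where
  "chosen_ops = (SOME ops. case ops of (lt, pl, ti, ze, on) \<Rightarrow> ops_ok lt pl ti ze (on :: nat) \<and>
    ((ACA0_omega \<turnstile> goal_fm) \<or> (\<exists>\<nu>. countermodel \<nu> lt pl ti ze on)))"

lemma chosen_ops: "case chosen_ops of (lt, pl, ti, ze, on) \<Rightarrow> ops_ok lt pl ti ze on \<and>
    ((ACA0_omega \<turnstile> goal_fm) \<or> (\<exists>\<nu>. countermodel \<nu> lt pl ti ze on))"
  unfolding chosen_ops_def by (rule someI_ex[OF ex_ops])

section \<open>The numbers of the countermodel as an ordered semiring type\<close>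

typedef mnat = "UNIV :: nat set" ..

setup_lifting type_definition_mnat

instantiation mnat :: "{zero, one, plus, times, minus, linorder}"
begin

lift_definition zero_mnat :: mnat is "case chosen_ops of (lt, pl, ti, ze, on) \<Rightarrow> ze" .
lift_definition one_mnat :: mnat is "case chosen_ops of (lt, pl, ti, ze, on) \<Rightarrow> on" .
lift_definition plus_mnat :: "mnat \<Rightarrow> mnat \<Rightarrow> mnat" is "case chosen_ops of (lt, pl, ti, ze, on) \<Rightarrow> pl" .
lift_definition times_mnat :: "mnat \<Rightarrow> mnat \<Rightarrow> mnat" is "case chosen_ops of (lt, pl, ti, ze, on) \<Rightarrow> ti" .
lift_definition less_mnat :: "mnat \<Rightarrow> mnat \<Rightarrow> bool" is "case chosen_ops of (lt, pl, ti, ze, on) \<Rightarrow> lt" .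
definition less_eq_mnat :: "mnat \<Rightarrow> mnat \<Rightarrow> bool" where "(a :: mnat) \<le> b \<longleftrightarrow> \<not> b < a"
text \<open>The default 0 makes subtraction truncated; the class laws, such as
  \<open>a - b - c = a - (b + c)\<close>, have to hold for all arguments.\<close>

definition minus_mnat :: "mnat \<Rightarrow> mnat \<Rightarrow> mnat" where
  "(a :: mnat) - b = (if b \<le> a then SOME c. c + b = a else 0)"

lemma ops_ok_mnat: "ops_ok (<) (+) (*) 0 (1 :: mnat)"
proof -
  obtain lt pl ti ze on where o: "chosen_ops = (lt, pl, ti, ze, on)" by (metis prod_cases5)
  have ok: "ops_ok lt pl ti ze on" using chosen_ops by (simp add: o)
  have r: "Rep_mnat 0 = ze" "Rep_mnat 1 = on" "a < b \<longleftrightarrow> lt (Rep_mnat a) (Rep_mnat b)"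
    "Rep_mnat (a + b) = pl (Rep_mnat a) (Rep_mnat b)" "Rep_mnat (a * b) = ti (Rep_mnat a) (Rep_mnat b)" for a b
    by (simp_all add: zero_mnat.rep_eq one_mnat.rep_eq less_mnat.rep_eq plus_mnat.rep_eq times_mnat.rep_eq o)
  have ex: "(\<exists>d. pl (Rep_mnat d) m = n) \<longleftrightarrow> (\<exists>d. pl d m = n)" for m n
    by (metis Abs_mnat_inverse UNIV_I)
  show ?thesis
    unfolding ops_ok_def Rep_mnat_inject[symmetric] r ex
    by (intro allI) (rule ok[unfolded ops_ok_def, THEN spec, THEN spec, THEN spec])
qed

lemma mnat_laws:
  fixes a b c :: mnat
  shows "a + b + c = a + (b + c)" "a + b = b + a" "a + 0 = a"
    "a * b * c = a * (b * c)" "a * b = b * a" "a * 1 = a" "a * 0 = 0"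
    "a * (b + c) = a * b + a * c" "\<not> a < a" "a < b \<Longrightarrow> b < c \<Longrightarrow> a < c"
    "a < b \<or> a = b \<or> b < a" "a < b \<Longrightarrow> a + c < b + c"
    "a < b \<Longrightarrow> 0 < c \<Longrightarrow> a * c < b * c" "(0 :: mnat) < 1" "\<not> a < 0"
    "\<not> a < b \<Longrightarrow> \<exists>d. d + b = a"
  using ops_ok_mnat[unfolded ops_ok_def, THEN spec, of a, THEN spec, of b, THEN spec, of c] by argo+

instance
proof
  fix a b c :: mnat
  show "(a < b) = (a \<le> b \<and> \<not> b \<le> a)" "a \<le> a" "a \<le> b \<or> b \<le> a"
    unfolding less_eq_mnat_def using mnat_laws(9)[of a] mnat_laws(10)[of a b a] by blast+
  show "a = b" if "a \<le> b" "b \<le> a" using that mnat_laws(11)[of a b] by (simp add: less_eq_mnat_def)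
  show "a \<le> c" if "a \<le> b" "b \<le> c"
    using that mnat_laws(10)[of c a b] mnat_laws(11)[of a b] by (auto simp: less_eq_mnat_def)
qed

end

instance mnat :: comm_semiring_1
proof
  fix a b c :: mnat
  show "a + b + c = a + (b + c)" "a + b = b + a" "a * b * c = a * (b * c)" "a * b = b * a"
    by (fact mnat_laws)+
  show "0 + a = a" "1 * a = a" "0 * a = 0" "a * 0 = 0"
    using mnat_laws(2)[of 0 a] mnat_laws(3)[of a] mnat_laws(5)[of 1 a] mnat_laws(6)[of a]
      mnat_laws(5)[of 0 a] mnat_laws(7)[of a] by simp_all
  show "(a + b) * c = a * c + b * c"
    using mnat_laws(8)[of c a b] mnat_laws(5)[of c a] mnat_laws(5)[of c b] mnat_laws(5)[of c "a + b"] by simp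
  show "(0::mnat) \<noteq> 1" using mnat_laws(14) by auto
qed

lemma mnat_nonneg: "0 \<le> (a :: mnat)"
  using mnat_laws(15)[of a] by (simp add: not_less)

instance mnat :: linordered_semidom
proof
  fix a b c :: mnat
  have lc: "c + a < c + b \<longleftrightarrow> a < b" for a b c :: mnat
  proof
    show "a < b \<Longrightarrow> c + a < c + b" using mnat_laws(12)[of a b c] by (simp add: add.commute)
    show "c + a < c + b \<Longrightarrow> a < b"
      using mnat_laws(12)[of b a c] less_asym[of "c + a" "c + b"] linorder_cases[of a b]
      by (auto simp: add.commute)
  qed
  have lm: "c + a \<le> c + b \<longleftrightarrow> a \<le> b" for a b c :: mnat
    using lc[of c b a] by (simp add: not_less[symmetric])
  then show "c + a \<le> c + b" if "a \<le> b" for a b c :: mnat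
    using that by simp
  have cancel: "c + a = c + b \<longleftrightarrow> a = b" for a b c :: mnat
    using lm[of c a b] lm[of c b a] by (auto simp: order_eq_iff)
  show d: "a - b + b = a" if "b \<le> a" for a b :: mnat
  proof -
    have "\<exists>c. c + b = a" using that mnat_laws(16)[of a b] by (simp add: not_less)
    then have "(SOME c. c + b = a) + b = a" by (rule someI_ex)
    then show ?thesis using that by (simp add: minus_mnat_def)
  qed
  have d0: "a - b = 0" if "\<not> b \<le> a" for a b :: mnat using that by (simp add: minus_mnat_def)
  have le: "b \<le> b + c" for b c :: mnat using lm[of b 0 c] mnat_nonneg[of c] by simp
  have du: "b + c - b = c" for b c :: mnat
    using d[of b "b + c"] le[of b c] cancel[of b "b + c - b" c] by (simp add: add.commute)
  show "a + b - a = b" by (rule du)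
  have ex: "\<exists>e. a = b + e" if "b \<le> a" for a b :: mnat using d[OF that] by (metis add.commute)
  have zd: "0 - c = 0" for c :: mnat
    using mnat_nonneg[of c] d[of c 0] d0[of c 0] du[of c 0] by (cases "c \<le> 0") (auto dest: antisym)
  show "a - b - c = a - (b + c)"
  proof (cases "b \<le> a")
    case True
    then obtain e where e: "a = b + e" using ex by blast
    show ?thesis
    proof (cases "c \<le> e")
      case True
      then obtain f where "e = c + f" using ex by blast
      then show ?thesis using e du[of "b + c" f] by (simp add: du add.assoc)
    next
      case False
      then have "\<not> b + c \<le> a" using e lm by simp
      then show ?thesis using False e by (simp add: du d0)
    qed
  next
    case False
    then have "\<not> b + c \<le> a" using le[of b c] by (meson order_trans)
    then show ?thesis using False by (simp add: d0 zd)
  qed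
  show ml: "c * a < c * b" if "a < b" "0 < c" for a b c :: mnat
    using mnat_laws(13)[OF that] by (simp add: mult.commute)
  show "a * (b - c) = a * b - a * c"
  proof (cases "c \<le> b")
    case True
    then obtain e where "b = c + e" using ex by blast
    then show ?thesis by (simp add: du distrib_left)
  next
    case False
    have "a * b - a * c = 0"
    proof (cases "a = 0")
      case F: False
      then have "0 < a" using mnat_nonneg[of a] by (simp add: le_less)
      then have "a * b < a * c" using False by (intro ml) simp
      then show ?thesis by (intro d0) simp
    qed (simp add: zd)
    then show ?thesis using False by (simp add: d0)
  qed
  show "a * b \<noteq> 0" if "a \<noteq> 0" "b \<noteq> 0"
  proof -
    have "0 < a" "0 < b" using that mnat_nonneg[of a] mnat_nonneg[of b] by (auto simp: le_less)
    then have "a * 0 < a * b" by (intro ml)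
    then show ?thesis by auto
  qed
  show "(0::mnat) < 1" by (fact mnat_laws)
qed

lemma countermodel_mnat:
  assumes "\<not> (ACA0_omega \<turnstile> goal_fm)"
  shows "\<exists>\<nu>. countermodel \<nu> (<) (+) (*) 0 (1 :: mnat)"
proof -
  obtain lt pl ti ze on where o: "chosen_ops = (lt, pl, ti, ze, on)" by (metis prod_cases5)
  obtain \<nu> where c: "countermodel \<nu> lt pl ti ze on"
    using chosen_ops assms unfolding o by auto
  define \<mu> where "\<mu> t = Abs_mnat (\<nu> t)" for t
  have eq: "\<mu> s = \<mu> t \<longleftrightarrow> \<nu> s = \<nu> t" for s t
    unfolding \<mu>_def by (simp add: Abs_mnat_inject)
  have less: "\<mu> s < \<mu> t \<longleftrightarrow> lt (\<nu> s) (\<nu> t)" for s t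
    unfolding \<mu>_def less_mnat_def o by (simp add: Abs_mnat_inverse)
  have EL: "(\<lambda>s t. \<mu> s = \<mu> t) = (\<lambda>s t. \<nu> s = \<nu> t)" "(\<lambda>s t. \<mu> s < \<mu> t) = (\<lambda>s t. lt (\<nu> s) (\<nu> t))"
    using eq less by auto
  interpret num_model \<nu> lt pl ti ze on using c by (simp add: countermodel_def)
  have "num_model \<mu> (<) (+) (*) 0 1"
  proof unfold_locales
    fix a :: mnat
    show "\<exists>t\<in>obj Ty0. \<mu> t = a" unfolding \<mu>_def using surj by (metis Rep_mnat_inverse)
    have ops: "\<mu> Zero = 0" "\<mu> One = 1" "\<mu> s + \<mu> t = Abs_mnat (pl (\<nu> s) (\<nu> t))"
      "\<mu> s * \<mu> t = Abs_mnat (ti (\<nu> s) (\<nu> t))" for s t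
      by (simp_all add: \<mu>_def zero_mnat_def one_mnat_def plus_mnat_def times_mnat_def o Abs_mnat_inverse)
    show "\<mu> Zero = 0" "\<mu> One = 1" by (fact ops)+
    show "\<mu> (s \<^bold>+ t) = \<mu> s + \<mu> t" "\<mu> (s \<^bold>* t) = \<mu> s * \<mu> t" if "s \<in> obj Ty0" "t \<in> obj Ty0" for s t
      using that unfolding ops by (simp_all add: \<mu>_def)
    show "sat (\<lambda>s t. \<mu> s = \<mu> t) (\<lambda>s t. \<mu> s < \<mu> t) A \<phi>" if "good A" "\<phi> \<in> RCA0_omega" "wf_fm \<phi>" for A \<phi>
      unfolding EL using that by (rule rca)
    show "\<mu> s' < \<mu> t'" if "\<mu> s = \<mu> s'" "\<mu> t = \<mu> t'" "\<mu> s < \<mu> t" for s s' t t'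
      using that by simp
  qed auto
  then have "countermodel \<mu> (<) (+) (*) 0 1"
    using c unfolding countermodel_def EL by (elim conjE) (intro conjI)
  then show ?thesis by (intro exI[where x = \<mu>])
qed

section \<open>The ordered field of fractions of the model\<close>

text \<open>The pair \<open>(a, b)\<close> stands for the formal difference of \<open>a\<close> and
  \<open>b\<close>, as in the Grothendieck construction of the integers; subtraction within the
  semiring itself need not give negative values.\<close>

definition diffrel :: "'a :: linordered_semidom \<times> 'a \<Rightarrow> 'a \<times> 'a \<Rightarrow> bool" where
  "diffrel x y \<longleftrightarrow> fst x + snd y = fst y + snd x"

lemma equivp_diffrel: "equivp (diffrel :: 'a :: linordered_semidom \<times> 'a \<Rightarrow> _)"
proof (rule equivpI)
  show "transp (diffrel :: 'a \<times> 'a \<Rightarrow> _)"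
  proof (rule transpI)
    fix x y z :: "'a \<times> 'a" assume a: "diffrel x y" "diffrel y z"
    have "(fst x + snd z) + snd y = (fst x + snd y) + snd z" by (simp add: ac_simps)
    also have "\<dots> = (fst y + snd z) + snd x" using a(1) by (simp add: diffrel_def ac_simps)
    also have "\<dots> = (fst z + snd x) + snd y" unfolding a(2)[unfolded diffrel_def] by (simp add: ac_simps)
    finally show "diffrel x z" by (simp add: diffrel_def)
  qed
qed (auto simp: diffrel_def reflp_def symp_def)

quotient_type (overloaded) 'a gint = "'a :: linordered_semidom \<times> 'a" / diffrel
  morphisms rep_gi abs_gi by (rule equivp_diffrel)

instantiation gint :: (linordered_semidom) comm_ring_1
begin

lift_definition zero_gint :: "'a gint" is "(0, 0)" .
lift_definition one_gint :: "'a gint" is "(1, 0)" .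
lift_definition plus_gint :: "'a gint \<Rightarrow> 'a gint \<Rightarrow> 'a gint" is "\<lambda>(a, b) (c, d). (a + c, b + d)"
  by (auto simp: diffrel_def split: prod.splits) (metis (no_types, opaque_lifting) add.assoc add.left_commute)
lift_definition uminus_gint :: "'a gint \<Rightarrow> 'a gint" is "\<lambda>(a, b). (b, a)"
  by (auto simp: diffrel_def ac_simps)
lift_definition minus_gint :: "'a gint \<Rightarrow> 'a gint \<Rightarrow> 'a gint" is "\<lambda>(a, b) (c, d). (a + d, b + c)"
  by (auto simp: diffrel_def split: prod.splits) (metis (no_types, opaque_lifting) add.assoc add.left_commute add.commute)
lift_definition times_gint :: "'a gint \<Rightarrow> 'a gint \<Rightarrow> 'a gint" is
  "\<lambda>(a, b) (c, d). (a * c + b * d, a * d + b * c)"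
proof (clarsimp simp: diffrel_def)
  fix a b a' b' c d c' d' :: 'a
  assume 1: "a + b' = a' + b" and 2: "c + d' = c' + d"
  have "(a * c + b * d + (a' * d' + b' * c')) + (b' * c + a' * d) =
      (a + b') * c + (a' + b) * d + (a' * d' + b' * c')"
    by (simp add: algebra_simps)
  also have "\<dots> = (a' + b) * c + (a + b') * d + (a' * d' + b' * c')"
    using 1 by simp
  also have "\<dots> = a' * (c + d') + b' * (c' + d) + (a * d + b * c)"
    by (simp add: algebra_simps)
  also have "\<dots> = a' * (c' + d) + b' * (c + d') + (a * d + b * c)"
    using 2 by simp
  also have "\<dots> = (a' * c' + b' * d' + (a * d + b * c)) + (b' * c + a' * d)"
    by (simp add: algebra_simps)
  finally show "a * c + b * d + (a' * d' + b' * c') = a' * c' + b' * d' + (a * d + b * c)"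
    by simp
qed

instance
  by standard (transfer; auto simp: diffrel_def algebra_simps)+

end

instantiation gint :: (linordered_semidom) linordered_idom
begin

lift_definition less_eq_gint :: "'a gint \<Rightarrow> 'a gint \<Rightarrow> bool" is "\<lambda>(a, b) (c, d). a + d \<le> c + b"
proof (clarsimp simp: diffrel_def)
  fix a b a' b' c d c' d' :: 'a
  assume 1: "a + b' = a' + b" and 2: "c + d' = c' + d"
  have "a + d \<le> c + b \<longleftrightarrow> (a + d) + (b' + d') \<le> (c + b) + (b' + d')" by simp
  also have "(a + d) + (b' + d') = (a + b') + (d + d')" by (simp add: ac_simps)
  also have "(a + b') + (d + d') = (a' + d') + (b + d)" unfolding 1 by (simp add: ac_simps)
  also have "(c + b) + (b' + d') = (c + d') + (b + b')" by (simp add: ac_simps)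
  also have "(c + d') + (b + b') = (c' + b') + (b + d)" unfolding 2 by (simp add: ac_simps)
  finally show "(a + d \<le> c + b) = (a' + d' \<le> c' + b')" by simp
qed
definition less_gint :: "'a gint \<Rightarrow> 'a gint \<Rightarrow> bool" where
  "x < y \<longleftrightarrow> x \<le> (y :: 'a gint) \<and> \<not> y \<le> x"
definition abs_gint :: "'a gint \<Rightarrow> 'a gint" where "\<bar>x :: 'a gint\<bar> = (if x < 0 then - x else x)"
definition sgn_gint :: "'a gint \<Rightarrow> 'a gint" where
  "sgn (x :: 'a gint) = (if x = 0 then 0 else if 0 < x then 1 else - 1)"

instance
proof
  fix x y z :: "'a gint"
  show "x < y \<longleftrightarrow> x \<le> y \<and> \<not> y \<le> x" by (fact less_gint_def)
  show "x \<le> x" "x \<le> y \<or> y \<le> x" by (transfer; auto)+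
  show "x = y" if "x \<le> y" "y \<le> x" using that by transfer (auto simp: diffrel_def)
  show "x \<le> z" if "x \<le> y" "y \<le> z" using that
  proof (transfer, clarsimp)
    fix a b c d e f :: 'a
    assume "a + d \<le> c + b" "c + f \<le> e + d"
    then have "(a + d) + (c + f) \<le> (c + b) + (e + d)" by (rule add_mono)
    then have "(a + f) + (c + d) \<le> (e + b) + (c + d)" by (simp add: ac_simps)
    then show "a + f \<le> e + b" by simp
  qed
  show "z + x \<le> z + y" if "x \<le> y" using that
  proof (transfer, clarsimp)
    fix a b c d e f :: 'a
    assume "c + f \<le> e + d"
    then have "(a + b) + (c + f) \<le> (a + b) + (e + d)" by simp
    then show "a + c + (b + f) \<le> a + e + (b + d)" by (simp add: ac_simps)
  qed
  \<comment> \<open>This is strict monotonicity of multiplication in terms of representatives. With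
    the factor written as \<open>f + g\<close> and \<open>g\<close> positive, the terms in
    \<open>f\<close> agree on both sides and only \<open>g\<close> times the given inequality is
    left.\<close>
  have key: "e * a + f * b + (e * d + f * c) < e * c + f * d + (e * b + f * a)"
    if 1: "a + d < c + b" and 2: "f < e" for a b c d e f :: 'a
  proof -
    obtain g where g: "e = f + g" "0 < g" using 2 le_add_diff_inverse2[of f e]
      by (metis add.commute add_less_cancel_right add_0 less_imp_le)
    have "g * (a + d) < g * (c + b)" using 1 g(2) by (rule mult_strict_left_mono)
    then have "g * (a + d) + f * (a + b + c + d) < g * (c + b) + f * (a + b + c + d)"
      by (rule add_strict_right_mono)
    then show ?thesis unfolding g by (simp add: algebra_simps)
  qed
  have less: "x < y \<longleftrightarrow> \<not> y \<le> x" for x y :: "'a gint"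
    unfolding less_gint_def by (transfer; auto)
  show "z * x < z * y" if "x < y" "0 < z" using that unfolding less
    by (transfer, clarsimp simp: not_le) (drule (1) key, drule (1) order.strict_trans1, simp only: less_irrefl)
  show "\<bar>x\<bar> = (if x < 0 then - x else x)" by (fact abs_gint_def)
  show "sgn x = (if x = 0 then 0 else if 0 < x then 1 else - 1)" by (fact sgn_gint_def)
qed

end

text \<open>The rationals of the model as an ordered field, so that linear arithmetic and field
  simplification apply to them even when the numbers are non-standard.\<close>

type_synonym 'a qnum = "'a gint fract"

lift_definition gemb :: "'a :: linordered_semidom \<Rightarrow> 'a gint" is "\<lambda>a. (a, 0)" .

definition emb :: "'a :: linordered_semidom \<Rightarrow> 'a qnum" where "emb a = Fract (gemb a) 1"

lemma gemb_simps: "gemb 0 = 0" "gemb 1 = 1" "gemb (a + b) = gemb a + gemb b"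
  "gemb (a * b) = gemb a * gemb b" "gemb a \<le> gemb b \<longleftrightarrow> a \<le> b" "gemb a = gemb b \<longleftrightarrow> a = b"
  by (transfer; simp add: diffrel_def)+

lemma emb_simps [simp]: "emb 0 = 0" "emb 1 = 1" "emb (a + b) = emb a + emb b"
  "emb (a * b) = emb a * emb b" "emb a \<le> emb b \<longleftrightarrow> a \<le> b" "emb a = emb b \<longleftrightarrow> a = b"
  "emb a < emb b \<longleftrightarrow> a < b"
  by (simp_all add: emb_def gemb_simps Zero_fract_def One_fract_def eq_fract less_le)

lemma emb_pos [simp]: "0 < emb a \<longleftrightarrow> 0 < a" "0 \<le> emb a \<longleftrightarrow> 0 \<le> a" "emb a = 0 \<longleftrightarrow> a = 0"
  by (metis emb_simps(1,7), metis emb_simps(1,5), metis emb_simps(1,6))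

lemma emb_diff: "b \<le> a \<Longrightarrow> emb (a - b) = emb a - emb b"
  using emb_simps(3)[of "a - b" b] by simp

lemma gint_cases: obtains a b where "x = gemb a - gemb b"
  by (transfer fixing: thesis) (auto simp: diffrel_def)

section \<open>Arithmetical comprehension and the Baire category argument\<close>

text \<open>A second-order interface in which the syntax of the model no longer appears.
  \<open>ex2\<close> eliminates one number quantifier at a time, \<open>choice\<close> selects a
  zero for every parameter, and \<open>S_induct\<close> is induction for zero sets; together they
  give comprehension, choice and induction for all arithmetical predicates.\<close>

locale aca_functions =
  fixes S :: "('n :: linordered_semidom \<Rightarrow> 'n) set"
    and pr :: "'n \<Rightarrow> 'n \<Rightarrow> 'n" and fs sn p2 :: "'n \<Rightarrow> 'n"
  assumes nonneg: "0 \<le> (a :: 'n)" and discrete: "(a :: 'n) = 0 \<or> 1 \<le> a"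
    and S_const: "(\<lambda>_. c) \<in> S" and S_id: "(\<lambda>e. e) \<in> S"
    and S_comp: "F \<in> S \<Longrightarrow> G \<in> S \<Longrightarrow> (\<lambda>e. F (G e)) \<in> S"
    and S_add: "F \<in> S \<Longrightarrow> G \<in> S \<Longrightarrow> (\<lambda>e. F e + G e) \<in> S"
    and S_mult: "F \<in> S \<Longrightarrow> G \<in> S \<Longrightarrow> (\<lambda>e. F e * G e) \<in> S"
    and S_monus: "F \<in> S \<Longrightarrow> G \<in> S \<Longrightarrow> (\<lambda>e. if G e \<le> F e then F e - G e else 0) \<in> S"
    and S_pr: "F \<in> S \<Longrightarrow> G \<in> S \<Longrightarrow> (\<lambda>e. pr (F e) (G e)) \<in> S"
    and fs_S: "fs \<in> S" and sn_S: "sn \<in> S" and p2_S: "p2 \<in> S"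
    and pairing [simp]: "fs (pr a b) = a" "sn (pr a b) = b"
    and p2_0 [simp]: "p2 0 = 1" and p2_Suc [simp]: "p2 (a + 1) = p2 a + p2 a"
    and ex2: "F \<in> S \<Longrightarrow> \<exists>G\<in>S. \<forall>e. G e = 0 \<longleftrightarrow> (\<exists>x. F (pr e x) = 0)"
    and choice: "F \<in> S \<Longrightarrow> \<forall>e. \<exists>x. F (pr e x) = 0 \<Longrightarrow> \<exists>G\<in>S. \<forall>e. F (pr e (G e)) = 0"
    and prim_rec: "G \<in> S \<Longrightarrow> \<exists>R\<in>S. R 0 = c \<and> (\<forall>i. R (i + 1) = G (pr i (R i)))"
    and S_induct: "F \<in> S \<Longrightarrow> F 0 = 0 \<Longrightarrow> (\<And>a. F a = 0 \<Longrightarrow> F (a + 1) = 0) \<Longrightarrow> F a = 0"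
begin

lemma S_fs: "F \<in> S \<Longrightarrow> (\<lambda>e. fs (F e)) \<in> S"
  by (rule S_comp[OF fs_S])

lemma S_sn: "F \<in> S \<Longrightarrow> (\<lambda>e. sn (F e)) \<in> S"
  by (rule S_comp[OF sn_S])

lemma S_p2: "F \<in> S \<Longrightarrow> (\<lambda>e. p2 (F e)) \<in> S"
  by (rule S_comp[OF p2_S])

text \<open>Comprehension is built into this notion: the predicates covered are those with a
  characteristic function in the model. Since number quantifiers preserve it,
  \<open>arith_induct\<close> amounts to arithmetical induction.\<close>

definition arith :: "('n \<Rightarrow> bool) \<Rightarrow> bool" where
  "arith P \<longleftrightarrow> (\<exists>F\<in>S. \<forall>e. P e \<longleftrightarrow> F e = 0)"

lemma arith_induct:
  assumes "arith P" "P 0" "\<And>a. P a \<Longrightarrow> P (a + 1)" shows "P a"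
proof -
  obtain F where F: "F \<in> S" "\<And>e. P e \<longleftrightarrow> F e = 0" using assms(1) unfolding arith_def by blast
  show ?thesis using S_induct[OF F(1), of a] assms(2,3) unfolding F(2) by blast
qed

lemma sum_eq_0: "(a :: 'n) + b = 0 \<longleftrightarrow> a = 0 \<and> b = 0"
  using nonneg[of a] nonneg[of b] by (rule add_nonneg_eq_0_iff)

lemma less_Suc: "(a :: 'n) < b + 1 \<longleftrightarrow> a \<le> b"
proof
  assume a: "a < b + 1"
  show "a \<le> b"
  proof (rule ccontr)
    assume "\<not> a \<le> b"
    then have "b < a" by simp
    then obtain c where c: "a = b + c" "c \<noteq> 0" using le_add_diff_inverse2[of b a]
      by (metis add.commute add_0 less_imp_le less_irrefl)
    then show False using a discrete[of c] by simp
  qed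
qed (rule le_less_trans[OF _ less_add_one])

lemma ex_diff: "(a :: 'n) \<le> b \<Longrightarrow> \<exists>c. b = a + c"
  using le_add_diff_inverse2[of a b] by (metis add.commute)

lemma arith_less:
  assumes "F \<in> S" "G \<in> S" shows "arith (\<lambda>e. F e < G e)"
proof -
  define D where "D e = (if F e \<le> G e then G e - F e else 0)" for e
  define H where "H e = (if D e \<le> 1 then 1 - D e else 0)" for e
  have "H \<in> S" unfolding H_def D_def by (intro S_monus S_const assms)
  moreover have "F e < G e \<longleftrightarrow> H e = 0" for e
  proof (cases "F e < G e")
    case True
    then obtain c where c: "G e = F e + c" "c \<noteq> 0"
      using ex_diff[of "F e" "G e"] by (auto simp: less_le)
    then have "D e = c" using nonneg[of c] by (simp add: D_def)
    moreover have "1 \<le> c" using c discrete[of c] by simp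
    ultimately have "H e = 0" by (simp add: H_def)
    with True show ?thesis by simp
  next
    case False
    then have "D e = 0" by (auto simp: D_def)
    then have "H e = 1" by (simp add: H_def)
    with False show ?thesis by simp
  qed
  ultimately show ?thesis unfolding arith_def by (intro bexI[of _ H]) auto
qed

lemma arith_not: 
  assumes "arith P" shows "arith (\<lambda>e. \<not> P e)"
proof -
  obtain F where F: "F \<in> S" "\<And>e. P e \<longleftrightarrow> F e = 0" using assms unfolding arith_def by blast
  have "arith (\<lambda>e. 0 < F e)" by (rule arith_less[OF S_const F(1)])
  then show ?thesis using F(2) nonneg by (simp add: less_le)
qed

lemma arith_conj: "arith P \<Longrightarrow> arith Q \<Longrightarrow> arith (\<lambda>e. P e \<and> Q e)"
  unfolding arith_def by (metis (no_types, lifting) S_add sum_eq_0)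

lemma arith_imp: "arith P \<Longrightarrow> arith Q \<Longrightarrow> arith (\<lambda>e. P e \<longrightarrow> Q e)"
  using arith_not[OF arith_conj[OF _ arith_not, of P Q]] by simp

lemma arith_le: "F \<in> S \<Longrightarrow> G \<in> S \<Longrightarrow> arith (\<lambda>e. F e \<le> G e)"
  using arith_not[OF arith_less[of G F]] by (simp add: not_less)

text \<open>The quantified variable is packed with the parameter into one number, so that unary
  predicates suffice. In this form nested quantifiers are handled by repeated introduction, each one
  leaving a further pair of projections.\<close>

lemma arith_ex: 
  assumes "arith (\<lambda>z. P (fs z) (sn z))" shows "arith (\<lambda>e. \<exists>x. P e x)"
proof -
  obtain F where F: "F \<in> S" "\<And>z. P (fs z) (sn z) \<longleftrightarrow> F z = 0" using assms unfolding arith_def by blast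
  have "P e x \<longleftrightarrow> F (pr e x) = 0" for e x using F(2)[of "pr e x"] by simp
  moreover obtain G where "G \<in> S" "\<forall>e. G e = 0 \<longleftrightarrow> (\<exists>x. F (pr e x) = 0)" using ex2[OF F(1)] by blast
  ultimately show ?thesis unfolding arith_def by (intro bexI[of _ G]) auto
qed

lemma arith_all: "arith (\<lambda>z. P (fs z) (sn z)) \<Longrightarrow> arith (\<lambda>e. \<forall>x. P e x)"
  using arith_not[OF arith_ex[of "\<lambda>e x. \<not> P e x"]] arith_not[of "\<lambda>z. P (fs z) (sn z)"] by simp

lemma arith_subst: "arith P \<Longrightarrow> G \<in> S \<Longrightarrow> arith (\<lambda>e. P (G e))"
  unfolding arith_def using S_comp by fastforce

section \<open>Rational-valued functions, powers of one half, and dependent choice\<close>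

definition rat :: "'n \<Rightarrow> 'n qnum" where
  "rat c = (emb (fs (fs c)) - emb (sn (fs c))) / emb (sn c + 1)"

definition h :: "'n \<Rightarrow> 'n qnum" where "h a = 1 / emb (p2 a)"

text \<open>Values in the fraction field are not numbers of the model, so definability is expressed
  through numerators and denominators in \<open>S\<close>. A comparison of two such functions
  becomes an inequality between functions in \<open>S\<close> once denominators are cleared.\<close>

definition qdef :: "('n \<Rightarrow> 'n qnum) \<Rightarrow> bool" where
  "qdef F \<longleftrightarrow> (\<exists>A\<in>S. \<exists>B\<in>S. \<exists>D\<in>S. (\<forall>e. 0 < D e) \<and> (\<forall>e. F e = (emb (A e) - emb (B e)) / emb (D e)))"

lemma qdefE:
  assumes "qdef F"
  obtains A B D where "A \<in> S" "B \<in> S" "D \<in> S" "\<And>e. 0 < D e" "\<And>e. F e = (emb (A e) - emb (B e)) / emb (D e)"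
  using assms unfolding qdef_def by blast

lemma p2_pos: "0 < p2 a"
proof (induction a rule: arith_induct)
  case 1 show ?case by (rule arith_less[OF S_const p2_S])
qed (simp_all add: add_pos_pos)

lemma Suc_pos: "0 < (a :: 'n) + 1"
  using nonneg[of a] by (simp add: add_nonneg_pos)

lemma qdef_rat: "F \<in> S \<Longrightarrow> qdef (\<lambda>e. rat (F e))"
  unfolding qdef_def rat_def
  by (intro bexI[of _ "\<lambda>e. fs (fs (F e))"] bexI[of _ "\<lambda>e. sn (fs (F e))"] bexI[of _ "\<lambda>e. sn (F e) + 1"])
    (auto intro: S_fs S_sn S_add S_const Suc_pos)

lemma qdef_h: "F \<in> S \<Longrightarrow> qdef (\<lambda>e. h (F e))"
  unfolding qdef_def h_def
  by (intro bexI[of _ "\<lambda>e. 1"] bexI[of _ "\<lambda>e. 0"] bexI[of _ "\<lambda>e. p2 (F e)"])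
    (auto intro: S_p2 S_const p2_pos)

lemma qdef_const_emb: "qdef (\<lambda>e. emb a)"
  unfolding qdef_def
  by (intro bexI[of _ "\<lambda>e. a"] bexI[of _ "\<lambda>e. 0"] bexI[of _ "\<lambda>e. 1"]) (auto intro: S_const)

lemma qdef_add: assumes "qdef F" "qdef G" shows "qdef (\<lambda>e. F e + G e)"
proof -
  obtain A B D where F: "A \<in> S" "B \<in> S" "D \<in> S" "\<And>e. 0 < D e" "\<And>e. F e = (emb (A e) - emb (B e)) / emb (D e)"
    using assms(1) by (rule qdefE) (rule that)
  obtain A' B' D' where G: "A' \<in> S" "B' \<in> S" "D' \<in> S" "\<And>e. 0 < D' e" "\<And>e. G e = (emb (A' e) - emb (B' e)) / emb (D' e)"
    using assms(2) by (rule qdefE) (rule that)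
  have "D e \<noteq> 0" "D' e \<noteq> 0" for e using F(4)[of e] G(4)[of e] by auto
  then show ?thesis unfolding qdef_def F(5) G(5)
    by (intro bexI[of _ "\<lambda>e. A e * D' e + A' e * D e"] bexI[of _ "\<lambda>e. B e * D' e + B' e * D e"]
       bexI[of _ "\<lambda>e. D e * D' e"])
      (use F G in \<open>auto intro!: S_add S_mult simp: field_simps\<close>)
qed

lemma qdef_uminus: assumes "qdef F" shows "qdef (\<lambda>e. - F e)"
proof -
  obtain A B D where F: "A \<in> S" "B \<in> S" "D \<in> S" "\<And>e. 0 < D e" "\<And>e. F e = (emb (A e) - emb (B e)) / emb (D e)"
    using assms(1) by (rule qdefE) (rule that)
  have neg: "- F e = (emb (B e) - emb (A e)) / emb (D e)" for e
    unfolding F(5) by (simp add: minus_divide_left)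
  show ?thesis unfolding qdef_def
    by (rule bexI[of _ B], rule bexI[of _ A], rule bexI[of _ D]) (use F neg in auto)
qed

lemma qdef_diff: "qdef F \<Longrightarrow> qdef G \<Longrightarrow> qdef (\<lambda>e. F e - G e)"
  using qdef_add[OF _ qdef_uminus, of F G] by simp

lemma arith_qless: assumes "qdef F" "qdef G" shows "arith (\<lambda>e. F e < G e)"
proof -
  obtain A B D where F: "A \<in> S" "B \<in> S" "D \<in> S" "\<And>e. 0 < D e" "\<And>e. F e = (emb (A e) - emb (B e)) / emb (D e)"
    using assms(1) by (rule qdefE) (rule that)
  obtain A' B' D' where G: "A' \<in> S" "B' \<in> S" "D' \<in> S" "\<And>e. 0 < D' e" "\<And>e. G e = (emb (A' e) - emb (B' e)) / emb (D' e)"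
    using assms(2) by (rule qdefE) (rule that)
  have "F e < G e \<longleftrightarrow> A e * D' e + B' e * D e < A' e * D e + B e * D' e" for e
  proof -
    have "F e < G e \<longleftrightarrow> (emb (A e) - emb (B e)) * emb (D' e) < (emb (A' e) - emb (B' e)) * emb (D e)"
      using F(4)[of e] G(4)[of e] unfolding F(5) G(5) by (simp add: field_simps)
    also have "\<dots> \<longleftrightarrow> emb (A e * D' e + B' e * D e) < emb (A' e * D e + B e * D' e)"
      by (simp only: emb_simps(1-4)) (simp add: algebra_simps)
    finally show ?thesis by (simp only: emb_simps(7))
  qed
  then show ?thesis using arith_less[of "\<lambda>e. A e * D' e + B' e * D e" "\<lambda>e. A' e * D e + B e * D' e"] F G
    by (simp add: S_add S_mult)
qed

lemma arith_qle: "qdef F \<Longrightarrow> qdef G \<Longrightarrow> arith (\<lambda>e. F e \<le> G e)"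
  using arith_not[OF arith_qless[of G F]] by (simp add: not_less)

lemma arith_abs_le: "qdef F \<Longrightarrow> qdef G \<Longrightarrow> arith (\<lambda>e. \<bar>F e\<bar> \<le> G e)"
  unfolding abs_le_iff by (intro arith_conj arith_qle qdef_uminus)

lemma h_pos [simp]: "0 < h a" "0 \<le> h a"
  using p2_pos[of a] by (auto simp: h_def less_imp_le)

lemma h_Suc [simp]: "h (a + 1) = h a / 2"
  by (simp add: h_def)

lemma h_antimono: assumes "a \<le> b" shows "h b \<le> h a"
proof -
  obtain c where b: "b = a + c" using ex_diff[OF assms] by blast
  have "h (a + c) \<le> h a" for c
  proof (induction c rule: arith_induct)
    case 1 show ?case by (intro arith_qle qdef_h S_add S_const S_id)
  next
    case (3 c)
    then show ?case using h_pos(1)[of "a + c"] unfolding add.assoc[symmetric] h_Suc by linarith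
  qed simp
  then show ?thesis by (simp add: b)
qed

lemma less_p2: "a < p2 a"
proof (induction a rule: arith_induct)
  case 1 show ?case by (rule arith_less[OF S_id p2_S])
next
  case (3 a)
  then have "a + 1 < p2 a + 1" by simp
  also have "\<dots> \<le> p2 a + p2 a" using discrete[of "p2 a"] p2_pos[of a] by auto
  finally show ?case by simp
qed simp

lemma ex_fraction: "\<exists>a b d. 0 < d \<and> q = (emb a - emb (b :: 'n)) / emb d"
proof -
  have key: "\<exists>a b d. 0 < d \<and> Fract x y = (emb a - emb (b :: 'n)) / emb d" if "0 < y" for x y
  proof -
    obtain a b where x: "x = gemb a - gemb b" by (rule gint_cases)
    obtain c d where y: "y = gemb c - gemb d" by (rule gint_cases)
    have "d < c" using that unfolding y by (simp add: gemb_simps not_le[symmetric])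
    then have "y = gemb (c - d)" using gemb_simps(3)[of "c - d" d] by (simp add: y)
    moreover have "0 < c - d" 
      using \<open>d < c\<close> nonneg[of "c - d"] le_add_diff_inverse2[of d c]
      by (metis add_0 less_imp_le less_le)
    moreover have "Fract (gemb a - gemb b) (gemb e) = (emb a - emb b) / emb e" for e
      by (simp add: emb_def)
    ultimately show ?thesis using x by blast
  qed
  obtain x y where q: "q = Fract x y" "y \<noteq> 0" by (cases q)
  show ?thesis
  proof (cases "0 < y")
    case True then show ?thesis using key q by simp
  next
    case False
    then have "Fract x y = Fract (- x) (- y)" "0 < - y" using q(2) by (auto simp: eq_fract)
    then show ?thesis using key q by metis
  qed
qed

lemma ex_rat: "\<exists>c. rat c = q"
proof -
  obtain a b d where q: "0 < d" "q = (emb a - emb b) / emb d" using ex_fraction by blast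
  then have "1 \<le> d" using discrete[of d] by auto
  then have "rat (pr (pr a b) (d - 1)) = q" using q by (simp add: rat_def emb_diff)
  then show ?thesis by blast
qed

text \<open>Relative to the numbers of the model the field is Archimedean, whatever its relation to
  the standard naturals: a positive fraction with denominator \<open>d\<close> is at least
  \<open>1 / emb d\<close>, and \<open>h d\<close> is smaller because
  \<open>d < p2 d\<close>.\<close>

lemma ex_h_less: assumes "0 < q" shows "\<exists>n. h n < q"
proof -
  obtain a b d where q: "0 < d" "q = (emb a - emb b) / emb d" using ex_fraction by blast
  then have ba: "b < a" using assms emb_simps(7)[of d 0] by (auto simp: zero_less_divide_iff)
  then obtain c where c: "a = b + c" "c \<noteq> 0" using ex_diff[OF less_imp_le[OF ba]] ba by auto
  then have "1 \<le> c" using discrete[of c] by simp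
  then have "emb 1 \<le> emb c" by (simp only: emb_simps(5))
  then have "1 / emb d \<le> q" using q c by (simp add: divide_right_mono less_imp_le)
  moreover have "h d < 1 / emb d" using less_p2[of d] q(1) p2_pos[of d] by (simp add: h_def frac_less2)
  ultimately show ?thesis by (meson less_le_trans)
qed

lemma ex_h_less_above: assumes "0 < q" shows "\<exists>n\<ge>m. h n < q"
proof -
  obtain n where "h n < q" using ex_h_less[OF assms] by blast
  then show ?thesis using h_antimono[of n "max m n"] by (intro exI[of _ "max m n"]) auto
qed

text \<open>\<open>choice\<close> selects the next state as a function of stage and state, and
  \<open>prim_rec\<close> iterates the selection. The selection has to be total, so the condition is
  made vacuous where \<open>I\<close> fails; induction on the arithmetical predicate
  \<open>I\<close> shows that this never happens along \<open>R\<close>.\<close>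

lemma dependent_choice:
  assumes "arith I" "arith (\<lambda>w. St (fs (fs w)) (sn (fs w)) (sn w))"
    and "I c" "\<And>i z. I z \<Longrightarrow> \<exists>z'. I z' \<and> St i z z'"
  shows "\<exists>R\<in>S. R 0 = c \<and> (\<forall>i. I (R i) \<and> St i (R i) (R (i + 1)))"
proof -
  have "arith (\<lambda>w. I (sn (fs w)) \<longrightarrow> I (sn w) \<and> St (fs (fs w)) (sn (fs w)) (sn w))"
    by (intro arith_imp arith_conj assms(2) arith_subst[OF assms(1)] S_fs S_sn S_id)
  then obtain F where F: "F \<in> S"
    "\<And>w. (I (sn (fs w)) \<longrightarrow> I (sn w) \<and> St (fs (fs w)) (sn (fs w)) (sn w)) \<longleftrightarrow> F w = 0"
    unfolding arith_def by blast
  have "\<forall>e. \<exists>x. F (pr e x) = 0"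
    unfolding F(2)[symmetric] using assms(4) by simp
  then obtain G where G: "G \<in> S" "\<And>e. F (pr e (G e)) = 0" using choice[OF F(1)] by blast
  obtain R where R: "R \<in> S" "R 0 = c" "\<And>i. R (i + 1) = G (pr i (R i))" using prim_rec[OF G(1)] by blast
  have step: "I (R i) \<Longrightarrow> I (R (i + 1)) \<and> St i (R i) (R (i + 1))" for i
    using G(2)[of "pr i (R i)"] unfolding F(2)[symmetric] R(3) by simp
  have "I (R i)" for i
    by (induction i rule: arith_induct) (use R step assms(3) arith_subst[OF assms(1)] in auto)
  then show ?thesis using R(1,2) step by blast
qed

section \<open>Reals as fast converging sequences, and estimates of their distance\<close>

text \<open>\<open>dle x y q\<close> means that the reals coded by \<open>x\<close> and \<open>y\<close> have distance at most \<open>q\<close>.\<close>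

definition dle :: "('n \<Rightarrow> 'n) \<Rightarrow> ('n \<Rightarrow> 'n) \<Rightarrow> 'n qnum \<Rightarrow> bool" where
  "dle x y q \<longleftrightarrow> (\<forall>n. \<bar>rat (x n) - rat (y n)\<bar> \<le> q + 2 * h n)"

definition real :: "('n \<Rightarrow> 'n) \<Rightarrow> bool" where
  "real x \<longleftrightarrow> x \<in> S \<and> (\<forall>n i. \<bar>rat (x n) - rat (x (n + i))\<bar> < h n)"

text \<open>The two bounds are the negations of \<open>x < 0\<close> and \<open>1 < x\<close> for
  coded reals, read stage by stage; this is where the margin \<open>2 * h n\<close> comes
  from.\<close>

definition unit :: "('n \<Rightarrow> 'n) \<Rightarrow> bool" where
  "unit x \<longleftrightarrow> real x \<and> (\<forall>n. - (2 * h n) \<le> rat (x n) \<and> rat (x n) \<le> 1 + 2 * h n)"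

lemma realD: "real x \<Longrightarrow> m \<le> n \<Longrightarrow> \<bar>rat (x m) - rat (x n)\<bar> < h m"
  using ex_diff[of m n] unfolding real_def by blast

lemma dle_sym: "dle x y q \<Longrightarrow> dle y x q"
  unfolding dle_def by (simp add: abs_minus_commute)

lemma dle_mono: "dle x y q \<Longrightarrow> q \<le> r \<Longrightarrow> dle x y r"
  unfolding dle_def by (meson add_right_mono order_trans)

text \<open>Closeness at arbitrarily late stages already gives closeness, because the sequences converge fast.\<close>

lemma dle_lateI:
  assumes "real x" "real y" "\<And>e. 0 < e \<Longrightarrow> \<exists>m. \<forall>n\<ge>m. \<bar>rat (x n) - rat (y n)\<bar> \<le> q + e"
  shows "dle x y q"
  unfolding dle_def
proof (intro allI, rule ccontr)
  fix n
  assume "\<not> \<bar>rat (x n) - rat (y n)\<bar> \<le> q + 2 * h n"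
  then have "0 < \<bar>rat (x n) - rat (y n)\<bar> - (q + 2 * h n)" (is "0 < ?e") by simp
  then obtain m where m: "\<forall>k\<ge>m. \<bar>rat (x k) - rat (y k)\<bar> \<le> q + ?e / 2"
    using assms(3)[of "?e / 2"] by auto
  define N where "N = max m n"
  have "\<bar>rat (x N) - rat (y N)\<bar> \<le> q + ?e / 2" using m by (simp add: N_def)
  moreover have "\<bar>rat (x n) - rat (x N)\<bar> < h n" "\<bar>rat (y n) - rat (y N)\<bar> < h n"
    using realD assms(1,2) by (simp_all add: N_def)
  ultimately show False using \<open>0 < ?e\<close> by (simp add: abs_if field_simps split: if_splits)
qed

lemma dle_late:
  assumes "dle x y q" "0 < e" shows "\<exists>m. \<forall>n\<ge>m. \<bar>rat (x n) - rat (y n)\<bar> \<le> q + e"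
proof -
  obtain m where m: "h m < e / 2" using ex_h_less[of "e / 2"] assms(2) by auto
  have "\<bar>rat (x n) - rat (y n)\<bar> \<le> q + e" if "n \<ge> m" for n
  proof -
    have "\<bar>rat (x n) - rat (y n)\<bar> \<le> q + 2 * h n" using assms(1) by (simp add: dle_def)
    moreover have "h n \<le> h m" using that by (rule h_antimono)
    ultimately show ?thesis using m by simp
  qed
  then show ?thesis by blast
qed

text \<open>Adding the two defining bounds at stage \<open>n\<close> would leave an error of
  \<open>4 * h n\<close>. At late stages the errors are arbitrarily small, and
  \<open>dle_lateI\<close> carries the bound back to all stages.\<close>

lemma dle_triangle:
  assumes "real x" "real z" "dle x y q" "dle y z r" shows "dle x z (q + r)"
proof (rule dle_lateI[OF assms(1,2)])
  fix e :: "'n qnum" assume e: "0 < e"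
  obtain m where m: "\<forall>n\<ge>m. \<bar>rat (x n) - rat (y n)\<bar> \<le> q + e / 2"
    using dle_late[OF assms(3), of "e / 2"] e by auto
  obtain m' where m': "\<forall>n\<ge>m'. \<bar>rat (y n) - rat (z n)\<bar> \<le> r + e / 2"
    using dle_late[OF assms(4), of "e / 2"] e by auto
  have "\<bar>rat (x n) - rat (z n)\<bar> \<le> q + r + e" if "n \<ge> max m m'" for n
  proof -
    have "\<bar>rat (x n) - rat (y n)\<bar> \<le> q + e / 2" "\<bar>rat (y n) - rat (z n)\<bar> \<le> r + e / 2"
      using m m' that by auto
    then show ?thesis by (simp add: abs_if field_simps split: if_splits)
  qed
  then show "\<exists>m. \<forall>n\<ge>m. \<bar>rat (x n) - rat (z n)\<bar> \<le> q + r + e" by blast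
qed

lemma dle_closed:
  assumes "\<And>e. 0 < e \<Longrightarrow> dle x y (q + e)" shows "dle x y q"
  unfolding dle_def
proof (rule allI, rule field_le_epsilon)
  fix n and e :: "'n qnum" assume "0 < e"
  then have "\<bar>rat (x n) - rat (y n)\<bar> \<le> q + e + 2 * h n" using assms[of e] by (simp add: dle_def)
  then show "\<bar>rat (x n) - rat (y n)\<bar> \<le> q + 2 * h n + e" by linarith
qed

abbreviation cst :: "'n \<Rightarrow> 'n \<Rightarrow> 'n" where "cst c \<equiv> (\<lambda>_. c)"

lemma real_cst: "real (cst c)"
  by (simp add: real_def S_const)

lemma dle_cst: "dle (cst c) (cst d) q \<longleftrightarrow> \<bar>rat c - rat d\<bar> \<le> q"
proof
  assume d: "dle (cst c) (cst d) q"
  show "\<bar>rat c - rat d\<bar> \<le> q"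
  proof (rule field_le_epsilon)
    fix e :: "'n qnum" assume "0 < e"
    then show "\<bar>rat c - rat d\<bar> \<le> q + e" using dle_late[OF d, of e] by auto
  qed
next
  assume "\<bar>rat c - rat d\<bar> \<le> q"
  then show "dle (cst c) (cst d) q" unfolding dle_def using h_pos(2)
    by (metis add_increasing2 mult_nonneg_nonneg zero_le_numeral)
qed

lemma unit_cst: "0 \<le> rat c \<Longrightarrow> rat c \<le> 1 \<Longrightarrow> unit (cst c)"
  unfolding unit_def
proof (intro conjI allI real_cst)
  fix n assume "0 \<le> rat c" "rat c \<le> 1"
  then show "- (2 * h n) \<le> rat c" "rat c \<le> 1 + 2 * h n" using h_pos(2)[of n] by linarith+
qed

lemma dle_approx: assumes "real x" shows "dle x (cst (x n)) (h n)"
proof (rule dle_lateI[OF assms real_cst])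
  fix e :: "'n qnum" assume "0 < e"
  then show "\<exists>m. \<forall>k\<ge>m. \<bar>rat (x k) - rat (x n)\<bar> \<le> h n + e"
  proof (intro exI[of _ n] allI impI)
    fix k assume "n \<le> k"
    then have "\<bar>rat (x n) - rat (x k)\<bar> < h n" by (rule realD[OF assms])
    then show "\<bar>rat (x k) - rat (x n)\<bar> \<le> h n + e" using \<open>0 < e\<close> by (simp add: abs_minus_commute)
  qed
qed

lemma unit_approx:
  assumes "unit x" "0 < q" shows "\<exists>r. 0 \<le> rat r \<and> rat r \<le> 1 \<and> dle x (cst r) q"
proof -
  \<comment> \<open>The approximation \<open>x n\<close> is within \<open>h n\<close> of
    \<open>x\<close>, and clamping it to the unit interval moves it by at most
    \<open>2 * h n\<close>; hence the third of \<open>q\<close>.\<close>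
  obtain n where n: "h n < q / 3" using ex_h_less[of "q / 3"] assms(2) by auto
  obtain r where r: "rat r = max 0 (min 1 (rat (x n)))" using ex_rat by blast
  have x: "real x" "- (2 * h n) \<le> rat (x n)" "rat (x n) \<le> 1 + 2 * h n"
    using assms(1) by (auto simp: unit_def)
  have "\<bar>rat (x n) - rat r\<bar> \<le> 2 * h n" using x h_pos(2)[of n] unfolding r by (auto simp: max_def min_def abs_if)
  then have "dle x (cst r) (h n + 2 * h n)"
    using dle_approx[OF x(1), of n] by (intro dle_triangle[OF x(1) real_cst]) (auto simp: dle_cst)
  then have "dle x (cst r) q" by (rule dle_mono) (use n in simp)
  moreover have "0 \<le> rat r" "rat r \<le> 1" unfolding r by auto
  ultimately show ?thesis by blast
qed

lemma Suc_le: "(a :: 'n) + 1 \<le> b \<longleftrightarrow> a < b"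
  using less_Suc[of b a] by (simp add: not_less[symmetric])

section \<open>Balls with rational centres, and the common point of nested balls\<close>

definition centre_ok :: "'n \<Rightarrow> bool" where
  "centre_ok z \<longleftrightarrow> 0 \<le> rat (fs z) \<and> rat (fs z) \<le> 1"

text \<open>A number \<open>z\<close> codes the closed ball with centre \<open>rat (fs z)\<close> and radius \<open>h (sn z)\<close>.\<close>

definition mem :: "'n \<Rightarrow> 'n \<Rightarrow> bool" where
  "mem z r \<longleftrightarrow> \<bar>rat r - rat (fs z)\<bar> \<le> h (sn z) \<and> 0 \<le> rat r \<and> rat r \<le> 1"

text \<open>Containment of balls would need the inner radius only once. Subtracting it twice leaves
  room for every rational point within the inner radius of some point of the inner ball, as
  \<open>near_in_ball\<close> requires. The strict increase of the exponent forces the radii to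
  shrink.\<close>

definition nest :: "'n \<Rightarrow> 'n \<Rightarrow> bool" where
  "nest z z' \<longleftrightarrow> \<bar>rat (fs z) - rat (fs z')\<bar> \<le> h (sn z) - 2 * h (sn z') \<and> sn z < sn z'"

lemma nested_limit:
  assumes R: "R \<in> S" and c: "\<And>i. centre_ok (R i)" and n: "\<And>i. nest (R i) (R (i + 1))"
  obtains x where "unit x" "\<And>i. dle x (cst (fs (R i))) (h (sn (R i)))"
proof -
  define c where "c i = rat (fs (R i))" for i
  define k where "k i = sn (R i)" for i
  have step: "\<bar>c i - c (i + 1)\<bar> \<le> h (k i) - 2 * h (k (i + 1))" "k i < k (i + 1)" for i
    using n[of i] by (auto simp: nest_def c_def k_def)
  \<comment> \<open>The exponents increase strictly, hence dominate the index; this yields the rate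
    of convergence that a coded real must have.\<close>
  have ki: "i \<le> k i" for i
  proof (induction i rule: arith_induct)
    case 1 show ?case unfolding k_def by (intro arith_le S_id S_sn R)
  next
    case (3 i)
    then show ?case using step(2)[of i] by (simp add: Suc_le)
  qed (rule nonneg)
  \<comment> \<open>The bound telescopes: a further step costs at most
    \<open>h (k (i + j)) - 2 * h (k (i + j + 1))\<close>, which is below the difference of the two
    consecutive radii.\<close>
  have near: "\<bar>c i - c (i + j)\<bar> \<le> h (k i) - h (k (i + j))" for i j
  proof (induction j rule: arith_induct)
    case 1 show ?case unfolding k_def c_def
      by (intro arith_abs_le qdef_diff qdef_rat qdef_h S_fs S_sn S_const S_comp[OF R] S_add S_id)
  next
    case (3 j)
    then show ?case using step(1)[of "i + j"] h_pos(1)[of "k (i + j + 1)"]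
      unfolding add.assoc[symmetric] abs_le_iff by (elim conjE, intro conjI; linarith)
  qed simp
  have near': "\<bar>c i - c j\<bar> < h (k i)" "h (k i) \<le> h i" if ij: "i \<le> j" for i j
  proof -
    obtain l where l: "j = i + l" using ex_diff[OF ij] by blast
    show "\<bar>c i - c j\<bar> < h (k i)" using near[of i l] h_pos(1)[of "k j"] unfolding l by linarith
    show "h (k i) \<le> h i" using ki by (rule h_antimono)
  qed
  define x where "x n = fs (R (n + 1))" for n
  have rx: "rat (x n) = c (n + 1)" for n by (simp add: x_def c_def)
  have half: "h (n + 1) < h n" for n using h_pos(1)[of n] by simp
  have "x \<in> S" unfolding x_def by (intro S_fs S_comp[OF R] S_add S_id S_const)
  moreover have "\<bar>rat (x n) - rat (x (n + i))\<bar> < h n" for n i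
    using near'[of "n + 1" "n + i + 1"] half[of n] nonneg[of i] unfolding rx by simp
  ultimately have rl: "real x" by (simp add: real_def)
  have ux: "unit x" unfolding unit_def
  proof (intro conjI allI rl)
    fix n
    show "- (2 * h n) \<le> rat (x n)" "rat (x n) \<le> 1 + 2 * h n"
      using assms(2)[of "n + 1"] h_pos(2)[of n] unfolding centre_ok_def rx c_def by linarith+
  qed
  have "dle x (cst (fs (R i))) (h (sn (R i)))" for i
    unfolding dle_def c_def[symmetric] k_def[symmetric] rx
  proof
    fix n
    show "\<bar>c (n + 1) - c i\<bar> \<le> h (k i) + 2 * h n"
    proof (cases "i \<le> n + 1")
      case True
      show ?thesis using near'(1)[OF True] h_pos(1)[of n] abs_minus_commute[of "c i" "c (n + 1)"] by linarith
    next
      case False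
      then have le: "n + 1 \<le> i" by simp
      show ?thesis using near'[OF le] half[of n] h_pos(1)[of n] h_pos(1)[of "k i"] by linarith
    qed
  qed
  with ux that show ?thesis by blast
qed

lemma near_in_ball:
  assumes "real x" "dle x (cst (fs z')) (h (sn z'))" "nest z z'" "dle x (cst r) (h (sn z'))"
    and "0 \<le> rat r" "rat r \<le> 1"
  shows "mem z r"
proof -
  have "dle (cst r) (cst (fs z')) (h (sn z') + h (sn z'))"
    using assms real_cst by (intro dle_triangle[of _ _ x]) (auto intro: dle_sym)
  then have "\<bar>rat r - rat (fs z')\<bar> \<le> h (sn z') + h (sn z')" by (simp add: dle_cst)
  then show ?thesis using assms unfolding mem_def nest_def by (simp add: abs_le_iff)
qed

text \<open>Tolerances are rational and the comparison is the non-strict \<open>dle\<close>;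
  \<open>tr_continuous_at\<close> reconciles this with the real tolerances and strict order of
  \<open>continuous_at\<close>.\<close>

definition cont :: "(('n \<Rightarrow> 'n) \<Rightarrow> 'n \<Rightarrow> 'n) \<Rightarrow> ('n \<Rightarrow> 'n) \<Rightarrow> bool" where
  "cont f x \<longleftrightarrow> (\<forall>q>0. \<exists>p>0. \<forall>y. unit y \<longrightarrow> dle x y p \<longrightarrow> dle (f x) (f y) q)"

lemma qdef_2h: "G \<in> S \<Longrightarrow> qdef (\<lambda>e. 2 * h (G e))"
  unfolding mult_2 by (intro qdef_add qdef_h)

lemma qdef_const: "qdef (\<lambda>_. 0)" "qdef (\<lambda>_. 1)"
  using qdef_const_emb[of 0] qdef_const_emb[of 1] by simp_all

lemma arith_centre_ok: "Z \<in> S \<Longrightarrow> arith (\<lambda>e. centre_ok (Z e))"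
  unfolding centre_ok_def by (intro arith_conj arith_qle qdef_const qdef_rat S_fs)

lemma arith_mem: "Z \<in> S \<Longrightarrow> G \<in> S \<Longrightarrow> arith (\<lambda>e. mem (Z e) (G e))"
  unfolding mem_def
  by (intro arith_conj arith_qle arith_abs_le qdef_const qdef_diff qdef_h qdef_rat S_fs S_sn)

lemma arith_nest: "Z \<in> S \<Longrightarrow> G \<in> S \<Longrightarrow> arith (\<lambda>e. nest (Z e) (G e))"
  unfolding nest_def
  by (intro arith_conj arith_less arith_abs_le qdef_diff qdef_h qdef_2h qdef_rat S_fs S_sn)

end

text \<open>\<open>F_S\<close> concerns constant sequences as arguments, that is, rational points,
  but uniformly in the index; this makes comparisons of the \<open>F m\<close> at rational points
  arithmetical. The limit \<open>f\<close> is reached through \<open>F_conv\<close> alone, at a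
  point that is already given.\<close>

locale convergent_sequence = aca_functions +
  fixes F :: "'a \<Rightarrow> ('a \<Rightarrow> 'a) \<Rightarrow> 'a \<Rightarrow> 'a" and f :: "('a \<Rightarrow> 'a) \<Rightarrow> 'a \<Rightarrow> 'a"
  assumes F_S: "M \<in> S \<Longrightarrow> G \<in> S \<Longrightarrow> J \<in> S \<Longrightarrow> (\<lambda>e. F (M e) (cst (G e)) (J e)) \<in> S"
    and F_real: "unit x \<Longrightarrow> real (F n x)" and f_real: "unit x \<Longrightarrow> real (f x)"
    and F_cont: "unit x \<Longrightarrow> cont (F n) x"
    and F_conv: "unit x \<Longrightarrow> 0 < q \<Longrightarrow> \<exists>m. \<forall>n\<ge>m. dle (F n x) (f x) q"
begin

section \<open>The category argument\<close>

abbreviation Fr :: "'a \<Rightarrow> 'a \<Rightarrow> 'a \<Rightarrow> 'a" where "Fr m r \<equiv> F m (cst r)"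

definition settled :: "'a \<Rightarrow> 'a \<Rightarrow> 'a \<Rightarrow> bool" where
  "settled z n p \<longleftrightarrow> (\<forall>m. n \<le> m \<longrightarrow> (\<forall>r s. mem z r \<longrightarrow> mem z s \<longrightarrow> dle (Fr m r) (Fr n s) (h p)))"

lemma arith_dle:
  assumes "M \<in> S" "G \<in> S" "N \<in> S" "H \<in> S" "qdef Q"
  shows "arith (\<lambda>e. dle (Fr (M e) (G e)) (Fr (N e) (H e)) (Q e))"
proof -
  have q: "qdef (\<lambda>z. Q (fs z))"
    using assms(5) unfolding qdef_def by (auto intro!: S_comp[OF _ fs_S] bexI)
  show ?thesis unfolding dle_def
    by (intro arith_all arith_abs_le qdef_diff qdef_rat qdef_add q qdef_2h F_S S_fs S_sn S_id
        S_comp[OF assms(1)] S_comp[OF assms(2)] S_comp[OF assms(3)] S_comp[OF assms(4)])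
qed

lemma arith_settled:
  assumes "Z \<in> S" "N \<in> S" "P \<in> S" shows "arith (\<lambda>e. settled (Z e) (N e) (P e))"
  unfolding settled_def
  by (intro arith_all arith_imp arith_le arith_mem arith_dle qdef_h S_fs S_sn S_id
      S_comp[OF assms(1)] S_comp[OF assms(2)] S_comp[OF assms(3)])

lemma contE:
  assumes "unit x" "0 < q"
  obtains p where "0 < p" "\<And>y. unit y \<Longrightarrow> dle x y p \<Longrightarrow> dle (F n x) (F n y) q"
  using F_cont[OF assms(1), of n] assms(2) unfolding cont_def by blast

lemma dle_chain:
  assumes "real a" "real c" "real d" "dle a b q" "dle b c r" "dle c d s" "q + r + s \<le> t"
  shows "dle a d t"
  by (rule dle_mono[OF dle_triangle[OF assms(1,3) dle_triangle[OF assms(1,2,4,5)] assms(6)] assms(7)])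

text \<open>This is one stage in the construction of a point of divergence. The conditions on
  \<open>z\<close> are weaker than \<open>nest z0 z\<close> so that \<open>z0\<close> itself can be
  the first ball.\<close>

lemma ex_disagreement:
  assumes none: "\<And>n z'. centre_ok z' \<Longrightarrow> nest z0 z' \<Longrightarrow> \<not> settled z' n p"
    and z: "centre_ok z" "\<bar>rat (fs z0) - rat (fs z)\<bar> \<le> h (sn z0) - h (sn z)" "sn z0 \<le> sn z"
  shows "\<exists>z'. (centre_ok z' \<and> \<bar>rat (fs z0) - rat (fs z')\<bar> \<le> h (sn z0) - h (sn z') \<and> sn z0 \<le> sn z') \<and>
    nest z z' \<and> (\<exists>m. i \<le> m \<and> (\<forall>r. mem z' r \<longrightarrow> \<not> dle (Fr m r) (Fr i r) (h (p + 1 + 1))))"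
proof -
  let ?q = "h p / 8"
  have q: "0 < ?q" by simp
  define c where "c = fs z"
  define k where "k = sn z"
  have uc: "unit (cst c)" using z by (intro unit_cst) (auto simp: centre_ok_def c_def)
  obtain d where d: "0 < d" "\<And>y. unit y \<Longrightarrow> dle (cst c) y d \<Longrightarrow> dle (Fr i c) (F i y) ?q"
    using contE[OF uc q] by blast
  \<comment> \<open>The radius is chosen so that on a concentric ball \<open>F i\<close> stays
    within an eighth of \<open>h p\<close> of its value at the centre. The exponent exceeds
    \<open>k\<close>, which makes this ball nested in \<open>z0\<close>.\<close>
  obtain j where j: "k + 1 \<le> j" "h j < d" using ex_h_less_above[OF d(1)] by blast
  have kj: "2 * h j \<le> h k" using h_antimono[OF j(1)] by simp
  define z1 where "z1 = pr c j"
  have z1: "fs z1 = c" "sn z1 = j" by (simp_all add: z1_def)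
  have "centre_ok z1" "nest z0 z1"
    using z kj j(1) h_pos(1)[of j] by (auto simp: centre_ok_def nest_def z1 c_def k_def Suc_le)
  then have "\<not> settled z1 i p" by (rule none)
  then obtain m r s where m: "i \<le> m" and rs: "mem z1 r" "mem z1 s"
    and nd: "\<not> dle (Fr m r) (Fr i s) (h p)" unfolding settled_def by blast
  have ur: "unit (cst r)" and us: "unit (cst s)" using rs by (auto intro!: unit_cst simp: mem_def)
  have dr: "dle (Fr i c) (Fr i r) ?q" and ds: "dle (Fr i c) (Fr i s) ?q"
    using rs j(2) by (auto intro!: d(2) ur us simp: dle_cst mem_def z1 abs_minus_commute)
  \<comment> \<open>Moving the second point from \<open>s\<close> to \<open>r\<close> by way of the
    centre costs two eighths of \<open>h p\<close>, so a disagreement above \<open>h p / 2\<close>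
    remains at the single point \<open>r\<close>.\<close>
  have nd2: "\<not> dle (Fr m r) (Fr i r) (h p / 2)"
  proof
    assume "dle (Fr m r) (Fr i r) (h p / 2)"
    then have "dle (Fr m r) (Fr i s) (h p)"
      using dle_sym[OF dr] ds by (rule dle_chain[OF F_real F_real F_real, OF ur uc us]) simp
    then show False using nd by simp
  qed
  \<comment> \<open>Continuity of \<open>F m\<close> and \<open>F i\<close> at \<open>r\<close>
    spreads the disagreement over a whole ball. Two further eighths are lost, which leaves
    \<open>h p / 4\<close>, that is, \<open>h (p + 1 + 1)\<close>.\<close>
  obtain d1 where d1: "0 < d1" "\<And>y. unit y \<Longrightarrow> dle (cst r) y d1 \<Longrightarrow> dle (Fr m r) (F m y) ?q"
    using contE[OF ur q] by blast
  obtain d2 where d2: "0 < d2" "\<And>y. unit y \<Longrightarrow> dle (cst r) y d2 \<Longrightarrow> dle (Fr i r) (F i y) ?q"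
    using contE[OF ur q] by blast
  obtain l where l: "j + 1 \<le> l" "h l < min d1 d2"
    using ex_h_less_above[of "min d1 d2"] d1(1) d2(1) by auto
  have jl: "2 * h l \<le> h j" using h_antimono[OF l(1)] by simp
  define z' where "z' = pr r l"
  have z': "fs z' = r" "sn z' = l" by (simp_all add: z'_def)
  have rc: "\<bar>rat r - rat c\<bar> \<le> h j" "0 \<le> rat r" "rat r \<le> 1" using rs by (auto simp: mem_def z1)
  have kjl: "k < j" "j < l" using j(1) l(1) by (auto simp: Suc_le)
  have "\<not> dle (Fr m t) (Fr i t) (h (p + 1 + 1))" if t: "mem z' t" for t
  proof
    assume a: "dle (Fr m t) (Fr i t) (h (p + 1 + 1))"
    have ut: "unit (cst t)" using t by (auto intro!: unit_cst simp: mem_def)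
    have rt: "dle (cst r) (cst t) d1" "dle (cst r) (cst t) d2"
      using t l by (auto simp: dle_cst mem_def z' abs_minus_commute)
    have "dle (Fr m r) (Fr i r) (h p / 2)"
      using d1(2)[OF ut rt(1)] a dle_sym[OF d2(2)[OF ut rt(2)]]
      by (rule dle_chain[OF F_real F_real F_real, OF ur ut ur]) simp
    then show False using nd2 by simp
  qed
  moreover have "centre_ok z'" using rc by (simp add: centre_ok_def z')
  moreover have "nest z z'"
    using rc kj jl kjl by (auto simp: nest_def z' c_def k_def abs_minus_commute)
  moreover have "\<bar>rat (fs z0) - rat (fs z')\<bar> \<le> h (sn z0) - h (sn z')"
    using z(2) rc(1) kj jl h_pos(1)[of l] unfolding z' c_def[symmetric] k_def[symmetric]
    by (simp add: abs_le_iff)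
  moreover have "sn z0 \<le> sn z'" using z(3) kjl by (simp add: z' k_def)
  ultimately show ?thesis using m by blast
qed

lemma ex_settled:
  assumes z0: "centre_ok z0"
  shows "\<exists>z'. centre_ok z' \<and> nest z0 z' \<and> (\<exists>n. settled z' n p)"
proof (rule ccontr)
  assume none: "\<not> ?thesis"
  define I where "I z \<longleftrightarrow> centre_ok z \<and> \<bar>rat (fs z0) - rat (fs z)\<bar> \<le> h (sn z0) - h (sn z) \<and> sn z0 \<le> sn z"
    for z
  define St where "St i z z' \<longleftrightarrow> nest z z' \<and>
    (\<exists>m. i \<le> m \<and> (\<forall>r. mem z' r \<longrightarrow> \<not> dle (Fr m r) (Fr i r) (h (p + 1 + 1))))" for i z z'
  have "arith I" unfolding I_def
    by (intro arith_conj arith_centre_ok arith_abs_le arith_le qdef_diff qdef_rat qdef_h S_fs S_sn S_const S_id)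
  moreover have "arith (\<lambda>w. St (fs (fs w)) (sn (fs w)) (sn w))" unfolding St_def
    by (intro arith_conj arith_nest arith_ex arith_all arith_imp arith_not arith_le arith_mem arith_dle
        qdef_h S_fs S_sn S_const S_id)
  moreover have "I z0" using z0 by (simp add: I_def)
  moreover have "\<exists>z'. I z' \<and> St i z z'" if "I z" for i z
    unfolding I_def St_def by (rule ex_disagreement) (use that none in \<open>auto simp: I_def\<close>)
  ultimately obtain R where R: "R \<in> S" "\<And>i. I (R i) \<and> St i (R i) (R (i + 1))"
    using dependent_choice by blast
  obtain x where x: "unit x" "\<And>i. dle x (cst (fs (R i))) (h (sn (R i)))"
    by (rule nested_limit[OF R(1)]) (use R(2) in \<open>auto simp: I_def St_def\<close>)
  \<comment> \<open>Four errors of a sixteenth add up to \<open>h (p + 1 + 1)\<close>: two for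
    comparing \<open>F m x\<close> and \<open>F i x\<close> with \<open>f x\<close>, and one for
    each passage between \<open>x\<close> and a rational point.\<close>
  let ?q = "h p / 16"
  have q: "0 < ?q" by simp
  obtain i where i: "\<And>n. n \<ge> i \<Longrightarrow> dle (F n x) (f x) ?q" using F_conv[OF x(1) q] by blast
  obtain m where m: "i \<le> m" "\<And>r. mem (R (i + 1)) r \<Longrightarrow> \<not> dle (Fr m r) (Fr i r) (h (p + 1 + 1))"
    using R(2)[of i] unfolding St_def by blast
  obtain d1 where d1: "0 < d1" "\<And>y. unit y \<Longrightarrow> dle x y d1 \<Longrightarrow> dle (F m x) (F m y) ?q"
    using contE[OF x(1) q] by blast
  obtain d2 where d2: "0 < d2" "\<And>y. unit y \<Longrightarrow> dle x y d2 \<Longrightarrow> dle (F i x) (F i y) ?q"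
    using contE[OF x(1) q] by blast
  \<comment> \<open>A rational point within the radius of the ball at stage \<open>i + 1 + 1\<close>
    of \<open>x\<close> lies in the ball at stage \<open>i + 1\<close>, by the margin built into
    \<open>nest\<close>.\<close>
  define d3 where "d3 = h (sn (R (i + 1 + 1)))"
  obtain r where r: "0 \<le> rat r" "rat r \<le> 1" "dle x (cst r) (min d1 (min d2 d3))"
    using unit_approx[OF x(1), of "min d1 (min d2 d3)"] d1(1) d2(1) by (auto simp: d3_def)
  have ur: "unit (cst r)" using r by (intro unit_cst)
  have "mem (R (i + 1)) r"
    by (rule near_in_ball[of x "R (i + 1 + 1)"])
      (use x r R(2)[of "i + 1"] in \<open>auto simp: unit_def St_def d3_def elim: dle_mono\<close>)
  moreover have "dle (Fr m r) (Fr i r) (h (p + 1 + 1))"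
  proof (rule dle_chain)
    show "dle (Fr m r) (F m x) ?q" using r by (intro dle_sym[OF d1(2)] ur) (auto elim: dle_mono)
    show "dle (F m x) (F i x) (?q + ?q)"
      using i[OF m(1)] dle_sym[OF i[of i]] F_real x(1) by (intro dle_triangle) auto
    show "dle (F i x) (Fr i r) ?q" using r by (intro d2(2) ur) (auto elim: dle_mono)
  qed (use F_real ur x(1) in auto)
  ultimately show False using m(2) by blast
qed

theorem ex_continuity_point: "\<exists>x. unit x \<and> cont f x"
proof -
  define St where "St i z z' \<longleftrightarrow> nest z z' \<and> (\<exists>n. settled z' n i)" for i z z'
  obtain c where c: "rat c = 0" using ex_rat by blast
  have "arith (\<lambda>w. St (fs (fs w)) (sn (fs w)) (sn w))" unfolding St_def
    by (intro arith_conj arith_nest arith_ex arith_settled S_fs S_sn S_const S_id)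
  moreover have "arith centre_ok" using arith_centre_ok[OF S_id] by simp
  moreover have "centre_ok (pr c 0)" using c by (simp add: centre_ok_def)
  moreover have "\<exists>z'. centre_ok z' \<and> St i z z'" if "centre_ok z" for i z
    using ex_settled[OF that] by (simp add: St_def)
  ultimately obtain R where R: "R \<in> S" "\<And>i. centre_ok (R i) \<and> St i (R i) (R (i + 1))"
    using dependent_choice by blast
  obtain x where x: "unit x" "\<And>i. dle x (cst (fs (R i))) (h (sn (R i)))"
    by (rule nested_limit[OF R(1)]) (use R(2) in \<open>auto simp: St_def\<close>)
  have "\<exists>p>0. \<forall>y. unit y \<longrightarrow> dle x y p \<longrightarrow> dle (f x) (f y) q" if q: "0 < q" for q
  proof -
    \<comment> \<open>Half of \<open>q\<close> suffices because \<open>f x\<close> and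
      \<open>f y\<close> will both be compared with one fixed value.\<close>
    obtain i where i: "h i < q / 2" using ex_h_less[of "q / 2"] q by auto
    define z' where "z' = R (i + 1)"
    \<comment> \<open>The radius of the next ball is used in halves: one for the distance from
      \<open>x\<close> to \<open>y\<close>, one for that from \<open>y\<close> to a rational
      point.\<close>
    define d where "d = h (sn (R (i + 1 + 1)))"
    have d: "0 < d" by (simp add: d_def)
    obtain n where n: "settled z' n i" using R(2)[of i] by (auto simp: St_def z'_def)
    define c' where "c' = fs z'"
    have mc: "mem z' c'" using R(2)[of "i + 1"] by (simp add: mem_def c'_def z'_def centre_ok_def)
    then have uc: "unit (cst c')" by (intro unit_cst) (auto simp: mem_def)
    \<comment> \<open>Three moves lead from \<open>f y\<close> to the fixed value: to
      \<open>F m y\<close> for some large \<open>m\<close>, to \<open>F m\<close> at a rational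
      point near \<open>y\<close>, and from there by \<open>settled\<close>. The first two errors
      can be made arbitrarily small, so \<open>dle_closed\<close> removes them.\<close>
    have key: "dle (f y) (Fr n c') (h i)" if y: "unit y" "dle x y (d / 2)" for y
    proof (rule dle_closed)
      fix e :: "'a qnum" assume "0 < e"
      then have e: "0 < e / 2" by simp
      obtain m0 where m0: "\<And>m. m \<ge> m0 \<Longrightarrow> dle (F m y) (f y) (e / 2)" using F_conv[OF y(1) e] by blast
      define m where "m = max m0 n"
      obtain d1 where d1: "0 < d1" "\<And>w. unit w \<Longrightarrow> dle y w d1 \<Longrightarrow> dle (F m y) (F m w) (e / 2)"
        using contE[OF y(1) e] by blast
      obtain r where r: "0 \<le> rat r" "rat r \<le> 1" "dle y (cst r) (min d1 (d / 2))"
        using unit_approx[OF y(1), of "min d1 (d / 2)"] d1(1) d by auto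
      have ur: "unit (cst r)" using r by (intro unit_cst)
      have "dle x (cst r) (d / 2 + d / 2)"
        using x(1) y(2) real_cst dle_mono[OF r(3), of "d / 2"] by (intro dle_triangle[of x _ y]) (auto simp: unit_def)
      then have "mem z' r" unfolding z'_def
        by (intro near_in_ball[of x "R (i + 1 + 1)"])
          (use x r R(2)[of "i + 1"] in \<open>auto simp: unit_def St_def d_def\<close>)
      then have a1: "dle (Fr m r) (Fr n c') (h i)" using n mc unfolding settled_def m_def by simp
      have a2: "dle (f y) (F m y) (e / 2)" by (rule dle_sym, rule m0) (simp add: m_def)
      have a3: "dle (F m y) (Fr m r) (e / 2)" using r by (intro d1(2) ur) (auto elim: dle_mono)
      show "dle (f y) (Fr n c') (h i + e)"
        by (rule dle_chain[OF f_real[OF y(1)] F_real[OF ur] F_real[OF uc] a2 a3 a1]) simp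
    qed
    have "dle x x (d / 2)" using d by (simp add: dle_def)
    then have kx: "dle (f x) (Fr n c') (h i)" by (rule key[OF x(1)])
    have "dle (f x) (f y) q" if y: "unit y" "dle x y (d / 2)" for y
      by (rule dle_mono[OF dle_triangle[OF f_real f_real kx dle_sym[OF key]]]) (use x(1) y i in auto)
    then show ?thesis using d by (intro exI[of _ "d / 2"]) auto
  qed
  then show ?thesis using x(1) unfolding cont_def by blast
qed

end

section \<open>Coding in a model of \<open>ACA\<^sub>0\<^sup>\<omega>\<close>\<close>

lemma val_codes [simp]:
  "val A (pair_tm s t) = pair_tm (val A s) (val A t)"
  "val A (fst_tm s) = fst_tm (val A s)" "val A (snd_tm s) = snd_tm (val A s)"
  "val A (pos_part s) = pos_part (val A s)" "val A (neg_part s) = neg_part (val A s)"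
  "val A (denom s) = denom (val A s)"
  by (simp_all add: pair_tm_def fst_tm_def snd_tm_def pos_part_def neg_part_def denom_def)

lemma val_rat [simp]:
  "val A (mk_rat s t u) = mk_rat (val A s) (val A t) (val A u)"
  "val A (rat_add s t) = rat_add (val A s) (val A t)"
  "val A (rat_uminus s) = rat_uminus (val A s)"
  "val A (rat_sub s t) = rat_sub (val A s) (val A t)"
  "val A (rat_abs s) = rat_abs (val A s)"
  "val A (half_pow s) = half_pow (val A s)" "val A (two_half_pow s) = two_half_pow (val A s)"
  by (simp_all add: mk_rat_def rat_add_def rat_uminus_def rat_sub_def rat_abs_def half_pow_def two_half_pow_def)

lemma val_in_obj: "good A \<Longrightarrow> t \<in> obj \<sigma> \<Longrightarrow> val A t \<in> obj \<sigma>"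
  using val_obj[of A t] by (auto simp: obj_def)

lemma fresh_neq [simp]:
  assumes "Var j \<tau> \<in> set ts" shows "j \<noteq> fresh ts" "fresh ts \<noteq> j"
  using fresh_not_vars[OF assms, of \<tau>] by auto

locale ordered_model = num_model \<nu> "(<)" "(+)" "(*)" 0 1
  for \<nu> :: "tm \<Rightarrow> 'n :: linordered_semidom"
begin

lemma nn: "0 \<le> (a :: 'n)"
  using nonneg_and_difference(1)[of a] by (simp add: not_less)

lemma zero_or_one: "(a :: 'n) = 0 \<or> 1 \<le> a"
proof (induction a rule: qf_induct)
  case 1
  have "qf (\<lambda>a. a = 0 \<or> \<not> a < 1)" by (intro qf_disj qf_eq qf_not qf_lt S_id S_const)
  then show ?case by (simp add: not_less)
qed (use nn in auto)

lemma Suc_le': "(a :: 'n) + 1 \<le> b \<longleftrightarrow> a < b"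
proof
  show "a + 1 \<le> b \<Longrightarrow> a < b" by (meson less_add_one less_le_trans)
  assume "a < b"
  then obtain c where c: "b = a + c" using le_add_diff_inverse2[of a b] by (metis add.commute less_imp_le)
  then show "a + 1 \<le> b" using zero_or_one[of c] \<open>a < b\<close> by auto
qed

lemma mn_add: "b \<le> a \<Longrightarrow> mn a b + b = a"
  using nonneg_and_difference(2)[of a b] by (simp add: not_less)

lemma mn_eq: "mn a b = (if b \<le> a then a - b else 0)"
proof (cases "b \<le> a")
  case True
  then show ?thesis using mn_add[OF True] le_add_diff_inverse2[OF True] by (metis add_right_cancel)
next
  case False
  then obtain c where c: "b = a + c" using le_add_diff_inverse2[of a b] by (metis add.commute linear)
  have "mn a (a + c) = 0" for c
  proof (induction c rule: qf_induct)
    case 1 show ?case by (intro qf_eq S_mn S_pl S_const S_id)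
  next
    case 2 show ?case using mn_add[of a a] by simp
  next
    case (3 c) then show ?case by (simp add: add.assoc[symmetric] mn_simps pd_simps)
  qed
  with False c show ?thesis by simp
qed

lemma pd_pos: "0 < a \<Longrightarrow> pd a + 1 = a"
  using mn_simps(2)[of a 0] mn_simps(1)[of a] mn_add[of 1 a] zero_or_one[of a] by auto

section \<open>Triangular numbers and the Cantor pairing in the model\<close>

definition tr' where "tr' = fn (prim_rec (\<lambda>n m. m \<^bold>+ (n \<^bold>+ One)) Zero)"
definition p2 where "p2 = fn (prim_rec (\<lambda>n m. m \<^bold>+ m) One)"
definition dg where
  "dg = fn (prim_rec (\<lambda>n m. m \<^bold>+ (One \<^bold>- (tri (m \<^bold>+ One) \<^bold>- (n \<^bold>+ One)))) Zero)"

lemma nu_tri [simp]: "t \<in> obj Ty0 \<Longrightarrow> \<nu> (tri t) = tr' (\<nu> t)"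
  unfolding tr'_def tri_def by (rule fn_nu[symmetric]) auto

lemma nu_pow2 [simp]: "t \<in> obj Ty0 \<Longrightarrow> \<nu> (pow2 t) = p2 (\<nu> t)"
  unfolding p2_def pow2_def by (rule fn_nu[symmetric]) auto

lemma nu_diag [simp]: "t \<in> obj Ty0 \<Longrightarrow> \<nu> (diag t) = dg (\<nu> t)"
  unfolding dg_def diag_def by (rule fn_nu[symmetric]) auto

lemma tr'_simps: "tr' 0 = 0" "tr' (a + 1) = tr' a + (a + 1)"
proof -
  note r = nu_prim_rec[of "\<lambda>n m. m \<^bold>+ (n \<^bold>+ One)" Zero "rep a", folded tri_def]
  show "tr' 0 = 0" using r(1) nu_tri[of Zero] by simp
  have "tri (rep a) \<in> obj Ty0" by simp
  then show "tr' (a + 1) = tr' a + (a + 1)" using r(2) nu_tri[of "rep a \<^bold>+ One"] by simp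
qed

lemma p2_simps: "p2 0 = 1" "p2 (a + 1) = p2 a + p2 a"
proof -
  note r = nu_prim_rec[of "\<lambda>n m. m \<^bold>+ m" One "rep a", folded pow2_def]
  show "p2 0 = 1" using r(1) nu_pow2[of Zero] by simp
  have "pow2 (rep a) \<in> obj Ty0" by simp
  then show "p2 (a + 1) = p2 a + p2 a" using r(2) nu_pow2[of "rep a \<^bold>+ One"] by simp
qed

lemma dg_simps: "dg 0 = 0" "dg (a + 1) = dg a + mn 1 (mn (tr' (dg a + 1)) (a + 1))"
proof -
  note r = nu_prim_rec[of "\<lambda>n m. m \<^bold>+ (One \<^bold>- (tri (m \<^bold>+ One) \<^bold>- (n \<^bold>+ One)))" Zero "rep a", folded diag_def]
  show "dg 0 = 0" using r(1) nu_diag[of Zero] by simp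
  have "diag (rep a) \<in> obj Ty0" by simp
  then show "dg (a + 1) = dg a + mn 1 (mn (tr' (dg a + 1)) (a + 1))"
    using r(2) nu_diag[of "rep a \<^bold>+ One"] by simp
qed

lemma in_S: "tr' \<in> S" "p2 \<in> S" "dg \<in> S"
  unfolding tr'_def p2_def dg_def by (auto intro!: fn_in_S)

lemma tr'_mono: assumes "a \<le> b" shows "tr' a \<le> tr' b"
proof -
  obtain c where c: "b = a + c" using le_add_diff_inverse2[OF assms] by (metis add.commute)
  have "\<not> tr' (a + c) < tr' a" for c
  proof (induction c rule: qf_induct)
    case 1 show ?case by (intro qf_not qf_lt S_comp[OF in_S(1)] S_pl S_const S_id)
  next
    case (3 c)
    have "tr' (a + c) \<le> tr' (a + (c + 1))"
    proof -
      have "tr' (a + (c + 1)) = tr' (a + c) + (a + c + 1)" using tr'_simps(2)[of "a + c"] by (simp only: add.assoc)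
      then show ?thesis using nn[of "a + c + 1"] by (simp only: le_add_same_cancel1)
    qed
    with 3 show ?case by (simp add: not_less)
  qed simp
  then show ?thesis by (simp add: c not_less)
qed

text \<open>The increment \<open>mn 1 (mn ...)\<close> is 1 exactly when the next triangular number
  is at most \<open>a + 1\<close>. So \<open>dg\<close> passes to the next diagonal at the moment
  its first element is reached.\<close>

lemma dg_bounds: "tr' (dg a) \<le> a \<and> a < tr' (dg a + 1)"
proof (induction a rule: qf_induct)
  case 1
  have "qf (\<lambda>a. \<not> a < tr' (dg a) \<and> a < tr' (dg a + 1))"
    by (intro qf_conj qf_not qf_lt S_comp[OF in_S(1)] S_pl S_const S_id in_S(3))
  then show ?case by (simp add: not_less)
next
  case 2 show ?case using tr'_simps(2)[of 0] by (simp add: dg_simps tr'_simps(1))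
next
  case (3 a)
  show ?case
  proof (cases "tr' (dg a + 1) \<le> a + 1")
    case True
    then have e: "tr' (dg a + 1) = a + 1" using 3 by (intro antisym) (auto simp: Suc_le')
    have d: "dg (a + 1) = dg a + 1" unfolding dg_simps e by (simp add: mn_eq)
    have "a + 1 \<le> tr' (dg a + 1)" using 3 by (simp add: Suc_le')
    moreover have "tr' (dg a + 1) < tr' (dg a + 1 + 1)"
      using nn[of "dg a + 1"] by (simp only: tr'_simps(2)[of "dg a + 1"]) (simp add: add_nonneg_pos)
    ultimately show ?thesis using True unfolding d by (meson le_less_trans)
  next
    case False
    then have "a + 1 + 1 \<le> tr' (dg a + 1)" by (simp add: Suc_le')
    then have "1 \<le> tr' (dg a + 1) - (a + 1)" using False zero_or_one[of "tr' (dg a + 1) - (a + 1)"]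
        le_add_diff_inverse2[of "a + 1" "tr' (dg a + 1)"] by (metis add_0 less_imp_le not_le less_irrefl)
    then have d: "dg (a + 1) = dg a" using False by (auto simp: dg_simps mn_eq antisym)
    have "tr' (dg a) \<le> a + 1" using 3 by (meson less_add_one less_imp_le order_trans)
    then show ?thesis using False unfolding d by simp
  qed
qed

lemma dg_unique: assumes "tr' d \<le> a" "a < tr' (d + 1)" shows "dg a = d"
proof (rule antisym)
  show "dg a \<le> d"
  proof (rule ccontr)
    assume "\<not> dg a \<le> d"
    then have "tr' (d + 1) \<le> tr' (dg a)" by (intro tr'_mono) (simp add: Suc_le')
    then show False using assms dg_bounds[of a] by (meson leD le_less_trans less_le_trans)
  qed
  show "d \<le> dg a"
  proof (rule ccontr)
    assume "\<not> d \<le> dg a"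
    then have "tr' (dg a + 1) \<le> tr' d" by (intro tr'_mono) (simp add: Suc_le')
    then show False using assms dg_bounds[of a] by (meson leD le_less_trans less_le_trans)
  qed
qed

definition pr where "pr a b = tr' (a + b) + a"
definition fs where "fs a = mn a (tr' (dg a))"
definition sn where "sn a = mn (dg a) (fs a)"

lemma dg_pr: "dg (pr a b) = a + b"
proof (rule dg_unique)
  show "tr' (a + b) \<le> pr a b" using nn by (simp add: pr_def)
  have "a < a + b + 1" using nn[of b] by (meson add_increasing2 less_add_one order.strict_trans1 le_less_trans order_refl)
  then show "pr a b < tr' (a + b + 1)" by (simp add: pr_def tr'_simps)
qed

lemma pairing: "fs (pr a b) = a" "sn (pr a b) = b"
proof -
  have *: "mn (a + b) a = b" for a b using mn_add[of a "a + b"] nn[of b] by (simp add: add.commute)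
  show "fs (pr a b) = a" unfolding fs_def dg_pr by (simp add: pr_def *)
  then show "sn (pr a b) = b" by (simp add: sn_def dg_pr *)
qed

lemma nu_codes [simp]:
  "s \<in> obj Ty0 \<Longrightarrow> t \<in> obj Ty0 \<Longrightarrow> \<nu> (pair_tm s t) = pr (\<nu> s) (\<nu> t)"
  "s \<in> obj Ty0 \<Longrightarrow> \<nu> (fst_tm s) = fs (\<nu> s)" "s \<in> obj Ty0 \<Longrightarrow> \<nu> (snd_tm s) = sn (\<nu> s)"
  "s \<in> obj Ty0 \<Longrightarrow> \<nu> (pos_part s) = fs (fs (\<nu> s))" "s \<in> obj Ty0 \<Longrightarrow> \<nu> (neg_part s) = sn (fs (\<nu> s))"
  "s \<in> obj Ty0 \<Longrightarrow> \<nu> (denom s) = sn (\<nu> s) + 1"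
  by (simp_all add: pair_tm_def fst_tm_def snd_tm_def pos_part_def neg_part_def denom_def
      pr_def fs_def sn_def)

section \<open>Closure of the functions under slicing, recursion, quantification and search\<close>

lemma S_I_rep:
  assumes "t \<in> obj Ty0" "\<And>a. F a = \<nu> (val (\<iota>((k, Ty0) := rep a)) t)"
  shows "F \<in> S"
proof -
  have t: "wt t" "ty_of t = Ty0" using assms(1) by (auto simp: obj_def)
  note b = fn_abstr[OF good_id t, where k = k]
  have "fn (val \<iota> (abstr k Ty0 t)) = F"
    using b(2) assms(2) by (auto simp: fn_def)
  then show ?thesis using b(1) by (metis fn_in_S)
qed

lemma abstr_obj: "t \<in> obj \<tau> \<Longrightarrow> abstr k \<sigma> t \<in> obj (\<sigma> \<Rrightarrow> \<tau>)"
  by (simp add: obj_def)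

text \<open>The code \<open>slice u k s\<close> of the function \<open>n \<mapsto> u (s, n)\<close>.\<close>

definition slice :: "tm \<Rightarrow> nat \<Rightarrow> tm \<Rightarrow> tm" where
  "slice u k s = val (\<iota>((k, Ty0) := s)) (abstr (Suc k) Ty0 (u \<cdot> pair_tm (Var k Ty0) (Var (Suc k) Ty0)))"

lemma slice:
  assumes "u \<in> obj Ty1" "var_bound u \<le> k" "s \<in> obj Ty0"
  shows "slice u k s \<in> obj Ty1"
    and "n \<in> obj Ty0 \<Longrightarrow> \<nu> (slice u k s \<cdot> n) = fn u (pr (\<nu> s) (\<nu> n))"
proof -
  let ?t = "u \<cdot> pair_tm (Var k Ty0) (Var (Suc k) Ty0)"
  have t: "?t \<in> obj Ty0" using assms by simp
  then have t': "wt ?t" "ty_of ?t = Ty0" by (auto simp: obj_def)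
  have g: "good (\<iota>((k, Ty0) := s))" using assms by simp
  show "slice u k s \<in> obj Ty1" unfolding slice_def by (rule fn_abstr(1)[OF g t'])
  show "\<nu> (slice u k s \<cdot> n) = fn u (pr (\<nu> s) (\<nu> n))" if "n \<in> obj Ty0"
    unfolding slice_def fn_abstr(2)[OF g t' that]
    using assms that fn_nu[of u "pair_tm s n"] by (simp add: val_var_bound_upd val_Var)
qed

text \<open>A functional of type 2 can act on all slices of \<open>u\<close> uniformly, because an
  abstraction may stand inside its argument. This turns the quantifier and the search functional
  into operations on \<open>S\<close>.\<close>

lemma S_slice:
  assumes "c \<in> obj Ty2" "u \<in> obj Ty1" "var_bound c \<le> k" "var_bound u \<le> k"
  shows "(\<lambda>e. \<nu> (c \<cdot> slice u k (rep e))) \<in> S"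
proof (rule S_I_rep[of "c \<cdot> abstr (Suc k) Ty0 (u \<cdot> pair_tm (Var k Ty0) (Var (Suc k) Ty0))" _ k])
  show "c \<cdot> abstr (Suc k) Ty0 (u \<cdot> pair_tm (Var k Ty0) (Var (Suc k) Ty0)) \<in> obj Ty0"
    using assms by (intro obj_App[of c Ty1] abstr_obj) auto
qed (use assms in \<open>simp add: slice_def val_var_bound_upd val_Var\<close>)

lemma prim_rec_closed:
  assumes "G \<in> S" shows "\<exists>R\<in>S. R 0 = c \<and> (\<forall>i. R (i + 1) = G (pr i (R i)))"
proof -
  obtain u where u: "u \<in> obj Ty1" "G = fn u" using assms by (auto simp: S_def)
  define k where "k = var_bound u"
  let ?t = "u \<cdot> pair_tm (Var k Ty0) (Var (Suc k) Ty0)"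
  let ?f = "val \<iota> (abstr k Ty0 (abstr (Suc k) Ty0 ?t))"
  have t: "?t \<in> obj Ty0" using u by simp
  have f: "?f \<in> obj (Ty0 \<Rrightarrow> Ty0 \<Rrightarrow> Ty0)" by (intro val_in_obj abstr_obj t) simp
  define r where "r = Rec \<cdot> ?f \<cdot> rep c"
  have r: "r \<in> obj Ty1" unfolding r_def using f by (intro obj_App[of _ Ty0] obj_App[OF obj_consts(7)]) auto
  have "fn r 0 = c" using fn_nu[OF r, of Zero] nu_Rec(1)[OF f, of "rep c" Zero] by (simp add: r_def)
  moreover have "fn r (i + 1) = G (pr i (fn r i))" for i
  proof -
    have ri: "r \<cdot> rep i \<in> obj Ty0" using r by simp
    have "fn r (i + 1) = \<nu> (r \<cdot> (rep i \<^bold>+ One))" using fn_nu[OF r, of "rep i \<^bold>+ One"] by simp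
    also have "\<dots> = \<nu> (?f \<cdot> rep i \<cdot> (r \<cdot> rep i))" unfolding r_def by (rule nu_Rec(2)[OF f]) auto
    also have "\<dots> = \<nu> (val (\<iota>((k, Ty0) := rep i, (Suc k, Ty0) := r \<cdot> rep i)) ?t)"
      by (rule nu_abstr2[OF good_id t _ ri]) simp
    also have "\<dots> = \<nu> (u \<cdot> pair_tm (rep i) (r \<cdot> rep i))"
      by (simp add: val_var_bound_upd val_Var k_def)
    also have "\<dots> = G (pr i (fn r i))"
      using fn_nu[OF u(1), of "pair_tm (rep i) (r \<cdot> rep i)"] ri u(2) by (simp add: fn_def)
    finally show ?thesis .
  qed
  ultimately show ?thesis using r by (intro bexI[of _ "fn r"]) auto
qed

lemma all_nu: "(\<forall>t\<in>obj Ty0. P (\<nu> t)) \<longleftrightarrow> (\<forall>a. P a)"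
  by (metis rep)

lemma ex_nu: "(\<exists>t\<in>obj Ty0. P (\<nu> t)) \<longleftrightarrow> (\<exists>a. P a)"
  by (metis rep)

end

locale aca_model = ordered_model +
  assumes exists2: "tr \<iota> exists2_axiom"
begin

lemma ex_quantifier: "\<exists>\<phi>\<in>obj Ty2. \<forall>u\<in>obj Ty1. (\<nu> (\<phi> \<cdot> u) = 0 \<or> \<nu> (\<phi> \<cdot> u) = 1) \<and>
    (\<nu> (\<phi> \<cdot> u) = 0 \<longleftrightarrow> (\<exists>n\<in>obj Ty0. \<nu> (u \<cdot> n) = 0))"
proof -
  from exists2 obtain \<phi> where \<phi>: "\<phi> \<in> obj Ty2" and
    "tr (\<iota>((0, Ty2) := \<phi>)) (univ Ty1 [Var 0 Ty2] (\<lambda>f.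
       (Var 0 Ty2 \<cdot> f \<^bold>= Zero \<^bold>\<or> Var 0 Ty2 \<cdot> f \<^bold>= One) \<^bold>\<and>
       (Var 0 Ty2 \<cdot> f \<^bold>= Zero \<^bold>\<longleftrightarrow> exis Ty0 [f] (\<lambda>n. f \<cdot> n \<^bold>= Zero))))"
    unfolding exists2_axiom_def sat_exis by auto
  then show ?thesis by (intro bexI[OF _ \<phi>]) (auto simp: sat_univ sat_exis)
qed

lemma ex2_closed:
  assumes "F \<in> S" shows "\<exists>G\<in>S. \<forall>e. G e = 0 \<longleftrightarrow> (\<exists>x. F (pr e x) = 0)"
proof -
  obtain u where u: "u \<in> obj Ty1" "F = fn u" using assms by (auto simp: S_def)
  obtain \<phi> where \<phi>: "\<phi> \<in> obj Ty2" "\<And>u. u \<in> obj Ty1 \<Longrightarrow> \<nu> (\<phi> \<cdot> u) = 0 \<longleftrightarrow> (\<exists>n\<in>obj Ty0. \<nu> (u \<cdot> n) = 0)"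
    using ex_quantifier by blast
  define k where "k = max (var_bound \<phi>) (var_bound u)"
  note s = slice[OF u(1), of k]
  have "\<nu> (\<phi> \<cdot> slice u k (rep e)) = 0 \<longleftrightarrow> (\<exists>x. F (pr e x) = 0)" for e
    using \<phi>(2)[OF s(1)] s(2) ex_nu[of "\<lambda>x. F (pr e x) = 0"] u(2) by (simp add: k_def)
  moreover have "(\<lambda>e. \<nu> (\<phi> \<cdot> slice u k (rep e))) \<in> S"
    using \<phi> u by (intro S_slice) (auto simp: k_def)
  ultimately show ?thesis by (intro bexI) auto
qed

text \<open>This is the search operator \<open>mu\<close>. Once \<open>\<phi>\<close> decides
  whether \<open>u\<close> has a zero, "if there is a zero then \<open>n\<close> is one" is a
  quantifier-free condition with \<open>\<phi>\<close> as a parameter, and any \<open>n\<close>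
  satisfies it when there is none; so the choice axiom applies.\<close>

lemma ex_search: "\<exists>Y\<in>obj Ty2. \<forall>u\<in>obj Ty1. (\<exists>n\<in>obj Ty0. \<nu> (u \<cdot> n) = 0) \<longrightarrow> \<nu> (u \<cdot> (Y \<cdot> u)) = 0"
proof -
  obtain \<phi> where \<phi>: "\<phi> \<in> obj Ty2" "\<And>u. u \<in> obj Ty1 \<Longrightarrow> \<nu> (\<phi> \<cdot> u) = 0 \<longleftrightarrow> (\<exists>n\<in>obj Ty0. \<nu> (u \<cdot> n) = 0)"
    using ex_quantifier by blast
  let ?x = "Var 0 Ty1" and ?n = "Var 0 Ty0" and ?c = "Var 1 Ty2"
  let ?A = "?c \<cdot> ?x \<^bold>= Zero \<^bold>\<longrightarrow> ?x \<cdot> ?n \<^bold>= Zero"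
  let ?AC = "Forall 0 Ty1 (Exists 0 Ty0 ?A) \<^bold>\<longrightarrow>
    Exists 2 Ty2 (Forall 0 Ty1 (subst_fm ?A 0 Ty0 (Var 2 Ty2 \<cdot> Var 0 Ty1)))"
  have "?AC \<in> qf_ac_axioms Ty1 Ty0"
    unfolding qf_ac_axioms_def
    by (rule CollectI, rule exI[of _ ?A], rule exI[of _ 0], rule exI[of _ 0], rule exI[of _ 2]) simp
  then have "tr (\<iota>((1, Ty2) := \<phi>)) ?AC"
    using \<phi>(1) by (intro rca) (auto simp: RCA0_omega_def)
  then have "(\<forall>u\<in>obj Ty1. \<exists>n\<in>obj Ty0. \<nu> (\<phi> \<cdot> u) = 0 \<longrightarrow> \<nu> (u \<cdot> n) = 0) \<longrightarrow>
      (\<exists>Y\<in>obj Ty2. \<forall>u\<in>obj Ty1. \<nu> (\<phi> \<cdot> u) = 0 \<longrightarrow> \<nu> (u \<cdot> (Y \<cdot> u)) = 0)"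
    by simp
  moreover have "\<forall>u\<in>obj Ty1. \<exists>n\<in>obj Ty0. \<nu> (\<phi> \<cdot> u) = 0 \<longrightarrow> \<nu> (u \<cdot> n) = 0"
    using \<phi>(2) obj_consts(1) by blast
  ultimately show ?thesis using \<phi>(2) by auto
qed

lemma choice_closed:
  assumes "F \<in> S" "\<forall>e. \<exists>x. F (pr e x) = 0" shows "\<exists>G\<in>S. \<forall>e. F (pr e (G e)) = 0"
proof -
  obtain u where u: "u \<in> obj Ty1" "F = fn u" using assms by (auto simp: S_def)
  obtain Y where Y: "Y \<in> obj Ty2"
    "\<And>u. u \<in> obj Ty1 \<Longrightarrow> \<exists>n\<in>obj Ty0. \<nu> (u \<cdot> n) = 0 \<Longrightarrow> \<nu> (u \<cdot> (Y \<cdot> u)) = 0"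
    using ex_search by blast
  define k where "k = max (var_bound Y) (var_bound u)"
  note s = slice[OF u(1), of k]
  have "F (pr e (\<nu> (Y \<cdot> slice u k (rep e)))) = 0" for e
  proof -
    have o: "slice u k (rep e) \<in> obj Ty1" using s(1) by (simp add: k_def)
    have v: "\<nu> (slice u k (rep e) \<cdot> n) = F (pr e (\<nu> n))" if "n \<in> obj Ty0" for n
      using s(2)[of "rep e" n] that u(2) by (simp add: k_def)
    have "\<exists>n\<in>obj Ty0. F (pr e (\<nu> n)) = 0" using assms(2) ex_nu[of "\<lambda>x. F (pr e x) = 0"] by blast
    then have "\<nu> (slice u k (rep e) \<cdot> (Y \<cdot> slice u k (rep e))) = 0"
      using v by (intro Y(2)[OF o]) auto
    then show ?thesis using v[of "Y \<cdot> slice u k (rep e)"] obj_App[OF Y(1) o] by simp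
  qed
  moreover have "(\<lambda>e. \<nu> (Y \<cdot> slice u k (rep e))) \<in> S"
    using Y(1) u by (intro S_slice) (auto simp: k_def)
  ultimately show ?thesis by (intro bexI) auto
qed

sublocale aca_functions S pr fs sn p2
proof
  show "(\<lambda>e. if G e \<le> F e then F e - G e else 0) \<in> S" if "F \<in> S" "G \<in> S" for F G
    using S_mn[OF that] by (simp add: mn_eq)
  show "(\<lambda>e. pr (F e) (G e)) \<in> S" if "F \<in> S" "G \<in> S" for F G
    unfolding pr_def by (intro S_pl S_comp[OF in_S(1)] that)
  have "(\<lambda>a. fs a) \<in> S" unfolding fs_def by (intro S_mn S_comp[OF in_S(1)] S_id in_S(3))
  then show fs: "fs \<in> S" by simp
  have "(\<lambda>a. sn a) \<in> S" unfolding sn_def by (intro S_mn S_id in_S(3) fs)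
  then show "sn \<in> S" by simp
  show "F a = 0" if "F \<in> S" "F 0 = 0" "\<And>a. F a = 0 \<Longrightarrow> F (a + 1) = 0" for F a
    using qf_induct[OF qf_eq[OF that(1) S_const[of 0]]] that(2,3) by blast
qed (use S_const S_id S_comp S_pl S_ti in_S pairing p2_simps nn zero_or_one ex2_closed choice_closed prim_rec_closed in auto)

end

section \<open>Reals and real functions in the model\<close>

lemma fresh_list_neq [simp]:
  "fresh (a # Var k \<tau> # ts) \<noteq> k" "fresh (a # b # Var k \<tau> # ts) \<noteq> k"
  "fresh (a # b # c # Var k \<tau> # ts) \<noteq> k" "fresh (a # b # c # d # Var k \<tau> # ts) \<noteq> k"
  by (rule fresh_neq(2)[of _ \<tau>]; simp)+

lemma fresh_list_neq' [simp]:
  "k \<noteq> fresh (Var k \<tau> # ts)" "k \<noteq> fresh (a # Var k \<tau> # ts)" "k \<noteq> fresh (a # b # Var k \<tau> # ts)"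
  "k \<noteq> fresh (a # b # c # Var k \<tau> # ts)" "k \<noteq> fresh (a # b # c # d # Var k \<tau> # ts)"
  by (rule fresh_neq(1)[of _ \<tau>]; simp)+

context aca_model
begin

lemma rat_mk_rat:
  "s \<in> obj Ty0 \<Longrightarrow> t \<in> obj Ty0 \<Longrightarrow> u \<in> obj Ty0 \<Longrightarrow> 0 < \<nu> u \<Longrightarrow>
    rat (\<nu> (mk_rat s t u)) = (emb (\<nu> s) - emb (\<nu> t)) / emb (\<nu> u)"
  by (simp add: mk_rat_def rat_def pd_pos pairing del: emb_simps(3))

text \<open>Fresh names for the parts of a code keep the projections of the pairing out of the field
  calculations that follow.\<close>

lemma rat_parts:
  obtains a b d where "s \<in> obj Ty0 \<Longrightarrow> \<nu> (pos_part s) = a" "s \<in> obj Ty0 \<Longrightarrow> \<nu> (neg_part s) = b"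
    "s \<in> obj Ty0 \<Longrightarrow> \<nu> (denom s) = d" "0 < d" "rat (\<nu> s) = (emb a - emb b) / emb d"
  using that[of "fs (fs (\<nu> s))" "sn (fs (\<nu> s))" "sn (\<nu> s) + 1"] Suc_pos by (simp add: rat_def)

lemma rat_ops [simp]:
  assumes s: "s \<in> obj Ty0"
  shows "t \<in> obj Ty0 \<Longrightarrow> rat (\<nu> (rat_add s t)) = rat (\<nu> s) + rat (\<nu> t)"
    and "rat (\<nu> (rat_uminus s)) = - rat (\<nu> s)"
    and "t \<in> obj Ty0 \<Longrightarrow> rat (\<nu> (rat_sub s t)) = rat (\<nu> s) - rat (\<nu> t)"
    and "rat (\<nu> (rat_abs s)) = \<bar>rat (\<nu> s)\<bar>"
    and "rat (\<nu> (half_pow s)) = h (\<nu> s)" and "rat (\<nu> (two_half_pow s)) = 2 * h (\<nu> s)"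
proof -
  obtain a b d where S: "\<nu> (pos_part s) = a" "\<nu> (neg_part s) = b" "\<nu> (denom s) = d" "0 < d"
    "rat (\<nu> s) = (emb a - emb b) / emb d" using rat_parts[of s] s by metis
  have um: "rat (\<nu> (rat_uminus s)) = - rat (\<nu> s)" 
    if "s \<in> obj Ty0" "\<nu> (pos_part s) = a" "\<nu> (neg_part s) = b" "\<nu> (denom s) = d" "0 < d"
    "rat (\<nu> s) = (emb a - emb b) / emb d" for s a b d
    unfolding rat_uminus_def using that by (subst rat_mk_rat) (auto simp: minus_divide_left simp del: nu_codes)
  show "rat (\<nu> (rat_uminus s)) = - rat (\<nu> s)" using um[OF s S] .
  have add: "rat (\<nu> (rat_add s t)) = rat (\<nu> s) + rat (\<nu> t)" if t: "t \<in> obj Ty0" for t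
  proof -
    obtain a' b' d' where T: "\<nu> (pos_part t) = a'" "\<nu> (neg_part t) = b'" "\<nu> (denom t) = d'" "0 < d'"
      "rat (\<nu> t) = (emb a' - emb b') / emb d'" using rat_parts[of t] t by metis
    have "emb d \<noteq> 0" "emb d' \<noteq> 0" using S(4) T(4) by auto
    have "rat (\<nu> (rat_add s t)) = (emb (a * d' + a' * d) - emb (b * d' + b' * d)) / emb (d * d')"
      unfolding rat_add_def using s t S(1-4) T(1-4) by (subst rat_mk_rat) (simp_all del: nu_codes emb_simps)
    also have "\<dots> = rat (\<nu> s) + rat (\<nu> t)"
      unfolding S(5) T(5) using \<open>emb d \<noteq> 0\<close> \<open>emb d' \<noteq> 0\<close> by (simp add: field_simps)
    finally show ?thesis .
  qed
  show "rat (\<nu> (rat_add s t)) = rat (\<nu> s) + rat (\<nu> t)" if "t \<in> obj Ty0" using add[OF that] .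
  show "rat (\<nu> (rat_sub s t)) = rat (\<nu> s) - rat (\<nu> t)" if t: "t \<in> obj Ty0"
  proof -
    obtain a' b' d' where T: "\<nu> (pos_part t) = a'" "\<nu> (neg_part t) = b'" "\<nu> (denom t) = d'" "0 < d'"
      "rat (\<nu> t) = (emb a' - emb b') / emb d'" using rat_parts[of t] t by metis
    show ?thesis unfolding rat_sub_def using add[of "rat_uminus t"] um[OF t T] t by simp
  qed
  have "emb (mn a b + mn b a) = \<bar>emb a - emb b\<bar>"
    by (cases "a \<le> b") (auto simp: mn_eq emb_diff abs_if not_le antisym)
  then show "rat (\<nu> (rat_abs s)) = \<bar>rat (\<nu> s)\<bar>"
    unfolding rat_abs_def using s S
    by (subst rat_mk_rat) (auto simp: abs_divide less_imp_le simp del: nu_codes emb_simps(3))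
  show "rat (\<nu> (half_pow s)) = h (\<nu> s)" "rat (\<nu> (two_half_pow s)) = 2 * h (\<nu> s)"
    unfolding half_pow_def two_half_pow_def h_def using s p2_pos[of "\<nu> s"]
      emb_simps(3)[of "1 :: 'a" 1]
    by (subst rat_mk_rat; simp)+
qed

lemma tr_rat_less:
  assumes "good A" "s \<in> obj Ty0" "t \<in> obj Ty0"
  shows "tr A (rat_less s t) \<longleftrightarrow> rat (\<nu> (val A s)) < rat (\<nu> (val A t))"
proof -
  let ?s = "val A s" and ?t = "val A t"
  have o: "?s \<in> obj Ty0" "?t \<in> obj Ty0" using assms by (auto intro: val_in_obj)
  obtain a b d where S: "\<nu> (pos_part ?s) = a" "\<nu> (neg_part ?s) = b" "\<nu> (denom ?s) = d" "0 < d"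
    "rat (\<nu> ?s) = (emb a - emb b) / emb d" using rat_parts[of ?s] o by metis
  obtain a' b' d' where T: "\<nu> (pos_part ?t) = a'" "\<nu> (neg_part ?t) = b'" "\<nu> (denom ?t) = d'" "0 < d'"
    "rat (\<nu> ?t) = (emb a' - emb b') / emb d'" using rat_parts[of ?t] o by metis
  have "tr A (rat_less s t) \<longleftrightarrow> a * d' + b' * d < a' * d + b * d'"
    unfolding rat_less_def using o S T by (simp del: nu_codes)
  also have "\<dots> \<longleftrightarrow> emb (a * d' + b' * d) < emb (a' * d + b * d')" by (simp only: emb_simps(7))
  also have "\<dots> \<longleftrightarrow> rat (\<nu> ?s) < rat (\<nu> ?t)" 
    unfolding S(5) T(5) using S(4) T(4) by (simp add: field_simps del: emb_simps(7))
  finally show ?thesis .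
qed

lemma nu_app: "u \<in> obj Ty1 \<Longrightarrow> t \<in> obj Ty0 \<Longrightarrow> \<nu> (u \<cdot> t) = fn u (\<nu> t)"
  by simp

lemma fn_lam:
  assumes "good A" "F (Var (fresh ts) Ty0) \<in> obj Ty0"
  shows "fn (val A (lam Ty0 ts F)) a = \<nu> (val (A((fresh ts, Ty0) := rep a)) (F (Var (fresh ts) Ty0)))"
  unfolding fn_def lam_def using assms by (intro fn_abstr(2) rep(1)) (auto simp: obj_def)

section \<open>Meaning of the order, the distance and the unit interval in the model\<close>

definition rless :: "('a \<Rightarrow> 'a) \<Rightarrow> ('a \<Rightarrow> 'a) \<Rightarrow> bool" where
  "rless x y \<longleftrightarrow> (\<exists>n. rat (x n) + 2 * h n < rat (y n))"

lemma tr_is_real: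
  assumes "good A" "x \<in> obj Ty1" shows "tr A (is_real x) \<longleftrightarrow> real (fn (val A x))"
proof -
  have u: "val A x \<in> obj Ty1" using assms by (rule val_in_obj)
  have "tr A (is_real x) \<longleftrightarrow> (\<forall>n\<in>obj Ty0. \<forall>i\<in>obj Ty0.
      \<bar>rat (fn (val A x) (\<nu> n)) - rat (fn (val A x) (\<nu> n + \<nu> i))\<bar> < h (\<nu> n))"
    unfolding is_real_def sat_univ using assms u
    by (intro ball_cong refl) (simp add: tr_rat_less nu_app del: fn_nu)
  also have "\<dots> \<longleftrightarrow> real (fn (val A x))"
    unfolding real_def using u all_nu[of "\<lambda>n. \<forall>i\<in>obj Ty0. \<bar>rat (fn (val A x) n) - rat (fn (val A x) (n + \<nu> i))\<bar> < h n"]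
      all_nu[of "\<lambda>i. \<bar>rat (fn (val A x) n) - rat (fn (val A x) (n + i))\<bar> < h n" for n] by simp
  finally show ?thesis .
qed

lemma tr_real_less:
  assumes "good A" "x \<in> obj Ty1" "y \<in> obj Ty1"
  shows "tr A (real_less x y) \<longleftrightarrow> rless (fn (val A x)) (fn (val A y))"
proof -
  have u: "val A x \<in> obj Ty1" "val A y \<in> obj Ty1" using assms by (auto intro: val_in_obj)
  have "tr A (real_less x y) \<longleftrightarrow> (\<exists>n\<in>obj Ty0.
      rat (fn (val A x) (\<nu> n)) + 2 * h (\<nu> n) < rat (fn (val A y) (\<nu> n)))"
    unfolding real_less_def sat_exis using assms u
    by (intro bex_cong refl) (simp add: tr_rat_less nu_app del: fn_nu)
  also have "\<dots> \<longleftrightarrow> rless (fn (val A x)) (fn (val A y))"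
    unfolding rless_def by (rule ex_nu)
  finally show ?thesis .
qed

lemma rat_zero_one: "good A \<Longrightarrow> rat (fn (val A real_zero) a) = 0"
  "good A \<Longrightarrow> rat (fn (val A real_one) a) = 1"
  unfolding real_zero_def real_one_def by (simp_all add: fn_lam rat_mk_rat)

lemma rat_dist:
  assumes "good A" "x \<in> obj Ty1" "y \<in> obj Ty1"
  shows "rat (fn (val A (real_dist x y)) a) = \<bar>rat (fn (val A x) (a + 1)) - rat (fn (val A y) (a + 1))\<bar>"
proof -
  have u: "val A x \<in> obj Ty1" "val A y \<in> obj Ty1" using assms by (auto intro: val_in_obj)
  have s: "rat (fn (val A (real_sub x y)) a) = rat (fn (val A x) (a + 1)) - rat (fn (val A y) (a + 1))"
    unfolding real_sub_def using assms u by (simp add: fn_lam nu_app del: fn_nu)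
  have "val A (real_sub x y) \<in> obj Ty1" using assms by (intro val_in_obj) auto
  then show ?thesis unfolding real_dist_def real_abs_def s[symmetric]
    using assms by (simp add: fn_lam nu_app del: fn_nu)
qed

lemma tr_in_unit:
  assumes "good A" "x \<in> obj Ty1" shows "tr A (in_unit x) \<longleftrightarrow> unit (fn (val A x))"
proof -
  let ?x = "fn (val A x)"
  have "tr A (in_unit x) \<longleftrightarrow>
      real ?x \<and> \<not> (\<exists>n. rat (?x n) + 2 * h n < 0) \<and> \<not> (\<exists>n. 1 + 2 * h n < rat (?x n))"
    unfolding in_unit_def using assms by (simp add: tr_is_real tr_real_less rless_def rat_zero_one)
  moreover have "\<not> (r + 2 * h n < 0) \<longleftrightarrow> - (2 * h n) \<le> r" for r n by linarith
  ultimately show ?thesis unfolding unit_def by (auto simp: not_less)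
qed

definition positive :: "('a \<Rightarrow> 'a) \<Rightarrow> bool" where
  "positive e \<longleftrightarrow> real e \<and> (\<exists>n. 2 * h n < rat (e n))"

lemma tr_real_pos:
  assumes "good A" "x \<in> obj Ty1" shows "tr A (real_pos x) \<longleftrightarrow> positive (fn (val A x))"
  unfolding real_pos_def positive_def
  using assms by (simp add: tr_is_real tr_real_less rless_def rat_zero_one)

text \<open>The order of the reals \<open>\<bar>x - y\<bar>\<close> and \<open>e\<close>; the index \<open>n + 1\<close> comes from \<open>real_sub\<close>.\<close>

definition dlt :: "('a \<Rightarrow> 'a) \<Rightarrow> ('a \<Rightarrow> 'a) \<Rightarrow> ('a \<Rightarrow> 'a) \<Rightarrow> bool" where
  "dlt x y e \<longleftrightarrow> (\<exists>n. \<bar>rat (x (n + 1)) - rat (y (n + 1))\<bar> + 2 * h n < rat (e n))"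

lemma tr_dist_less:
  assumes "good A" "x \<in> obj Ty1" "y \<in> obj Ty1" "e \<in> obj Ty1"
  shows "tr A (real_less (real_dist x y) e) \<longleftrightarrow> dlt (fn (val A x)) (fn (val A y)) (fn (val A e))"
  using assms by (simp add: tr_real_less rless_def rat_dist dlt_def)

text \<open>The strict bound at stage \<open>N\<close> has a reserve of \<open>2 * h N\<close>. At
  later stages the reserve absorbs the movement of both sequences, less than
  \<open>2 * h (N + 1)\<close>; at earlier stages that movement is less than the
  \<open>2 * h n\<close> which \<open>dle\<close> tolerates.\<close>

lemma dlt_imp_dle:
  assumes "real x" "real y" "dlt x y (cst c)" shows "dle x y (rat c)"
  unfolding dle_def
proof
  fix n
  obtain N where N: "\<bar>rat (x (N + 1)) - rat (y (N + 1))\<bar> + 2 * h N < rat c"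
    using assms(3) by (auto simp: dlt_def)
  show "\<bar>rat (x n) - rat (y n)\<bar> \<le> rat c + 2 * h n"
  proof (cases "n \<le> N + 1")
    case True
    have "\<bar>rat (x n) - rat (x (N + 1))\<bar> < h n" "\<bar>rat (y n) - rat (y (N + 1))\<bar> < h n"
      using realD[OF assms(1) True] realD[OF assms(2) True] .
    then show ?thesis using N h_pos(1)[of N] by linarith
  next
    case False
    then have le: "N + 1 \<le> n" by simp
    have "\<bar>rat (x (N + 1)) - rat (x n)\<bar> < h (N + 1)" "\<bar>rat (y (N + 1)) - rat (y n)\<bar> < h (N + 1)"
      using realD[OF assms(1) le] realD[OF assms(2) le] .
    then show ?thesis using N h_pos(1)[of N] h_pos(1)[of n] h_Suc[of N] by linarith
  qed
qed

lemma positive_cst: "0 < rat c \<Longrightarrow> positive (cst c)"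
  using ex_h_less[of "rat c / 2"] real_cst by (auto simp: positive_def mult.commute)

lemma positive_bound:
  assumes "positive e"
  shows "\<exists>q>0. \<forall>x y. dle x y q \<longrightarrow> dlt x y e"
proof -
  obtain n where n: "2 * h n < rat (e n)" and re: "real e" using assms by (auto simp: positive_def)
  \<comment> \<open>Three more stages suffice: \<open>e\<close> at \<open>N\<close> still exceeds
    \<open>h n\<close>, while the other side is at most
    \<open>h N + 2 * h (N + 1) + 2 * h N\<close>, which is \<open>4 * h N\<close> and so half of
    \<open>h n\<close>.\<close>
  define N where "N = n + 1 + 1 + 1"
  have hN: "h N = h n / 8" by (simp add: N_def)
  have nN: "n \<le> N" using nn by (simp add: N_def add.assoc)
  have "dlt x y e" if d: "dle x y (h N)" for x y
  proof -
    have "\<bar>rat (x (N + 1)) - rat (y (N + 1))\<bar> \<le> h N + 2 * h (N + 1)" using d unfolding dle_def by blast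
    moreover have "h (N + 1) = h N / 2" by simp
    moreover have "\<bar>rat (e n) - rat (e N)\<bar> < h n" by (rule realD[OF re nN])
    ultimately have "\<bar>rat (x (N + 1)) - rat (y (N + 1))\<bar> + 2 * h N < rat (e N)"
      using n hN h_pos(1)[of n] by linarith
    then show ?thesis unfolding dlt_def by blast
  qed
  then show ?thesis using h_pos(1) by blast
qed

section \<open>Functions on reals, continuity and convergence in the model\<close>

definition code :: "('a \<Rightarrow> 'a) \<Rightarrow> tm" where "code x = (SOME u. u \<in> obj Ty1 \<and> fn u = x)"

lemma code: "x \<in> S \<Longrightarrow> code x \<in> obj Ty1" "x \<in> S \<Longrightarrow> fn (code x) = x"
  using someI[of "\<lambda>u. u \<in> obj Ty1 \<and> fn u = x"] unfolding code_def S_def by blast+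

definition act :: "tm \<Rightarrow> ('a \<Rightarrow> 'a) \<Rightarrow> 'a \<Rightarrow> 'a" where "act g x = fn (g \<cdot> code x)"

text \<open>By extensionality the value depends only on the function that \<open>u\<close>
  represents, so the arbitrary choice made by \<open>code\<close> is harmless and
  \<open>act g\<close> is the operation on functions induced by \<open>g\<close>.\<close>

lemma act_fn: 
  assumes "g \<in> obj (Ty1 \<Rrightarrow> Ty1)" "u \<in> obj Ty1" shows "fn (g \<cdot> u) = act g (fn u)"
proof -
  have c: "code (fn u) \<in> obj Ty1" "fn (code (fn u)) = fn u" using code assms(2) by auto
  have "eqm Ty1 (g \<cdot> u) (g \<cdot> code (fn u))"
    using assms c by (intro eqv_ext[of _ Ty1]) (auto simp: fn_eqm[symmetric] simp del: eqv.simps)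
  then show ?thesis unfolding act_def using assms c by (simp add: fn_eqm[symmetric] del: eqv.simps)
qed

lemma unit_in_S: "unit x \<Longrightarrow> x \<in> S" "positive x \<Longrightarrow> x \<in> S"
  by (auto simp: unit_def positive_def real_def)

text \<open>Two translations of tolerances are needed: \<open>positive_bound\<close> extracts a
  rational one from a positive real, and \<open>dlt_imp_dle\<close> leads from a constant real back
  to its rational value. From left to right they serve for delta and epsilon respectively, in the
  other direction the roles are exchanged.\<close>

lemma tr_continuous_at:
  assumes A: "good A" and g: "g \<in> obj (Ty1 \<Rrightarrow> Ty1)" and x: "x \<in> obj Ty1"
    and u: "unit (fn (val A x))" and r: "\<And>y. unit y \<Longrightarrow> real (act (val A g) y)"
  shows "tr A (continuous_at g x) \<longleftrightarrow> cont (act (val A g)) (fn (val A x))"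
proof -
  let ?X = "fn (val A x)" and ?g = "act (val A g)"
  have o: "val A g \<in> obj (Ty1 \<Rrightarrow> Ty1)" "val A x \<in> obj Ty1" using A g x by (auto intro: val_in_obj)
  have "tr A (continuous_at g x) \<longleftrightarrow> (\<forall>e\<in>obj Ty1. positive (fn e) \<longrightarrow> (\<exists>d\<in>obj Ty1. positive (fn d) \<and>
    (\<forall>y\<in>obj Ty1. unit (fn y) \<longrightarrow> dlt ?X (fn y) (fn d) \<longrightarrow> dlt (?g ?X) (?g (fn y)) (fn e))))"
    unfolding continuous_at_def all_pos_def ex_pos_def all_unit_def
    using A g x o
    by (simp add: sat_univ sat_exis tr_real_pos tr_in_unit tr_dist_less act_fn) blast
  also have "\<dots> \<longleftrightarrow> (\<forall>e\<in>S. positive e \<longrightarrow> (\<exists>d\<in>S. positive d \<and>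
    (\<forall>y\<in>S. unit y \<longrightarrow> dlt ?X y d \<longrightarrow> dlt (?g ?X) (?g y) e)))"
    by (simp add: S_def)
  also have "\<dots> \<longleftrightarrow> cont ?g ?X"
  proof
    assume a: "\<forall>e\<in>S. positive e \<longrightarrow> (\<exists>d\<in>S. positive d \<and>
      (\<forall>y\<in>S. unit y \<longrightarrow> dlt ?X y d \<longrightarrow> dlt (?g ?X) (?g y) e))"
    show "cont ?g ?X" unfolding cont_def
    proof (intro allI impI)
      fix q :: "'a qnum" assume q: "0 < q"
      obtain c where c: "rat c = q" using ex_rat by blast
      then obtain d where d: "positive d" "\<And>y. unit y \<Longrightarrow> dlt ?X y d \<Longrightarrow> dlt (?g ?X) (?g y) (cst c)"
        using a positive_cst[of c] q unit_in_S by blast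
      obtain p where p: "p > 0" "\<And>y. dle ?X y p \<Longrightarrow> dlt ?X y d" using positive_bound[OF d(1)] by blast
      have "dle (?g ?X) (?g y) q" if y: "unit y" "dle ?X y p" for y
        using dlt_imp_dle[OF r[OF u] r[OF y(1)] d(2)[OF y(1) p(2)[OF y(2)]]] c by simp
      then show "\<exists>p>0. \<forall>y. unit y \<longrightarrow> dle ?X y p \<longrightarrow> dle (?g ?X) (?g y) q" using p(1) by blast
    qed
  next
    assume a: "cont ?g ?X"
    show "\<forall>e\<in>S. positive e \<longrightarrow> (\<exists>d\<in>S. positive d \<and>
      (\<forall>y\<in>S. unit y \<longrightarrow> dlt ?X y d \<longrightarrow> dlt (?g ?X) (?g y) e))"
    proof (intro ballI impI)
      fix e assume "positive e"
      then obtain q where q: "q > 0" "\<And>x y. dle x y q \<Longrightarrow> dlt x y e" using positive_bound by blast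
      obtain p where p: "p > 0" "\<And>y. unit y \<Longrightarrow> dle ?X y p \<Longrightarrow> dle (?g ?X) (?g y) q"
        using a q(1) unfolding cont_def by blast
      obtain c where c: "rat c = p" using ex_rat by blast
      have "dlt (?g ?X) (?g y) e" if y: "unit y" "dlt ?X y (cst c)" for y
        using dlt_imp_dle[of ?X y c] u y c by (intro q(2) p(2)) (auto simp: unit_def)
      then show "\<exists>d\<in>S. positive d \<and> (\<forall>y\<in>S. unit y \<longrightarrow> dlt ?X y d \<longrightarrow> dlt (?g ?X) (?g y) e)"
        using positive_cst[of c] c p(1) S_const by (intro bexI[of _ "cst c"]) auto
    qed
  qed
  finally show ?thesis .
qed

lemma unit_fun_real:
  assumes "good A" "g \<in> obj (Ty1 \<Rrightarrow> Ty1)" "tr A (unit_fun g)" "unit y"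
  shows "real (act (val A g) y)"
proof -
  have o: "val A g \<in> obj (Ty1 \<Rrightarrow> Ty1)" using assms by (auto intro: val_in_obj)
  have "tr A (all_unit [g] (\<lambda>x. is_real (g \<cdot> x)))" using assms(3) by (simp add: unit_fun_def)
  then have "\<forall>u\<in>obj Ty1. unit (fn u) \<longrightarrow> real (act (val A g) (fn u))"
    unfolding all_unit_def sat_univ using assms o by (simp add: tr_in_unit tr_is_real act_fn)
  then show ?thesis using assms(4) code[OF unit_in_S(1)[OF assms(4)]] by metis
qed

lemma tr_unit_quantifiers:
  assumes "good A"
  shows "tr A (all_unit ts G) \<longleftrightarrow>
      (\<forall>u\<in>obj Ty1. unit (fn u) \<longrightarrow> tr (A((fresh ts, Ty1) := u)) (G (Var (fresh ts) Ty1)))"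
    and "tr A (ex_unit ts G) \<longleftrightarrow>
      (\<exists>u\<in>obj Ty1. unit (fn u) \<and> tr (A((fresh ts, Ty1) := u)) (G (Var (fresh ts) Ty1)))"
  using assms by (simp_all add: all_unit_def ex_unit_def sat_univ sat_exis tr_in_unit)

lemma tr_continuous_unit:
  assumes A: "good A" and g: "g \<in> obj (Ty1 \<Rrightarrow> Ty1)" and r: "tr A (unit_fun g)"
  shows "tr A (continuous_unit g) \<longleftrightarrow> (\<forall>x. unit x \<longrightarrow> cont (act (val A g)) x)"
    and "tr A (ex_unit [g] (continuous_at g)) \<longleftrightarrow> (\<exists>x. unit x \<and> cont (act (val A g)) x)"
proof -
  let ?k = "fresh [g]"
  have c: "tr (A((?k, Ty1) := u)) (continuous_at g (Var ?k Ty1)) \<longleftrightarrow> cont (act (val A g)) (fn u)"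
    if "u \<in> obj Ty1" "unit (fn u)" for u
    using tr_continuous_at[of "A((?k, Ty1) := u)" g "Var ?k Ty1"] unit_fun_real[OF A g r] A g that by simp
  have "(\<forall>x. unit x \<longrightarrow> P x) \<longleftrightarrow> (\<forall>u\<in>obj Ty1. unit (fn u) \<longrightarrow> P (fn u))" for P
    using code unit_in_S(1) by metis
  then show "tr A (continuous_unit g) \<longleftrightarrow> (\<forall>x. unit x \<longrightarrow> cont (act (val A g)) x)"
    unfolding continuous_unit_def tr_unit_quantifiers[OF A] using c by simp
  have "(\<exists>x. unit x \<and> P x) \<longleftrightarrow> (\<exists>u\<in>obj Ty1. unit (fn u) \<and> P (fn u))" for P
    using code unit_in_S(1) by metis
  then show "tr A (ex_unit [g] (continuous_at g)) \<longleftrightarrow> (\<exists>x. unit x \<and> cont (act (val A g)) x)"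
    unfolding tr_unit_quantifiers[OF A] using c by (simp cong: conj_cong bex_cong)
qed

lemma tr_converges:
  assumes A: "good A" and g: "g \<in> obj (Ty1 \<Rrightarrow> Ty1)" and gs: "gs \<in> obj (Ty0 \<Rrightarrow> Ty1 \<Rrightarrow> Ty1)"
    and t: "tr A (converges_pointwise gs g)" and x: "unit x" and e: "positive e"
  shows "\<exists>m. \<forall>n\<ge>m. dlt (act (val A gs \<cdot> rep n) x) (act (val A g) x) e"
proof -
  have o: "val A g \<in> obj (Ty1 \<Rrightarrow> Ty1)" "val A gs \<in> obj (Ty0 \<Rrightarrow> Ty1 \<Rrightarrow> Ty1)"
    using A g gs by (auto intro: val_in_obj)
  have "\<forall>u\<in>obj Ty1. unit (fn u) \<longrightarrow> (\<forall>e\<in>obj Ty1. positive (fn e) \<longrightarrow> (\<exists>m\<in>obj Ty0. \<forall>n\<in>obj Ty0.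
      \<not> \<nu> n < \<nu> m \<longrightarrow> dlt (act (val A gs \<cdot> n) (fn u)) (act (val A g) (fn u)) (fn e)))"
    using t unfolding converges_pointwise_def all_pos_def
    using A g gs o by (simp add: tr_unit_quantifiers sat_univ sat_exis tr_real_pos tr_dist_less act_fn)
  then obtain m where "m \<in> obj Ty0" and
    m: "\<And>n. n \<in> obj Ty0 \<Longrightarrow> \<not> \<nu> n < \<nu> m \<Longrightarrow> dlt (act (val A gs \<cdot> n) x) (act (val A g) x) e"
    using x e code[OF unit_in_S(1)[OF x]] code[OF unit_in_S(2)[OF e]] by metis
  have "\<forall>n\<ge>\<nu> m. dlt (act (val A gs \<cdot> rep n) x) (act (val A g) x) e" using m[OF rep(1)] by (simp add: not_less)
  then show ?thesis by blast
qed

lemma act_rep: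
  assumes gs: "gs \<in> obj (Ty0 \<Rrightarrow> Ty1 \<Rrightarrow> Ty1)" and n: "n \<in> obj Ty0" and x: "x \<in> S"
  shows "act (gs \<cdot> n) x = act (gs \<cdot> rep (\<nu> n)) x"
proof -
  have c: "code x \<in> obj Ty1" using code x by blast
  have "eqm (Ty1 \<Rrightarrow> Ty1) (gs \<cdot> n) (gs \<cdot> rep (\<nu> n))" using gs n by (intro nu_arg) auto
  then have "eqm Ty1 (gs \<cdot> n \<cdot> code x) (gs \<cdot> rep (\<nu> n) \<cdot> code x)" using c by simp
  then show ?thesis unfolding act_def using gs n c by (simp add: fn_eqm[symmetric] del: eqv.simps)
qed

text \<open>The constant sequence with value \<open>G e\<close> changes with \<open>e\<close>, so it
  is built by an abstraction inside the term. Abstracting over \<open>k\<close> afterwards makes the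
  value a function of \<open>e\<close>; extensionality lets \<open>m \<cdot> rep e\<close> stand for
  the representative of \<open>M e\<close>.\<close>

lemma S_act:
  assumes gs: "gs \<in> obj (Ty0 \<Rrightarrow> Ty1 \<Rrightarrow> Ty1)" and S: "M \<in> S" "G \<in> S" "J \<in> S"
  shows "(\<lambda>e. act (gs \<cdot> rep (M e)) (\<lambda>_. G e) (J e)) \<in> S"
proof -
  obtain m g j where o: "m \<in> obj Ty1" "g \<in> obj Ty1" "j \<in> obj Ty1" "M = fn m" "G = fn g" "J = fn j"
    using S by (auto simp: S_def)
  define k where "k = max (var_bound gs) (max (var_bound m) (max (var_bound g) (var_bound j)))"
  let ?c = "abstr (Suc k) Ty0 (g \<cdot> Var k Ty0)"
  let ?t = "gs \<cdot> (m \<cdot> Var k Ty0) \<cdot> ?c \<cdot> (j \<cdot> Var k Ty0)"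
  have c: "?c \<in> obj Ty1" using o by (intro abstr_obj) simp
  show ?thesis
  proof (rule S_I_rep[of ?t _ k])
    show "?t \<in> obj Ty0" using gs o c by simp
    fix e
    let ?A = "\<iota>((k, Ty0) := rep e)"
    let ?C = "val ?A ?c"
    have C: "?C \<in> obj Ty1" using c by (intro val_in_obj) auto
    have "fn ?C = (\<lambda>_. G e)"
    proof
      fix a
      have "fn ?C a = \<nu> (val (?A((Suc k, Ty0) := rep a)) (g \<cdot> Var k Ty0))"
        unfolding fn_def using o by (intro fn_abstr(2) rep(1) good_upd good_id) (auto simp: obj_def)
      also have "\<dots> = G e" using o by (simp add: val_var_bound_upd val_Var k_def nu_app del: fn_nu)
      finally show "fn ?C a = G e" .
    qed
    moreover have "val ?A ?t = gs \<cdot> (m \<cdot> rep e) \<cdot> ?C \<cdot> (j \<cdot> rep e)"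
      by (simp add: val_var_bound_upd val_Var k_def)
    moreover have "\<nu> (gs \<cdot> (m \<cdot> rep e) \<cdot> ?C \<cdot> (j \<cdot> rep e)) = fn (gs \<cdot> (m \<cdot> rep e) \<cdot> ?C) (J e)"
      using gs o C by (simp add: nu_app del: fn_nu)
    moreover have "fn (gs \<cdot> (m \<cdot> rep e) \<cdot> ?C) = act (gs \<cdot> (m \<cdot> rep e)) (fn ?C)"
      using gs o C by (intro act_fn) auto
    moreover have "act (gs \<cdot> (m \<cdot> rep e)) (fn ?C) = act (gs \<cdot> rep (M e)) (fn ?C)"
      using act_rep[OF gs, of "m \<cdot> rep e" "fn ?C"] o C by (simp add: nu_app del: fn_nu)
    ultimately show "act (gs \<cdot> rep (M e)) (\<lambda>_. G e) (J e) = \<nu> (val ?A ?t)" by simp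
  qed
qed

theorem no_counterexample: "tr \<iota> goal_fm"
proof -
  have *: "tr A (ex_unit [f] (continuous_at f))"
    if A: "good A" and f: "f \<in> obj (Ty1 \<Rrightarrow> Ty1)" and gs: "gs \<in> obj (Ty0 \<Rrightarrow> Ty1 \<Rrightarrow> Ty1)"
      and uf: "tr A (unit_fun f)" and conv: "tr A (converges_pointwise gs f)"
      and seq: "tr A (univ Ty0 [gs] (\<lambda>n. unit_fun (gs \<cdot> n) \<^bold>\<and> continuous_unit (gs \<cdot> n)))"
    for A f gs
  proof -
    define F where "F n = act (val A gs \<cdot> rep n)" for n
    have o: "val A gs \<in> obj (Ty0 \<Rrightarrow> Ty1 \<Rrightarrow> Ty1)" using A gs by (auto intro: val_in_obj)
    let ?k = "fresh [gs]"
    have n: "tr (A((?k, Ty0) := rep n)) (unit_fun (gs \<cdot> Var ?k Ty0))"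
      "tr (A((?k, Ty0) := rep n)) (continuous_unit (gs \<cdot> Var ?k Ty0))"
      "good (A((?k, Ty0) := rep n))" "gs \<cdot> Var ?k Ty0 \<in> obj (Ty1 \<Rrightarrow> Ty1)" for n
      using seq A gs by (auto simp: sat_univ)
    have F: "act (val (A((?k, Ty0) := rep n)) (gs \<cdot> Var ?k Ty0)) = F n" for n
      by (simp add: F_def)
    have r: "real (F n x)" if "unit x" for n x
      using unit_fun_real[OF n(3,4,1) that] unfolding F .
    have fr: "real (act (val A f) x)" if "unit x" for x
      using unit_fun_real[OF A f uf that] .
    interpret convergent_sequence S pr fs sn p2 F "act (val A f)"
    proof
      show "(\<lambda>e. F (M e) (\<lambda>_. G e) (J e)) \<in> S" if "M \<in> S" "G \<in> S" "J \<in> S" for M G J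
        unfolding F_def using S_act[OF o that] .
      show "cont (F n) x" if "unit x" for x n
        using n(2)[of n] that unfolding tr_continuous_unit(1)[OF n(3,4,1)] F by blast
      show "\<exists>m. \<forall>n\<ge>m. dle (F n x) (act (val A f) x) q" if x: "unit x" and q: "0 < q" for x q
      proof -
        obtain c where c: "rat c = q" using ex_rat by blast
        then obtain m where "\<forall>n\<ge>m. dlt (F n x) (act (val A f) x) (\<lambda>_. c)"
          using tr_converges[OF A f gs conv x positive_cst[of c]] q unfolding F_def by blast
        then show ?thesis using dlt_imp_dle[OF r[OF x] fr[OF x]] c by blast
      qed
    qed (fact r fr)+
    show ?thesis unfolding tr_continuous_unit(2)[OF A f uf] by (rule ex_continuity_point)
  qed
  show ?thesis
    unfolding goal_fm_def sat_univ
    \<comment> \<open>The binders choose index 0 for \<open>f\<close> and then, avoiding it, index 1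
      for the sequence.\<close>
    by (auto intro!: *[where gs = "Var 1 (Ty0 \<Rrightarrow> Ty1 \<Rrightarrow> Ty1)"] simp: sat_univ)
qed

end

theorem theorem2p7:
  shows "ACA0_omega \<turnstile>
    univ (Ty1 \<Rrightarrow> Ty1) [] (\<lambda>f. univ (Ty0 \<Rrightarrow> Ty1 \<Rrightarrow> Ty1) [f] (\<lambda>fs.
      unit_fun f \<^bold>\<and> usc_unit f \<^bold>\<and>
      univ Ty0 [fs] (\<lambda>n. unit_fun (fs \<cdot> n) \<^bold>\<and> continuous_unit (fs \<cdot> n)) \<^bold>\<and>
      converges_pointwise fs f
      \<^bold>\<longrightarrow> ex_unit [f] (\<lambda>x. continuous_at f x)))"
proof -
  have "ACA0_omega \<turnstile> goal_fm"
  proof (rule ccontr)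
    assume "\<not> (ACA0_omega \<turnstile> goal_fm)"
    from countermodel_mnat[OF this] obtain \<nu> where c: "countermodel \<nu> (<) (+) (*) 0 (1 :: mnat)" ..
    then interpret num_model \<nu> "(<)" "(+)" "(*)" 0 "1 :: mnat" by (simp add: countermodel_def)
    interpret aca_model \<nu> by unfold_locales (use c in \<open>simp add: countermodel_def\<close>)
    show False using c no_counterexample by (simp add: countermodel_def)
  qed
  then show ?thesis unfolding goal_fm_def .
qed

end
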